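(* Let $\mathcal H=\mathcal H(2n,\Gamma)$ be the Hamiltonian Lie algebra of Cartan type defined in the context. Then the following hold. (1) Every Lie bialgebra structure on $\mathcal H$ is triangular; that is, if $\Delta:\mathcal H\to\mathcal H\otimes\mathcal H$ is a linear map such that $(\mathcal H,[\cdot,\cdot],\Delta)$ is a Lie bialgebra, then there is $r\in \mathrm{Im}(1\otimes 1-\tau)\subset\mathcal H\otimes\mathcal H$ such that $\Delta(x)=x\cdot r$ for all $x\in\mathcal H$ and $c(r)=0$. (2) An element $r\in\mathcal H\otimes\mathcal H$ satisfies the classical Yang-Baxter equation $c(r)=0$ if and only if $c(r)$ is ad-invariant, i.e. $x\cdot c(r)=0$ for all $x\in\mathcal H$. (3) Regarding $V=\mathcal H\otimes\mathcal H$ as an $\mathcal H$-module under the adjoint diagonal action, one has $H^1(\mathcal H,V)=\mathrm{Der}(\mathcal H,V)/\mathrm{Inn}(\mathcal H,V)=0$.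
   Context: **The Lie algebra $\mathcal H$.** Let $\mathbb F$ be a field of characteristic zero and $n\ge 1$ an integer. Let $\Gamma$ be a nondegenerate additive subgroup of $\mathbb F^{2n}$, i.e. an additive subgroup containing an $\mathbb F$-basis of $\mathbb F^{2n}$. Fix an $\mathbb F$-basis $\{\varepsilon_p\mid 1\le p\le 2n\}\subset\Gamma$ of $\mathbb F^{2n}$. For $1\le p\le n$ write $\overline p=n+p$. An element $\alpha\in\Gamma$ is written $\alpha=(\alpha_1,\alpha_{\overline 1},\dots,\alpha_n,\alpha_{\overline n})$, where $\alpha_p,\alpha_{\overline p}\in\mathbb F$ are its coordinates with respect to this basis, i.e. $\alpha=\sum_{p=1}^n(\alpha_p\varepsilon_p+\alpha_{\overline p}\varepsilon_{\overline p})$. Put $\sigma_p=\varepsilon_p+\varepsilon_{\overline p}$ for $1\le p\le n$. Let $\overline{\mathcal H}=\mathrm{span}_{\mathbb F}\{t^\alpha\mid\alpha\in\Gamma\}$ be the group algebra of $\Gamma$, with product $t^\alpha\cdot t^\beta=t^{\alpha+\beta}$, and with Lie bracket $$[t^\alpha,t^\beta]=\sum_{i=1}^n(\alpha_i\beta_{\overline i}-\beta_i\alpha_{\overline i})\,t^{\alpha+\beta-\sigma_i},\qquad \alpha,\beta\in\Gamma.$$ Let $\mathcal H=\overline{\mathcal H}/\mathbb F\cdot 1$, where $1=t^0$, with the induced Lie bracket; the image of $t^\alpha$ in $\mathcal H$ is still denoted $t^\alpha$ (so $t^0=0$ in $\mathcal H$). **Lie bialgebras.** Let $L$ be a vector space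 over $\mathbb F$. Let $\tau:L\otimes L\to L\otimes L$, $\tau(x\otimes y)=y\otimes x$, and $\xi:L^{\otimes 3}\to L^{\otimes 3}$, $\xi(x_1\otimes x_2\otimes x_3)=x_2\otimes x_3\otimes x_1$; $1$ denotes the identity map. A Lie coalgebra is a pair $(L,\Delta)$ with $\Delta:L\to L\otimes L$ linear such that $\mathrm{Im}\,\Delta\subset\mathrm{Im}(1\otimes 1-\tau)$ and $(1\otimes1\otimes1+\xi+\xi^2)\cdot(1\otimes\Delta)\cdot\Delta=0$ as a map $L\to L^{\otimes 3}$. For a Lie algebra $L$, the adjoint diagonal action of $L$ on $L\otimes L$ is $x\cdot\left(\sum_i a_i\otimes b_i\right)=\sum_i([x,a_i]\otimes b_i+a_i\otimes[x,b_i])$, and the diagonal action on $L^{\otimes 3}$ is defined likewise. A Lie bialgebra is a triple $(L,[\cdot,\cdot],\Delta)$ where $(L,[\cdot,\cdot])$ is a Lie algebra, $(L,\Delta)$ is a Lie coalgebra, and $\Delta([x,y])=x\cdot\Delta y-y\cdot\Delta x$ for all $x,y\in L$. **CYBE.** For $r=\sum_i a_i\otimes b_i\in L\otimes L$ set $c(r)=[r^{12},r^{13}]+[r^{12},r^{23}]+[r^{13},r^{23}]$, where $r^{12}=\sum_i a_i\otimes b_i\otimes 1$, $r^{13}=\sum_i a_i\otimes 1\otimes b_i$, $r^{23}=\sum_i 1\otimes a_i\otimes b_i$ are elements of $\mathcal U(L)\otimes\mathcal U(L)\otimes\mathcal U(L)$, $\mathcal U(L)$ is the universal enveloping algebra of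 $L$, $1$ is its identity element, and brackets are commutators. (Then $c(r)\in L\otimes L\otimes L$.) A coboundary Lie bialgebra is a 4-tuple $(L,[\cdot,\cdot],\Delta,r)$ where $(L,[\cdot,\cdot],\Delta)$ is a Lie bialgebra, $r\in\mathrm{Im}(1\otimes1-\tau)$ and $\Delta=\Delta_r$, with $\Delta_r(x)=x\cdot r$ for $x\in L$; it is called triangular if $c(r)=0$. **Derivations.** For an $\mathcal H$-module $V$, $\mathrm{Der}(\mathcal H,V)$ is the space of linear maps $d:\mathcal H\to V$ with $d([x,y])=x\cdot d(y)-y\cdot d(x)$ for all $x,y\in\mathcal H$, and $\mathrm{Inn}(\mathcal H,V)$ is the subspace of inner derivations $a_{\mathrm{inn}}:x\mapsto x\cdot a$, $a\in V$. One has $H^1(\mathcal H,V)\cong\mathrm{Der}(\mathcal H,V)/\mathrm{Inn}(\mathcal H,V)$. *)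

theory Defs
  imports "HOL-Analysis.Analysis" "HOL-Library.Poly_Mapping"
begin

section \<open>Vector spaces with a distinguished basis, and their tensor products\<close>

text \<open>
  A vector space with basis \<open>S\<close> is realised as the space \<open>fspace S\<close> of finitely supported
  functions on \<open>S\<close>; the basis vector belonging to \<open>a\<close> is \<open>Poly_Mapping.single a 1\<close>.
  The tensor product of \<open>fspace S\<close> and \<open>fspace S'\<close> is \<open>fspace (S \<times> S')\<close>, with pure tensors
  given by \<open>tensor\<close> below (see \<open>tensor_universal\<close> for the universal property).
  Triple tensor products are bracketed to the right.
\<close>

definition scal :: "'f::field \<Rightarrow> ('a \<Rightarrow>\<^sub>0 'f) \<Rightarrow> ('a \<Rightarrow>\<^sub>0 'f)" (infixr \<open>\<odot>\<close> 75)
  where "c \<odot> f = Poly_Mapping.map ((*) c) f"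

lemma lookup_scal [simp]: "Poly_Mapping.lookup (c \<odot> f) a = c * Poly_Mapping.lookup f a"
  unfolding scal_def by (transfer) (auto simp: when_def)

interpretation fs: vector_space "scal :: 'f::field \<Rightarrow> ('a \<Rightarrow>\<^sub>0 'f) \<Rightarrow> ('a \<Rightarrow>\<^sub>0 'f)"
  by unfold_locales (auto intro!: poly_mapping_eqI simp: lookup_add algebra_simps)

definition fspace :: "'a set \<Rightarrow> ('a \<Rightarrow>\<^sub>0 'f::field) set"
  where "fspace S = {f. Poly_Mapping.keys f \<subseteq> S}"

definition lin :: "('a \<Rightarrow> ('b \<Rightarrow>\<^sub>0 'f)) \<Rightarrow> ('a \<Rightarrow>\<^sub>0 'f) \<Rightarrow> ('b \<Rightarrow>\<^sub>0 'f::field)"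
  \<comment> \<open>the linear extension of a map given on basis vectors\<close>
  where "lin \<phi> f = (\<Sum>a\<in>Poly_Mapping.keys f. Poly_Mapping.lookup f a \<odot> \<phi> a)"

definition bilin :: "('a \<Rightarrow> 'b \<Rightarrow> ('c \<Rightarrow>\<^sub>0 'f)) \<Rightarrow> ('a \<Rightarrow>\<^sub>0 'f) \<Rightarrow> ('b \<Rightarrow>\<^sub>0 'f) \<Rightarrow> ('c \<Rightarrow>\<^sub>0 'f::field)"
  where "bilin \<phi> f g = lin (\<lambda>a. lin (\<phi> a) g) f"

definition tensor :: "('a \<Rightarrow>\<^sub>0 'f) \<Rightarrow> ('b \<Rightarrow>\<^sub>0 'f) \<Rightarrow> (('a \<times> 'b) \<Rightarrow>\<^sub>0 'f::field)" (infixr \<open>\<otimes>\<^sub>t\<close> 78)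
  where "x \<otimes>\<^sub>t y = bilin (\<lambda>a b. Poly_Mapping.single (a, b) 1) x y"

definition linear_into ::
  "('a \<Rightarrow>\<^sub>0 'f) set \<Rightarrow> ('b \<Rightarrow>\<^sub>0 'f) set \<Rightarrow> (('a \<Rightarrow>\<^sub>0 'f) \<Rightarrow> ('b \<Rightarrow>\<^sub>0 'f::field)) \<Rightarrow> bool"
  where "linear_into V W d \<longleftrightarrow>
    (\<forall>x\<in>V. d x \<in> W) \<and>
    (\<forall>x\<in>V. \<forall>y\<in>V. d (x + y) = d x + d y) \<and>
    (\<forall>c. \<forall>x\<in>V. d (c \<odot> x) = c \<odot> d x)"

definition tmap ::
  "(('a \<Rightarrow>\<^sub>0 'f) \<Rightarrow> ('c \<Rightarrow>\<^sub>0 'f)) \<Rightarrow> (('b \<Rightarrow>\<^sub>0 'f) \<Rightarrow> ('d \<Rightarrow>\<^sub>0 'f))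
    \<Rightarrow> (('a \<times> 'b) \<Rightarrow>\<^sub>0 'f) \<Rightarrow> (('c \<times> 'd) \<Rightarrow>\<^sub>0 'f::field)"
  \<comment> \<open>the tensor product of two linear maps, see \<open>tmap_tensor\<close>\<close>
  where "tmap f g = lin (\<lambda>(a, b). f (Poly_Mapping.single a 1) \<otimes>\<^sub>t g (Poly_Mapping.single b 1))"

definition twist :: "(('a \<times> 'a) \<Rightarrow>\<^sub>0 'f) \<Rightarrow> (('a \<times> 'a) \<Rightarrow>\<^sub>0 'f::field)"
  where "twist = lin (\<lambda>(a, b). Poly_Mapping.single (b, a) 1)"

definition cyc :: "(('a \<times> 'a \<times> 'a) \<Rightarrow>\<^sub>0 'f) \<Rightarrow> (('a \<times> 'a \<times> 'a) \<Rightarrow>\<^sub>0 'f::field)"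
  where "cyc = lin (\<lambda>(a, b, c). Poly_Mapping.single (b, c, a) 1)"

definition skew :: "'a set \<Rightarrow> (('a \<times> 'a) \<Rightarrow>\<^sub>0 'f::field) set"
  \<comment> \<open>the image of \<open>1 \<otimes> 1 - \<tau>\<close> on \<open>L \<otimes> L\<close>, where \<open>L = fspace S\<close>\<close>
  where "skew S = (\<lambda>u. u - twist u) ` fspace (S \<times> S)"

subsection \<open>Basic facts\<close>

lemma fspace_0: "0 \<in> fspace S"
  by (simp add: fspace_def)

lemma fspace_add: "x \<in> fspace S \<Longrightarrow> y \<in> fspace S \<Longrightarrow> x + y \<in> fspace S"
  using Poly_Mapping.keys_add[of x y] by (auto simp: fspace_def)

lemma fspace_scal: "x \<in> fspace S \<Longrightarrow> c \<odot> x \<in> fspace S"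
  by (auto simp: fspace_def in_keys_iff)

lemma fspace_sum: "(\<And>i. i \<in> I \<Longrightarrow> x i \<in> fspace S) \<Longrightarrow> (\<Sum>i\<in>I. x i) \<in> fspace S"
  by (induction I rule: infinite_finite_induct) (auto intro: fspace_add fspace_0)

lemma fspace_single: "a \<in> S \<Longrightarrow> Poly_Mapping.single a c \<in> fspace S"
  by (auto simp: fspace_def)

lemma lin_superset:
  assumes "finite A" "Poly_Mapping.keys f \<subseteq> A"
  shows "lin \<phi> f = (\<Sum>a\<in>A. Poly_Mapping.lookup f a \<odot> \<phi> a)"
  unfolding lin_def using assms
  by (intro sum.mono_neutral_left) (auto simp: in_keys_iff)

lemma lin_add: "lin \<phi> (f + g) = lin \<phi> f + lin \<phi> g"
proof -
  let ?A = "Poly_Mapping.keys f \<union> Poly_Mapping.keys g"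
  have "Poly_Mapping.keys (f + g) \<subseteq> ?A" by (rule Poly_Mapping.keys_add)
  then show ?thesis
    by (simp add: lin_superset[of ?A] lookup_add fs.scale_left_distrib sum.distrib)
qed

lemma lin_scal: "lin \<phi> (c \<odot> f) = c \<odot> lin \<phi> f"
proof -
  have "Poly_Mapping.keys (c \<odot> f) \<subseteq> Poly_Mapping.keys f" by (auto simp: in_keys_iff)
  then show ?thesis
    by (simp add: lin_superset[of "Poly_Mapping.keys f"] fs.scale_sum_right)
qed

lemma lin_0 [simp]: "lin \<phi> 0 = 0"
  by (simp add: lin_def)

lemma lin_sum: "lin \<phi> (\<Sum>i\<in>I. f i) = (\<Sum>i\<in>I. lin \<phi> (f i))"
  by (induction I rule: infinite_finite_induct) (auto simp: lin_add)

lemma lin_diff: "lin \<phi> (f - g) = lin \<phi> f - lin \<phi> g"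
  using lin_add[of \<phi> "f - g" g] by simp

lemma lin_single [simp]: "lin \<phi> (Poly_Mapping.single a c) = c \<odot> \<phi> a"
  by (cases "c = 0") (simp_all add: lin_def)

lemma lin_id: "lin (\<lambda>a. Poly_Mapping.single a 1) f = f"
  by (rule poly_mapping_eqI)
    (auto simp: lin_def lookup_sum lookup_single when_def sum.If_cases in_keys_iff
      if_distrib[of "(*) _"] cong: if_cong)

lemma lin_unique:
  assumes "linear_into (fspace S) UNIV d" and "x \<in> fspace S"
  shows "d x = lin (\<lambda>a. d (Poly_Mapping.single a 1)) x"
proof -
  have *: "d (\<Sum>a\<in>A. Poly_Mapping.lookup x a \<odot> Poly_Mapping.single a 1)
      = (\<Sum>a\<in>A. Poly_Mapping.lookup x a \<odot> d (Poly_Mapping.single a 1))"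
    if "finite A" "A \<subseteq> S" for A using that
  proof (induction A rule: finite_induct)
    case empty
    have "d (0 \<odot> 0) = 0 \<odot> d 0" using assms(1) fspace_0 unfolding linear_into_def by blast
    then show ?case by simp
  next
    case (insert a A)
    have 1: "Poly_Mapping.single a 1 \<in> fspace S"
      using insert by (auto intro: fspace_single)
    have 2: "(\<Sum>a\<in>A. Poly_Mapping.lookup x a \<odot> Poly_Mapping.single a 1) \<in> fspace S"
      using insert by (auto intro!: fspace_sum fspace_scal fspace_single)
    have "d (Poly_Mapping.lookup x a \<odot> Poly_Mapping.single a 1)
        = Poly_Mapping.lookup x a \<odot> d (Poly_Mapping.single a 1)"
      using 1 assms(1) unfolding linear_into_def by blast
    moreover have "d (u + v) = d u + d v" if "u \<in> fspace S" "v \<in> fspace S" for u v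
      using that assms(1) unfolding linear_into_def by blast
    ultimately show ?case
      using insert 2 fspace_scal[OF 1, of "Poly_Mapping.lookup x a"] by simp
  qed
  show ?thesis
    using *[of "Poly_Mapping.keys x"] assms(2) lin_id[of x]
    by (simp add: fspace_def lin_def)
qed

lemma lookup_tensor:
  "Poly_Mapping.lookup (x \<otimes>\<^sub>t y) (a, b) = Poly_Mapping.lookup x a * Poly_Mapping.lookup y b"
proof -
  have "Poly_Mapping.lookup (x \<otimes>\<^sub>t y) (a, b)
      = (\<Sum>a'\<in>Poly_Mapping.keys x. \<Sum>b'\<in>Poly_Mapping.keys y.
          if a' = a then (if b' = b then Poly_Mapping.lookup x a' * Poly_Mapping.lookup y b' else 0)
          else 0)"
    by (auto simp: tensor_def bilin_def lin_def lookup_sum lookup_single when_def sum_distrib_left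
        intro!: sum.cong)
  also have "\<dots> = (\<Sum>a'\<in>Poly_Mapping.keys x. if a' = a then
      (\<Sum>b'\<in>Poly_Mapping.keys y. if b' = b then Poly_Mapping.lookup x a' * Poly_Mapping.lookup y b' else 0)
      else 0)"
    by (intro sum.cong) auto
  also have "\<dots> = Poly_Mapping.lookup x a * Poly_Mapping.lookup y b"
    by (simp add: in_keys_iff)
  finally show ?thesis .
qed

lemma tensor_add_left: "(x + x') \<otimes>\<^sub>t y = x \<otimes>\<^sub>t y + x' \<otimes>\<^sub>t y"
  by (rule poly_mapping_eqI) (auto simp: lookup_tensor lookup_add algebra_simps split: prod.splits)

lemma tensor_add_right: "x \<otimes>\<^sub>t (y + y') = x \<otimes>\<^sub>t y + x \<otimes>\<^sub>t y'"
  by (rule poly_mapping_eqI) (auto simp: lookup_tensor lookup_add algebra_simps split: prod.splits)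

lemma tensor_diff_left: "(x - x') \<otimes>\<^sub>t y = x \<otimes>\<^sub>t y - x' \<otimes>\<^sub>t y"
  by (rule poly_mapping_eqI) (auto simp: lookup_tensor lookup_minus algebra_simps split: prod.splits)

lemma tensor_diff_right: "x \<otimes>\<^sub>t (y - y') = x \<otimes>\<^sub>t y - x \<otimes>\<^sub>t y'"
  by (rule poly_mapping_eqI) (auto simp: lookup_tensor lookup_minus algebra_simps split: prod.splits)

lemma tensor_scal_left: "(c \<odot> x) \<otimes>\<^sub>t y = c \<odot> (x \<otimes>\<^sub>t y)"
  by (rule poly_mapping_eqI) (auto simp: lookup_tensor algebra_simps split: prod.splits)

lemma tensor_scal_right: "x \<otimes>\<^sub>t (c \<odot> y) = c \<odot> (x \<otimes>\<^sub>t y)"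
  by (rule poly_mapping_eqI) (auto simp: lookup_tensor algebra_simps split: prod.splits)

lemma tensor_0_left [simp]: "0 \<otimes>\<^sub>t y = 0"
  by (rule poly_mapping_eqI) (auto simp: lookup_tensor)

lemma tensor_0_right [simp]: "x \<otimes>\<^sub>t 0 = 0"
  by (rule poly_mapping_eqI) (auto simp: lookup_tensor)

lemma tensor_sum_left: "(\<Sum>i\<in>I. x i) \<otimes>\<^sub>t y = (\<Sum>i\<in>I. x i \<otimes>\<^sub>t y)"
  by (induction I rule: infinite_finite_induct) (simp_all add: tensor_add_left)

lemma tensor_sum_right: "x \<otimes>\<^sub>t (\<Sum>i\<in>I. y i) = (\<Sum>i\<in>I. x \<otimes>\<^sub>t y i)"
  by (induction I rule: infinite_finite_induct) (simp_all add: tensor_add_right)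

lemma tensor_single: "Poly_Mapping.single a 1 \<otimes>\<^sub>t Poly_Mapping.single b 1 = Poly_Mapping.single (a, b) 1"
  by (simp add: tensor_def bilin_def)

lemma tensor_in_fspace: "x \<in> fspace S \<Longrightarrow> y \<in> fspace S' \<Longrightarrow> x \<otimes>\<^sub>t y \<in> fspace (S \<times> S')"
  by (auto simp: fspace_def in_keys_iff lookup_tensor)

lemma lin_cong: "(\<And>a. a \<in> Poly_Mapping.keys x \<Longrightarrow> \<phi> a = \<psi> a) \<Longrightarrow> lin \<phi> x = lin \<psi> x"
  by (simp add: lin_def)

lemma lin_in_fspace: "(\<And>a. a \<in> Poly_Mapping.keys x \<Longrightarrow> \<phi> a \<in> fspace S) \<Longrightarrow> lin \<phi> x \<in> fspace S"
  by (auto simp: lin_def intro!: fspace_sum fspace_scal)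

lemma lin_lin: "lin \<psi> (lin \<phi> x) = lin (\<lambda>a. lin \<psi> (\<phi> a)) x"
  by (simp add: lin_def[of \<phi>] lin_def[of "\<lambda>a. lin \<psi> (\<phi> a)"] lin_sum lin_scal)

lemma lin_tensor: "lin \<phi> (x \<otimes>\<^sub>t y) = lin (\<lambda>a. lin (\<lambda>b. \<phi> (a, b)) y) x"
  by (simp add: tensor_def bilin_def lin_lin)

lemma tensor_lin_lin: "lin \<phi> x \<otimes>\<^sub>t lin \<psi> y = lin (\<lambda>a. lin (\<lambda>b. \<phi> a \<otimes>\<^sub>t \<psi> b) y) x"
  by (simp only: lin_def tensor_sum_left tensor_scal_left)
    (simp only: tensor_sum_right tensor_scal_right)

lemma tmap_tensor:
  assumes "linear_into (fspace S) UNIV f" "linear_into (fspace S') UNIV g"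
    and "x \<in> fspace S" "y \<in> fspace S'"
  shows "tmap f g (x \<otimes>\<^sub>t y) = f x \<otimes>\<^sub>t g y"
  unfolding lin_unique[OF assms(1,3)] lin_unique[OF assms(2,4)] tensor_lin_lin
  by (simp add: tmap_def lin_tensor)

lemma linear_into_lin: "linear_into V UNIV (lin \<phi>)"
  by (simp add: linear_into_def lin_add lin_scal)

theorem tensor_universal:
  fixes B :: "('a \<Rightarrow>\<^sub>0 'f::field) \<Rightarrow> ('b \<Rightarrow>\<^sub>0 'f) \<Rightarrow> ('c \<Rightarrow>\<^sub>0 'f)"
  assumes B1: "\<And>x. x \<in> fspace S \<Longrightarrow> linear_into (fspace S') UNIV (B x)"
    and B2: "\<And>y. y \<in> fspace S' \<Longrightarrow> linear_into (fspace S) UNIV (\<lambda>x. B x y)"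
  defines "P \<equiv> \<lambda>h. linear_into (fspace (S \<times> S')) UNIV h \<and>
    (\<forall>x\<in>fspace S. \<forall>y\<in>fspace S'. h (x \<otimes>\<^sub>t y) = B x y)"
  shows "\<exists>h. P h" and "P h \<Longrightarrow> P h' \<Longrightarrow> u \<in> fspace (S \<times> S') \<Longrightarrow> h u = h' u"
proof -
  have "P (lin (\<lambda>(a, b). B (Poly_Mapping.single a (1::'f)) (Poly_Mapping.single b (1::'f))))"
    unfolding P_def
  proof (intro conjI ballI linear_into_lin)
    fix x :: "'a \<Rightarrow>\<^sub>0 'f" and y :: "'b \<Rightarrow>\<^sub>0 'f"
    assume x: "x \<in> fspace S" and y: "y \<in> fspace S'"
    have "lin (\<lambda>b. B (Poly_Mapping.single a (1::'f)) (Poly_Mapping.single b (1::'f))) y = B (Poly_Mapping.single a (1::'f)) y" if "a \<in> Poly_Mapping.keys x" for a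
      using lin_unique[OF B1[of "Poly_Mapping.single a (1::'f)"] y] that x fspace_single[of a S "1::'f"]
      by (auto simp: fspace_def)
    then show "lin (\<lambda>(a, b). B (Poly_Mapping.single a (1::'f)) (Poly_Mapping.single b (1::'f))) (x \<otimes>\<^sub>t y) = B x y"
      using lin_unique[OF B2[OF y] x] by (simp add: lin_tensor cong: lin_cong)
  qed
  then show "\<exists>h. P h" by (intro exI[of P])
  assume h: "P h" "P h'" and u: "u \<in> fspace (S \<times> S')"
  have "h (Poly_Mapping.single p (1::'f)) = h' (Poly_Mapping.single p (1::'f))" if "p \<in> Poly_Mapping.keys u" for p
  proof -
    obtain a b where p: "p = (a, b)" by force
    with that u have "a \<in> S" "b \<in> S'" by (auto simp: fspace_def)
    with h show ?thesis
      unfolding P_def p tensor_single[symmetric] by (simp add: fspace_single)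
  qed
  then show "h u = h' u"
    using lin_unique[of "S \<times> S'" h u] lin_unique[of "S \<times> S'" h' u] h u
    by (simp add: P_def cong: lin_cong)
qed

lemma pm_induct [case_names zero add single]:
  fixes x :: "'a \<Rightarrow>\<^sub>0 'f::field"
  assumes "P 0" "\<And>x y. P x \<Longrightarrow> P y \<Longrightarrow> P (x + y)" "\<And>a c. P (Poly_Mapping.single a c)"
  shows "P x"
proof -
  have "c \<odot> Poly_Mapping.single a 1 = Poly_Mapping.single a c" for a :: 'a and c :: 'f
    by (rule poly_mapping_eqI) (auto simp: lookup_single when_def)
  then have "P (\<Sum>a\<in>A. Poly_Mapping.lookup x a \<odot> Poly_Mapping.single a 1)" for A
    by (induction A rule: infinite_finite_induct) (auto intro: assms)
  then have "P (lin (\<lambda>a. Poly_Mapping.single a 1) x)"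
    unfolding lin_def .
  then show ?thesis
    by (simp only: lin_id)
qed

lemma scal_single [simp]: "c \<odot> Poly_Mapping.single a b = Poly_Mapping.single a (c * b)"
  by (rule poly_mapping_eqI) (auto simp: lookup_single when_def)

lemma bilin_add_left: "bilin \<phi> (x + x') y = bilin \<phi> x y + bilin \<phi> x' y"
  by (simp add: bilin_def lin_add)

lemma bilin_add_right: "bilin \<phi> x (y + y') = bilin \<phi> x y + bilin \<phi> x y'"
  by (simp add: bilin_def lin_add) (simp add: lin_def fs.scale_right_distrib sum.distrib)

lemma bilin_scal_left: "bilin \<phi> (c \<odot> x) y = c \<odot> bilin \<phi> x y"
  by (simp add: bilin_def lin_scal)

lemma bilin_scal_right: "bilin \<phi> x (c \<odot> y) = c \<odot> bilin \<phi> x y"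
  by (simp add: bilin_def lin_scal) (simp add: lin_def fs.scale_sum_right mult_ac)

lemma bilin_0_left [simp]: "bilin \<phi> 0 y = 0"
  by (simp add: bilin_def)

lemma bilin_0_right [simp]: "bilin \<phi> x 0 = 0"
  by (simp add: bilin_def) (simp add: lin_def)

lemma bilin_single [simp]:
  "bilin \<phi> (Poly_Mapping.single a c) (Poly_Mapping.single b d) = (c * d) \<odot> \<phi> a b"
  by (simp add: bilin_def)

lemma tensor_single_single:
  "Poly_Mapping.single a c \<otimes>\<^sub>t Poly_Mapping.single b d = Poly_Mapping.single (a, b) (c * d)"
  by (simp add: tensor_def)

section \<open>Lie bialgebras\<close>

text \<open>Throughout, \<open>L = fspace S\<close> and \<open>br\<close> is a bracket on \<open>L\<close>.\<close>

definition lie_algebra ::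
  "'a set \<Rightarrow> (('a \<Rightarrow>\<^sub>0 'f) \<Rightarrow> ('a \<Rightarrow>\<^sub>0 'f) \<Rightarrow> ('a \<Rightarrow>\<^sub>0 'f::field)) \<Rightarrow> bool"
  where "lie_algebra S br \<longleftrightarrow>
    (\<forall>x\<in>fspace S. linear_into (fspace S) (fspace S) (br x)) \<and>
    (\<forall>y\<in>fspace S. linear_into (fspace S) (fspace S) (\<lambda>x. br x y)) \<and>
    (\<forall>x\<in>fspace S. br x x = 0) \<and>
    (\<forall>x\<in>fspace S. \<forall>y\<in>fspace S. \<forall>z\<in>fspace S.
      br x (br y z) + br y (br z x) + br z (br x y) = 0)"

definition act2 ::
  "(('a \<Rightarrow>\<^sub>0 'f) \<Rightarrow> ('a \<Rightarrow>\<^sub>0 'f) \<Rightarrow> ('a \<Rightarrow>\<^sub>0 'f)) \<Rightarrow> ('a \<Rightarrow>\<^sub>0 'f)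
    \<Rightarrow> (('a \<times> 'a) \<Rightarrow>\<^sub>0 'f) \<Rightarrow> (('a \<times> 'a) \<Rightarrow>\<^sub>0 'f::field)"
  where "act2 br x r = tmap (br x) id r + tmap id (br x) r"

definition act3 ::
  "(('a \<Rightarrow>\<^sub>0 'f) \<Rightarrow> ('a \<Rightarrow>\<^sub>0 'f) \<Rightarrow> ('a \<Rightarrow>\<^sub>0 'f)) \<Rightarrow> ('a \<Rightarrow>\<^sub>0 'f)
    \<Rightarrow> (('a \<times> 'a \<times> 'a) \<Rightarrow>\<^sub>0 'f) \<Rightarrow> (('a \<times> 'a \<times> 'a) \<Rightarrow>\<^sub>0 'f::field)"
  where "act3 br x r =
    tmap (br x) (tmap id id) r + tmap id (tmap (br x) id) r + tmap id (tmap id (br x)) r"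

definition lie_coalgebra ::
  "'a set \<Rightarrow> (('a \<Rightarrow>\<^sub>0 'f) \<Rightarrow> (('a \<times> 'a) \<Rightarrow>\<^sub>0 'f::field)) \<Rightarrow> bool"
  where "lie_coalgebra S \<Delta> \<longleftrightarrow>
    linear_into (fspace S) (fspace (S \<times> S)) \<Delta> \<and>
    (\<forall>x\<in>fspace S. \<Delta> x \<in> skew S) \<and>
    (\<forall>x\<in>fspace S. let w = tmap id \<Delta> (\<Delta> x) in w + cyc w + cyc (cyc w) = 0)"

definition lie_bialgebra ::
  "'a set \<Rightarrow> (('a \<Rightarrow>\<^sub>0 'f) \<Rightarrow> ('a \<Rightarrow>\<^sub>0 'f) \<Rightarrow> ('a \<Rightarrow>\<^sub>0 'f))
    \<Rightarrow> (('a \<Rightarrow>\<^sub>0 'f) \<Rightarrow> (('a \<times> 'a) \<Rightarrow>\<^sub>0 'f::field)) \<Rightarrow> bool"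
  where "lie_bialgebra S br \<Delta> \<longleftrightarrow>
    lie_algebra S br \<and> lie_coalgebra S \<Delta> \<and>
    (\<forall>x\<in>fspace S. \<forall>y\<in>fspace S. \<Delta> (br x y) = act2 br x (\<Delta> y) - act2 br y (\<Delta> x))"

section \<open>The universal enveloping algebra and the classical Yang-Baxter equation\<close>

text \<open>
  The tensor algebra of \<open>L = fspace S\<close> is the free associative algebra on \<open>S\<close>, i.e. the monoid
  algebra of the free monoid on \<open>S\<close>. The monoid is written additively, so that the library's
  convolution product on \<open>\<Rightarrow>\<^sub>0\<close> is the product of the tensor algebra; likewise, on a product
  of free monoids, convolution is the componentwise product on a tensor product of tensor algebras.
\<close>

datatype 'a word = Word (letters: "'a list")

instantiation word :: (type) monoid_add
begin
definition "0 = Word []"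
definition "v + w = Word (letters v @ letters w)"
instance
  by standard (simp_all add: zero_word_def plus_word_def)
end

definition tens_alg :: "'a set \<Rightarrow> ('a word \<Rightarrow>\<^sub>0 'f::field) set"
  where "tens_alg S = fspace {w. set (letters w) \<subseteq> S}"

definition incl :: "('a \<Rightarrow>\<^sub>0 'f) \<Rightarrow> ('a word \<Rightarrow>\<^sub>0 'f::field)"
  \<comment> \<open>the inclusion of \<open>L\<close> in its tensor algebra\<close>
  where "incl = lin (\<lambda>a. Poly_Mapping.single (Word [a]) 1)"

definition env_ideal ::
  "'a set \<Rightarrow> (('a \<Rightarrow>\<^sub>0 'f) \<Rightarrow> ('a \<Rightarrow>\<^sub>0 'f) \<Rightarrow> ('a \<Rightarrow>\<^sub>0 'f::field)) \<Rightarrow> ('a word \<Rightarrow>\<^sub>0 'f) set"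
  \<comment> \<open>\<open>\<U>(L)\<close> is \<open>tens_alg S\<close> modulo this two-sided ideal\<close>
  where "env_ideal S br = fs.span
    {u * (incl x * incl y - incl y * incl x - incl (br x y)) * v | u v x y.
       u \<in> tens_alg S \<and> v \<in> tens_alg S \<and> x \<in> fspace S \<and> y \<in> fspace S}"

definition env_ideal3 ::
  "'a set \<Rightarrow> (('a \<Rightarrow>\<^sub>0 'f) \<Rightarrow> ('a \<Rightarrow>\<^sub>0 'f) \<Rightarrow> ('a \<Rightarrow>\<^sub>0 'f::field))
    \<Rightarrow> (('a word \<times> 'a word \<times> 'a word) \<Rightarrow>\<^sub>0 'f) set"
  \<comment> \<open>\<open>I \<otimes> T \<otimes> T + T \<otimes> I \<otimes> T + T \<otimes> T \<otimes> I\<close>, the kernel of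
      \<open>T \<otimes> T \<otimes> T \<rightarrow> \<U>(L) \<otimes> \<U>(L) \<otimes> \<U>(L)\<close>, where \<open>T\<close> is the tensor algebra and \<open>\<U>(L) = T / I\<close>\<close>
  where "env_ideal3 S br = fs.span
    ({p \<otimes>\<^sub>t q \<otimes>\<^sub>t s | p q s. p \<in> env_ideal S br \<and> q \<in> tens_alg S \<and> s \<in> tens_alg S} \<union>
     {p \<otimes>\<^sub>t q \<otimes>\<^sub>t s | p q s. p \<in> tens_alg S \<and> q \<in> env_ideal S br \<and> s \<in> tens_alg S} \<union>
     {p \<otimes>\<^sub>t q \<otimes>\<^sub>t s | p q s. p \<in> tens_alg S \<and> q \<in> tens_alg S \<and> s \<in> env_ideal S br})"

definition r12 :: "(('a \<times> 'a) \<Rightarrow>\<^sub>0 'f) \<Rightarrow> (('a word \<times> 'a word \<times> 'a word) \<Rightarrow>\<^sub>0 'f::field)"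
  where "r12 = lin (\<lambda>(a, b). incl (Poly_Mapping.single a 1) \<otimes>\<^sub>t incl (Poly_Mapping.single b 1) \<otimes>\<^sub>t 1)"

definition r13 :: "(('a \<times> 'a) \<Rightarrow>\<^sub>0 'f) \<Rightarrow> (('a word \<times> 'a word \<times> 'a word) \<Rightarrow>\<^sub>0 'f::field)"
  where "r13 = lin (\<lambda>(a, b). incl (Poly_Mapping.single a 1) \<otimes>\<^sub>t 1 \<otimes>\<^sub>t incl (Poly_Mapping.single b 1))"

definition r23 :: "(('a \<times> 'a) \<Rightarrow>\<^sub>0 'f) \<Rightarrow> (('a word \<times> 'a word \<times> 'a word) \<Rightarrow>\<^sub>0 'f::field)"
  where "r23 = lin (\<lambda>(a, b). 1 \<otimes>\<^sub>t incl (Poly_Mapping.single a 1) \<otimes>\<^sub>t incl (Poly_Mapping.single b 1))"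

definition commutator :: "'b::ring \<Rightarrow> 'b \<Rightarrow> 'b"
  where "commutator u v = u * v - v * u"

definition cybe_env :: "(('a \<times> 'a) \<Rightarrow>\<^sub>0 'f) \<Rightarrow> (('a word \<times> 'a word \<times> 'a word) \<Rightarrow>\<^sub>0 'f::field)"
  \<comment> \<open>a representative in \<open>T \<otimes> T \<otimes> T\<close> of \<open>c(r) \<in> \<U>(L) \<otimes> \<U>(L) \<otimes> \<U>(L)\<close>\<close>
  where "cybe_env r = commutator (r12 r) (r13 r) + commutator (r12 r) (r23 r) + commutator (r13 r) (r23 r)"

lemma tensor_mult:
  fixes p p' :: "'a::monoid_add \<Rightarrow>\<^sub>0 'f::field" and q q' :: "'b::monoid_add \<Rightarrow>\<^sub>0 'f"
  shows "(p \<otimes>\<^sub>t q) * (p' \<otimes>\<^sub>t q') = (p * p') \<otimes>\<^sub>t (q * q')"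
proof (induction p rule: pm_induct)
  case (single a1 c1)
  show ?case
  proof (induction q rule: pm_induct)
    case (single a2 c2)
    show ?case
    proof (induction p' rule: pm_induct)
      case (single a3 c3)
      show ?case
        by (induction q' rule: pm_induct)
          (simp_all add: tensor_add_right distrib_left tensor_single_single mult_single mult_ac)
    qed (simp_all add: tensor_add_left distrib_left)
  qed (simp_all add: tensor_add_right distrib_right)
qed (simp_all add: tensor_add_left distrib_right)

lemma commutator_lin:
  fixes \<phi> :: "'a \<Rightarrow> ('b::monoid_add \<Rightarrow>\<^sub>0 'd::field)" and \<psi> :: "'c \<Rightarrow> ('b \<Rightarrow>\<^sub>0 'd)"
  shows "commutator (lin \<phi> r) (lin \<psi> s) = bilin (\<lambda>p q. commutator (\<phi> p) (\<psi> q)) r s"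
proof (induction r rule: pm_induct)
  case (single p c)
  have l: "(c \<odot> f) * g = c \<odot> (f * g)" for c and f g :: "'b \<Rightarrow>\<^sub>0 'd"
    by (simp add: scal_def mult_map_scale_conv_mult mult.assoc)
  have r: "f * (c \<odot> g) = c \<odot> (f * g)" for c and f g :: "'b \<Rightarrow>\<^sub>0 'd"
  proof (induction f rule: pm_induct)
    case (single a d)
    show ?case
      by (induction g rule: pm_induct)
        (simp_all add: fs.scale_right_distrib distrib_left mult_single mult_ac)
  qed (simp_all add: fs.scale_right_distrib distrib_right)
  show ?case
  proof (induction s rule: pm_induct)
    case (single q d)
    show ?case
      by (simp add: commutator_def l r fs.scale_right_diff_distrib mult_ac)
  qed (simp_all add: commutator_def lin_add bilin_add_right distrib_left distrib_right algebra_simps)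
qed (simp_all add: commutator_def lin_add bilin_add_left algebra_simps)

lemma tens_alg_1: "1 \<in> tens_alg S"
  by (auto simp: tens_alg_def fspace_def zero_word_def)

lemma incl_single: "incl (Poly_Mapping.single a 1) = Poly_Mapping.single (Word [a]) 1"
  by (simp add: incl_def)

lemma incl_single_in: "a \<in> S \<Longrightarrow> incl (Poly_Mapping.single a 1) \<in> tens_alg S"
  by (auto simp: incl_single tens_alg_def intro: fspace_single)

lemma env_ideal_gen:
  "x \<in> fspace S \<Longrightarrow> y \<in> fspace S \<Longrightarrow> incl x * incl y - incl y * incl x - incl (br x y) \<in> env_ideal S br"
  unfolding env_ideal_def
  by (rule fs.span_base) (use tens_alg_1 in \<open>force intro: exI[of _ 1]\<close>)

theorem cybe_exists:
  fixes br :: "('a \<Rightarrow>\<^sub>0 'f) \<Rightarrow> ('a \<Rightarrow>\<^sub>0 'f) \<Rightarrow> ('a \<Rightarrow>\<^sub>0 'f::field)"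
  assumes br: "\<And>x y. x \<in> fspace S \<Longrightarrow> y \<in> fspace S \<Longrightarrow> br x y \<in> fspace S"
    and r: "r \<in> fspace (S \<times> S)"
  defines "e \<equiv> \<lambda>a. Poly_Mapping.single a 1"
  defines "\<phi> \<equiv> \<lambda>(a, b) (c, d).
    br (e a) (e c) \<otimes>\<^sub>t e b \<otimes>\<^sub>t e d + e a \<otimes>\<^sub>t br (e b) (e c) \<otimes>\<^sub>t e d + e a \<otimes>\<^sub>t e c \<otimes>\<^sub>t br (e b) (e d)"
  shows "bilin \<phi> r r \<in> fspace (S \<times> S \<times> S)"
    and "tmap incl (tmap incl incl) (bilin \<phi> r r) - cybe_env r \<in> env_ideal3 S br"
proof -
  let ?i = "\<lambda>a. incl (e a)"
  let ?emb = "tmap incl (tmap incl incl) :: _ \<Rightarrow> (_ \<Rightarrow>\<^sub>0 'f)"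
  let ?f12 = "\<lambda>(a, b). ?i a \<otimes>\<^sub>t ?i b \<otimes>\<^sub>t 1" and ?f13 = "\<lambda>(a, b). ?i a \<otimes>\<^sub>t 1 \<otimes>\<^sub>t ?i b"
    and ?f23 = "\<lambda>(a, b). 1 \<otimes>\<^sub>t ?i a \<otimes>\<^sub>t ?i b"
  define \<psi> where "\<psi> = (\<lambda>p q. commutator (?f12 p) (?f13 q) + commutator (?f12 p) (?f23 q)
    + commutator (?f13 p) (?f23 q))"
  have e: "e a \<in> fspace S" if "a \<in> S" for a
    using that by (simp add: e_def fspace_single)
  have i: "?i a \<in> tens_alg S" if "a \<in> S" for a
    using that by (simp add: e_def incl_single_in)
  have S: "a \<in> S \<and> b \<in> S" if "(a, b) \<in> Poly_Mapping.keys r" for a b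
    using that r by (auto simp: fspace_def)
  show "bilin \<phi> r r \<in> fspace (S \<times> S \<times> S)"
    unfolding bilin_def
    by (intro lin_in_fspace) (auto simp: \<phi>_def dest!: S intro!: fspace_add tensor_in_fspace e br)
  have emb: "?emb (x \<otimes>\<^sub>t y \<otimes>\<^sub>t z) = incl x \<otimes>\<^sub>t incl y \<otimes>\<^sub>t incl z" for x y z
  proof -
    have *: "linear_into (fspace UNIV) UNIV incl" "linear_into (fspace UNIV) UNIV (tmap incl incl)"
      by (simp_all add: incl_def tmap_def linear_into_lin)
    show ?thesis
      by (subst tmap_tensor[OF *]) (simp_all add: fspace_def tmap_tensor[OF *(1) *(1)])
  qed
  have cy: "cybe_env r = lin (\<lambda>p. lin (\<psi> p) r) r"
    unfolding cybe_env_def r12_def r13_def r23_def commutator_lin \<psi>_def e_def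
    by (simp add: bilin_def lin_def fs.scale_right_distrib sum.distrib)
  have "?emb (bilin \<phi> r r) = lin (\<lambda>p. lin (\<lambda>q. ?emb (\<phi> p q)) r) r"
    by (simp add: tmap_def[of incl "tmap incl incl"] bilin_def lin_lin)
  then have "?emb (bilin \<phi> r r) - cybe_env r = (\<Sum>p\<in>Poly_Mapping.keys r. \<Sum>q\<in>Poly_Mapping.keys r.
      Poly_Mapping.lookup r p \<odot> Poly_Mapping.lookup r q \<odot> (?emb (\<phi> p q) - \<psi> p q))"
    unfolding cy lin_def
    by (simp only: fs.scale_sum_right sum_subtractf[symmetric] fs.scale_right_diff_distrib)
  also have "\<dots> \<in> env_ideal3 S br"
  proof -
    have "?emb (\<phi> p q) - \<psi> p q \<in> env_ideal3 S br"
      if "p \<in> Poly_Mapping.keys r" "q \<in> Poly_Mapping.keys r" for p q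
    proof -
      obtain a b c d where pq: "p = (a, b)" "q = (c, d)" by force
      with that S have abcd: "a \<in> S" "b \<in> S" "c \<in> S" "d \<in> S" by auto
      define k where "k x y = ?i x * ?i y - ?i y * ?i x - incl (br (e x) (e y))" for x y
      have k: "k x y \<in> env_ideal S br" if "x \<in> S" "y \<in> S" for x y
        using that by (simp add: k_def env_ideal_gen e)
      have eadd: "?emb (u + v) = ?emb u + ?emb v" for u v
        by (simp add: tmap_def lin_add)
      have "?emb (\<phi> p q) - \<psi> p q
        = - (k a c \<otimes>\<^sub>t ?i b \<otimes>\<^sub>t ?i d) + - (?i a \<otimes>\<^sub>t k b c \<otimes>\<^sub>t ?i d) + - (?i a \<otimes>\<^sub>t ?i c \<otimes>\<^sub>t k b d)"
        by (simp add: \<phi>_def \<psi>_def pq eadd emb commutator_def tensor_mult k_def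
            tensor_diff_left tensor_diff_right)
      also have "\<dots> \<in> env_ideal3 S br"
        unfolding env_ideal3_def using k abcd i
        by (intro fs.span_add fs.span_neg fs.span_base) blast+
      finally show ?thesis .
    qed
    then show ?thesis
      unfolding env_ideal3_def by (intro fs.span_sum fs.span_scale) auto
  qed
  finally show "tmap incl (tmap incl incl) (bilin \<phi> r r) - cybe_env r \<in> env_ideal3 S br" .
qed

definition cybe ::
  "'a set \<Rightarrow> (('a \<Rightarrow>\<^sub>0 'f) \<Rightarrow> ('a \<Rightarrow>\<^sub>0 'f) \<Rightarrow> ('a \<Rightarrow>\<^sub>0 'f::field))
    \<Rightarrow> (('a \<times> 'a) \<Rightarrow>\<^sub>0 'f) \<Rightarrow> (('a \<times> 'a \<times> 'a) \<Rightarrow>\<^sub>0 'f)"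
  \<comment> \<open>\<open>c(r)\<close> as the element of \<open>L \<otimes> L \<otimes> L\<close> whose image in \<open>\<U>(L) \<otimes> \<U>(L) \<otimes> \<U>(L)\<close> is
      the class of \<open>cybe_env r\<close>; there is one by \<open>cybe_exists\<close>, and for a Lie algebra it is unique
      since \<open>L \<rightarrow> \<U>(L)\<close> is injective (Poincare-Birkhoff-Witt)\<close>
  where "cybe S br r = (THE c. c \<in> fspace (S \<times> S \<times> S) \<and>
    tmap incl (tmap incl incl) c - cybe_env r \<in> env_ideal3 S br)"

section \<open>Derivations and first cohomology\<close>

text \<open>
  \<open>L = fspace S\<close>, and \<open>V\<close> is an \<open>L\<close>-module with action \<open>act\<close>. Linear maps on \<open>L\<close> are taken to
  vanish outside \<open>L\<close>, so that they are determined by their restriction to \<open>L\<close>.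
\<close>

definition Der ::
  "'a set \<Rightarrow> (('a \<Rightarrow>\<^sub>0 'f) \<Rightarrow> ('a \<Rightarrow>\<^sub>0 'f) \<Rightarrow> ('a \<Rightarrow>\<^sub>0 'f)) \<Rightarrow> ('b \<Rightarrow>\<^sub>0 'f) set
    \<Rightarrow> (('a \<Rightarrow>\<^sub>0 'f) \<Rightarrow> ('b \<Rightarrow>\<^sub>0 'f) \<Rightarrow> ('b \<Rightarrow>\<^sub>0 'f)) \<Rightarrow> (('a \<Rightarrow>\<^sub>0 'f) \<Rightarrow> ('b \<Rightarrow>\<^sub>0 'f::field)) set"
  where "Der S br V act = {d. linear_into (fspace S) V d \<and> (\<forall>x. x \<notin> fspace S \<longrightarrow> d x = 0) \<and>
    (\<forall>x\<in>fspace S. \<forall>y\<in>fspace S. d (br x y) = act x (d y) - act y (d x))}"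

definition Inn ::
  "'a set \<Rightarrow> ('b \<Rightarrow>\<^sub>0 'f) set \<Rightarrow> (('a \<Rightarrow>\<^sub>0 'f) \<Rightarrow> ('b \<Rightarrow>\<^sub>0 'f) \<Rightarrow> ('b \<Rightarrow>\<^sub>0 'f))
    \<Rightarrow> (('a \<Rightarrow>\<^sub>0 'f) \<Rightarrow> ('b \<Rightarrow>\<^sub>0 'f::field)) set"
  where "Inn S V act = {\<lambda>x. if x \<in> fspace S then act x a else 0 | a. a \<in> V}"

definition H1 ::
  "'a set \<Rightarrow> (('a \<Rightarrow>\<^sub>0 'f) \<Rightarrow> ('a \<Rightarrow>\<^sub>0 'f) \<Rightarrow> ('a \<Rightarrow>\<^sub>0 'f)) \<Rightarrow> ('b \<Rightarrow>\<^sub>0 'f) set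
    \<Rightarrow> (('a \<Rightarrow>\<^sub>0 'f) \<Rightarrow> ('b \<Rightarrow>\<^sub>0 'f) \<Rightarrow> ('b \<Rightarrow>\<^sub>0 'f))
    \<Rightarrow> (('a \<Rightarrow>\<^sub>0 'f) \<Rightarrow> ('b \<Rightarrow>\<^sub>0 'f::field)) set set"
  \<comment> \<open>the quotient \<open>Der / Inn\<close>; its zero element is the coset \<open>Inn\<close>\<close>
  where "H1 S br V act = Der S br V act //
    {(d, e). d \<in> Der S br V act \<and> e \<in> Der S br V act \<and> (\<lambda>x. d x - e x) \<in> Inn S V act}"

section \<open>The Lie algebra of Hamiltonian type\<close>

text \<open>
  The index \<open>Inl p\<close> stands for \<open>p\<close> and \<open>Inr p\<close> for \<open>n + p\<close>, where \<open>n = CARD('n)\<close>.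
\<close>

definition coord ::
  "('n::finite + 'n \<Rightarrow> 'f::field ^ ('n + 'n)) \<Rightarrow> 'f ^ ('n + 'n) \<Rightarrow> 'n + 'n \<Rightarrow> 'f"
  where "coord \<epsilon> \<alpha> p = vec.representation (range \<epsilon>) \<alpha> (\<epsilon> p)"

definition ham_sigma :: "('n::finite + 'n \<Rightarrow> 'f::field ^ ('n + 'n)) \<Rightarrow> 'n \<Rightarrow> 'f ^ ('n + 'n)"
  where "ham_sigma \<epsilon> i = \<epsilon> (Inl i) + \<epsilon> (Inr i)"

definition hbar_br ::
  "('n::finite + 'n \<Rightarrow> 'f::field ^ ('n + 'n))
    \<Rightarrow> ('f ^ ('n + 'n) \<Rightarrow>\<^sub>0 'f) \<Rightarrow> ('f ^ ('n + 'n) \<Rightarrow>\<^sub>0 'f) \<Rightarrow> ('f ^ ('n + 'n) \<Rightarrow>\<^sub>0 'f)"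
  where "hbar_br \<epsilon> = bilin (\<lambda>\<alpha> \<beta>. \<Sum>i\<in>UNIV.
    Poly_Mapping.single (\<alpha> + \<beta> - ham_sigma \<epsilon> i)
      (coord \<epsilon> \<alpha> (Inl i) * coord \<epsilon> \<beta> (Inr i) - coord \<epsilon> \<beta> (Inl i) * coord \<epsilon> \<alpha> (Inr i)))"

text \<open>
  The group algebra of \<open>\<Gamma>\<close> is \<open>fspace \<Gamma>\<close>. Its quotient by the line spanned by \<open>t\<^sup>0\<close> is realised as
  \<open>fspace (\<Gamma> - {0})\<close>, the quotient map being \<open>drop0\<close>, which erases the coefficient of \<open>t\<^sup>0\<close>.
  By \<open>drop0_quotient\<close>, \<open>ham_br\<close> is the induced bracket.
\<close>

definition drop0 :: "('a::zero \<Rightarrow>\<^sub>0 'f) \<Rightarrow> ('a \<Rightarrow>\<^sub>0 'f::field)"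
  where "drop0 f = f - Poly_Mapping.single 0 (Poly_Mapping.lookup f 0)"

definition ham_br ::
  "('n::finite + 'n \<Rightarrow> 'f::field ^ ('n + 'n))
    \<Rightarrow> ('f ^ ('n + 'n) \<Rightarrow>\<^sub>0 'f) \<Rightarrow> ('f ^ ('n + 'n) \<Rightarrow>\<^sub>0 'f) \<Rightarrow> ('f ^ ('n + 'n) \<Rightarrow>\<^sub>0 'f)"
  where "ham_br \<epsilon> x y = drop0 (hbar_br \<epsilon> x y)"

subsection \<open>\<open>\<H>\<close> is a Lie algebra, and a quotient of the group algebra\<close>

lemma coord_linear:
  assumes "vec.independent (range \<epsilon>)" "vec.span (range \<epsilon>) = UNIV"
  shows "coord \<epsilon> (\<alpha> + \<beta>) p = coord \<epsilon> \<alpha> p + coord \<epsilon> \<beta> p"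
    and "coord \<epsilon> (\<alpha> - \<beta>) p = coord \<epsilon> \<alpha> p - coord \<epsilon> \<beta> p"
    and "coord \<epsilon> 0 p = 0"
  using assms by (simp_all add: coord_def vec.representation_add vec.representation_diff
      vec.representation_zero)

lemma coord_basis:
  assumes "inj \<epsilon>" "vec.independent (range \<epsilon>)"
  shows "coord \<epsilon> (\<epsilon> q) p = (if p = q then 1 else 0)"
  using assms by (auto simp: coord_def vec.representation_basis inj_def)

definition ham_omega :: "('n::finite + 'n \<Rightarrow> 'f::field ^ ('n + 'n)) \<Rightarrow> 'n \<Rightarrow> 'f ^ ('n + 'n) \<Rightarrow> 'f ^ ('n + 'n) \<Rightarrow> 'f"
  where "ham_omega \<epsilon> i \<alpha> \<beta> =
    coord \<epsilon> \<alpha> (Inl i) * coord \<epsilon> \<beta> (Inr i) - coord \<epsilon> \<beta> (Inl i) * coord \<epsilon> \<alpha> (Inr i)"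

lemma hbar_br_single:
  "hbar_br \<epsilon> (Poly_Mapping.single \<alpha> a) (Poly_Mapping.single \<beta> b) =
    (\<Sum>i\<in>UNIV. Poly_Mapping.single (\<alpha> + \<beta> - ham_sigma \<epsilon> i) (a * b * ham_omega \<epsilon> i \<alpha> \<beta>))"
  by (simp add: hbar_br_def ham_omega_def fs.scale_sum_right)

lemma hbar_br_add_left: "hbar_br \<epsilon> (x + x') y = hbar_br \<epsilon> x y + hbar_br \<epsilon> x' y"
  and hbar_br_add_right: "hbar_br \<epsilon> x (y + y') = hbar_br \<epsilon> x y + hbar_br \<epsilon> x y'"
  and hbar_br_0_left: "hbar_br \<epsilon> 0 y = 0"
  and hbar_br_0_right: "hbar_br \<epsilon> x 0 = 0"
  by (simp_all add: hbar_br_def bilin_add_left bilin_add_right)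

lemma hbar_br_scal_left: "hbar_br \<epsilon> (c \<odot> x) y = c \<odot> hbar_br \<epsilon> x y"
  and hbar_br_scal_right: "hbar_br \<epsilon> x (c \<odot> y) = c \<odot> hbar_br \<epsilon> x y"
  by (simp_all add: hbar_br_def bilin_scal_left bilin_scal_right)

lemma hbar_br_diff_left: "hbar_br \<epsilon> (x - x') y = hbar_br \<epsilon> x y - hbar_br \<epsilon> x' y"
  using hbar_br_add_left[of \<epsilon> "x - x'" x' y] by simp

lemma hbar_br_diff_right: "hbar_br \<epsilon> x (y - y') = hbar_br \<epsilon> x y - hbar_br \<epsilon> x y'"
  using hbar_br_add_right[of \<epsilon> x "y - y'" y'] by simp

lemma hbar_br_sum_right: "hbar_br \<epsilon> x (\<Sum>i\<in>I. y i) = (\<Sum>i\<in>I. hbar_br \<epsilon> x (y i))"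
  by (induction I rule: infinite_finite_induct) (simp_all add: hbar_br_add_right hbar_br_0_right)

lemma hbar_br_swap: "hbar_br \<epsilon> x y = - hbar_br \<epsilon> y x"
proof (induction x rule: pm_induct)
  case (single \<alpha> a)
  show ?case
  proof (induction y rule: pm_induct)
    case (single \<beta> b)
    show ?case
      by (auto simp: hbar_br_single ham_omega_def algebra_simps simp flip: sum_negf single_uminus
          intro!: sum.cong)
  qed (simp_all add: hbar_br_add_left hbar_br_add_right hbar_br_0_left hbar_br_0_right)
qed (simp_all add: hbar_br_add_left hbar_br_add_right hbar_br_0_left hbar_br_0_right)

lemma pm_eq_uminus:
  fixes u :: "'a \<Rightarrow>\<^sub>0 'f::field_char_0"
  assumes "u = - u"
  shows "u = 0"
proof (rule poly_mapping_eqI)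
  fix k
  have "Poly_Mapping.lookup u k = - Poly_Mapping.lookup u k"
    by (subst assms) simp
  then have "2 * Poly_Mapping.lookup u k = 0"
    by (metis mult_2 add.right_inverse)
  then show "Poly_Mapping.lookup u k = Poly_Mapping.lookup 0 k"
    by simp
qed

lemma hbar_br_self: "hbar_br \<epsilon> x x = (0 :: _ \<Rightarrow>\<^sub>0 'f::field_char_0)"
  by (rule pm_eq_uminus[OF hbar_br_swap])

lemma hbar_br_closed:
  assumes "\<And>\<alpha> \<beta>. \<alpha> \<in> \<Gamma> \<Longrightarrow> \<beta> \<in> \<Gamma> \<Longrightarrow> \<alpha> - \<beta> \<in> \<Gamma>" "range \<epsilon> \<subseteq> \<Gamma>"
    and "x \<in> fspace \<Gamma>" "y \<in> fspace \<Gamma>"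
  shows "hbar_br \<epsilon> x y \<in> fspace \<Gamma>"
proof -
  have eps: "\<epsilon> p \<in> \<Gamma>" for p using assms(2) by auto
  have "0 \<in> \<Gamma>" using assms(1)[OF eps eps] by (metis diff_self)
  then have neg: "- \<alpha> \<in> \<Gamma>" if "\<alpha> \<in> \<Gamma>" for \<alpha> using assms(1)[of 0 \<alpha>] that by simp
  have add: "\<alpha> + \<beta> \<in> \<Gamma>" if "\<alpha> \<in> \<Gamma>" "\<beta> \<in> \<Gamma>" for \<alpha> \<beta> using assms(1)[of \<alpha> "- \<beta>"] neg that by simp
  have shift: "\<alpha> + \<beta> - ham_sigma \<epsilon> i \<in> \<Gamma>" if "\<alpha> \<in> \<Gamma>" "\<beta> \<in> \<Gamma>" for \<alpha> \<beta> i
    unfolding ham_sigma_def by (rule assms(1)[OF add[OF that] add[OF eps eps]])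
  show ?thesis
    using assms(3,4) unfolding hbar_br_def bilin_def
    by (intro lin_in_fspace fspace_sum fspace_single shift) (auto simp: fspace_def)
qed

theorem hbar_br_jacobi:
  fixes \<epsilon> :: "'n::finite + 'n \<Rightarrow> 'f::field_char_0 ^ ('n + 'n)"
  assumes \<epsilon>: "inj \<epsilon>" "vec.independent (range \<epsilon>)" "vec.span (range \<epsilon>) = UNIV"
  shows "hbar_br \<epsilon> x (hbar_br \<epsilon> y z) + hbar_br \<epsilon> y (hbar_br \<epsilon> z x) + hbar_br \<epsilon> z (hbar_br \<epsilon> x y) = 0"
proof -
  note lin_simps = hbar_br_add_left hbar_br_add_right hbar_br_0_left hbar_br_0_right
  note coord = coord_linear[OF \<epsilon>(2,3)] coord_basis[OF \<epsilon>(1,2)]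
  let ?w = "ham_omega \<epsilon>" and ?s = "ham_sigma \<epsilon>"
  have w: "?w j \<alpha> (\<beta> + \<gamma> - ?s i) = ?w j \<alpha> \<beta> + ?w j \<alpha> \<gamma>
      - (if i = j then coord \<epsilon> \<alpha> (Inl i) - coord \<epsilon> \<alpha> (Inr i) else 0)" for i j \<alpha> \<beta> \<gamma>
    by (auto simp: ham_omega_def ham_sigma_def coord algebra_simps)
  have nest: "hbar_br \<epsilon> (Poly_Mapping.single \<alpha> a)
        (hbar_br \<epsilon> (Poly_Mapping.single \<beta> b) (Poly_Mapping.single \<gamma> c)) =
      (\<Sum>i\<in>UNIV. \<Sum>j\<in>UNIV. Poly_Mapping.single (\<alpha> + \<beta> + \<gamma> - ?s i - ?s j)
        (a * b * c * (?w i \<beta> \<gamma> * ?w j \<alpha> (\<beta> + \<gamma> - ?s i))))" for \<alpha> \<beta> \<gamma> a b c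
    unfolding hbar_br_single hbar_br_sum_right
    by (intro sum.cong refl arg_cong2[where f = Poly_Mapping.single]) (simp_all add: algebra_simps)
  have jac: "hbar_br \<epsilon> (Poly_Mapping.single \<alpha> a)
        (hbar_br \<epsilon> (Poly_Mapping.single \<beta> b) (Poly_Mapping.single \<gamma> c)) +
      hbar_br \<epsilon> (Poly_Mapping.single \<beta> b)
        (hbar_br \<epsilon> (Poly_Mapping.single \<gamma> c) (Poly_Mapping.single \<alpha> a)) +
      hbar_br \<epsilon> (Poly_Mapping.single \<gamma> c)
        (hbar_br \<epsilon> (Poly_Mapping.single \<alpha> a) (Poly_Mapping.single \<beta> b)) = 0" (is "?J = 0")
    for \<alpha> \<beta> \<gamma> a b c
  proof -
    define D where "D i j = ?w i \<beta> \<gamma> * ?w j \<alpha> (\<beta> + \<gamma> - ?s i) + ?w i \<gamma> \<alpha> * ?w j \<beta> (\<gamma> + \<alpha> - ?s i)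
      + ?w i \<alpha> \<beta> * ?w j \<gamma> (\<alpha> + \<beta> - ?s i)" for i j
    have D: "D j i = - D i j" for i j
    proof (cases "i = j")
      case True
      show ?thesis
        unfolding D_def w True by (simp add: ham_omega_def algebra_simps)
    next
      case False
      then show ?thesis
        unfolding D_def w by (simp add: ham_omega_def algebra_simps)
    qed
    let ?t = "\<lambda>i j. Poly_Mapping.single (\<alpha> + \<beta> + \<gamma> - ?s i - ?s j) (a * b * c * D i j)"
    have J: "?J = (\<Sum>i\<in>UNIV. \<Sum>j\<in>UNIV. ?t i j)"
      unfolding nest D_def
      by (simp add: distrib_left single_add sum.distrib add_ac mult_ac)
    also have "\<dots> = (\<Sum>j\<in>UNIV. \<Sum>i\<in>UNIV. ?t i j)"
      by (rule sum.swap)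
    also have "\<dots> = - (\<Sum>j\<in>UNIV. \<Sum>i\<in>UNIV. ?t j i)"
      unfolding sum_negf[symmetric] single_uminus[symmetric]
    proof (intro sum.cong refl arg_cong2[where f = Poly_Mapping.single])
      fix i j
      show "\<alpha> + \<beta> + \<gamma> - ?s i - ?s j = \<alpha> + \<beta> + \<gamma> - ?s j - ?s i"
        by (simp add: algebra_simps)
      show "a * b * c * D i j = - (a * b * c * D j i)"
        by (subst D) simp
    qed
    finally have "?J = - ?J" using J by simp
    then show ?thesis by (rule pm_eq_uminus)
  qed
  define J where "J x y z = hbar_br \<epsilon> x (hbar_br \<epsilon> y z) + hbar_br \<epsilon> y (hbar_br \<epsilon> z x)
    + hbar_br \<epsilon> z (hbar_br \<epsilon> x y)" for x y z
  have J_add: "J (x + x') y z = J x y z + J x' y z" "J x (y + y') z = J x y z + J x y' z"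
    "J x y (z + z') = J x y z + J x y z'" for x x' y y' z z'
    by (simp_all add: J_def lin_simps add_ac)
  have J_0: "J 0 y z = 0" "J x 0 z = 0" "J x y 0 = 0" for x y z
    by (simp_all add: J_def lin_simps)
  have "J x y z = 0"
  proof (induction x rule: pm_induct)
    case (single \<alpha> a)
    show ?case
    proof (induction y rule: pm_induct)
      case (single \<beta> b)
      show ?case
      proof (induction z rule: pm_induct)
        case (single \<gamma> c)
        show ?case unfolding J_def by (rule jac)
      qed (simp_all add: J_add J_0)
    qed (simp_all add: J_add J_0)
  qed (simp_all add: J_add J_0)
  then show ?thesis by (simp add: J_def)
qed

lemma drop0_add: "drop0 (x + y) = drop0 x + drop0 y"
  by (simp add: drop0_def lookup_add single_add)

lemma drop0_scal: "drop0 (c \<odot> x) = c \<odot> drop0 x"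
  by (simp add: drop0_def fs.scale_right_diff_distrib)

lemma drop0_in: "x \<in> fspace \<Gamma> \<Longrightarrow> drop0 x \<in> fspace (\<Gamma> - {0})"
  by (auto simp: drop0_def fspace_def in_keys_iff lookup_minus lookup_single when_def split: if_splits)

lemma drop0_id: "x \<in> fspace (\<Gamma> - {0}) \<Longrightarrow> drop0 x = x"
  using not_in_keys_iff_lookup_eq_zero[of 0 x] by (auto simp: drop0_def fspace_def)

theorem drop0_quotient:
  fixes \<epsilon> :: "'n::finite + 'n \<Rightarrow> 'f::field ^ ('n + 'n)"
  assumes "vec.independent (range \<epsilon>)" "vec.span (range \<epsilon>) = UNIV" and "0 \<in> \<Gamma>"
  shows "linear_into (fspace \<Gamma>) (fspace (\<Gamma> - {0})) drop0"
    and "drop0 ` fspace \<Gamma> = (fspace (\<Gamma> - {0}) :: ('f ^ ('n + 'n) \<Rightarrow>\<^sub>0 'f) set)"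
    and "{x \<in> fspace \<Gamma>. drop0 x = 0} = fs.span {Poly_Mapping.single (0 :: 'f ^ ('n + 'n)) (1 :: 'f)}"
    and "drop0 (hbar_br \<epsilon> x y) = ham_br \<epsilon> (drop0 x) (drop0 y)"
proof -
  show lin: "linear_into (fspace \<Gamma>) (fspace (\<Gamma> - {0})) drop0"
    by (simp add: linear_into_def drop0_add drop0_scal drop0_in)
  show "drop0 ` fspace \<Gamma> = (fspace (\<Gamma> - {0}) :: ('f ^ ('n + 'n) \<Rightarrow>\<^sub>0 'f) set)"
  proof
    show "fspace (\<Gamma> - {0}) \<subseteq> drop0 ` (fspace \<Gamma> :: ('f ^ ('n + 'n) \<Rightarrow>\<^sub>0 'f) set)"
    proof
      fix x :: "'f ^ ('n + 'n) \<Rightarrow>\<^sub>0 'f" assume x: "x \<in> fspace (\<Gamma> - {0})"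
      then have "x \<in> fspace \<Gamma>" by (auto simp: fspace_def)
      then show "x \<in> drop0 ` fspace \<Gamma>" using drop0_id[OF x] by (metis image_eqI)
    qed
  qed (auto simp: drop0_in)
  show "{x \<in> fspace \<Gamma>. drop0 x = 0} = fs.span {Poly_Mapping.single (0 :: 'f ^ ('n + 'n)) (1 :: 'f)}"
    using assms(3)
    by (auto simp: fs.span_singleton drop0_def fspace_single simp del: single_one intro!: image_eqI)
  have central: "hbar_br \<epsilon> (Poly_Mapping.single 0 c) y = 0" for c y
    by (induction y rule: pm_induct)
      (simp_all add: hbar_br_add_right hbar_br_0_right hbar_br_single ham_omega_def
        coord_linear[OF assms(1,2)])
  show "drop0 (hbar_br \<epsilon> x y) = ham_br \<epsilon> (drop0 x) (drop0 y)"
    using central hbar_br_swap[of \<epsilon> _ "Poly_Mapping.single 0 _"]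
    by (simp add: ham_br_def drop0_def[of x] drop0_def[of y] hbar_br_diff_left hbar_br_diff_right)
qed

theorem lie_algebra_ham:
  fixes \<epsilon> :: "'n::finite + 'n \<Rightarrow> 'f::field_char_0 ^ ('n + 'n)"
  assumes \<Gamma>: "0 \<in> \<Gamma>" "\<And>\<alpha> \<beta>. \<alpha> \<in> \<Gamma> \<Longrightarrow> \<beta> \<in> \<Gamma> \<Longrightarrow> \<alpha> - \<beta> \<in> \<Gamma>" "range \<epsilon> \<subseteq> \<Gamma>"
    and \<epsilon>: "inj \<epsilon>" "vec.independent (range \<epsilon>)" "vec.span (range \<epsilon>) = UNIV"
  shows "lie_algebra (\<Gamma> - {0}) (ham_br \<epsilon>)"
proof -
  have sub: "x \<in> fspace \<Gamma>" if "x \<in> fspace (\<Gamma> - {0})" for x :: "'f ^ ('n + 'n) \<Rightarrow>\<^sub>0 'f"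
    using that by (auto simp: fspace_def)
  have closed: "ham_br \<epsilon> x y \<in> fspace (\<Gamma> - {0})"
    if "x \<in> fspace (\<Gamma> - {0})" "y \<in> fspace (\<Gamma> - {0})" for x y
    unfolding ham_br_def by (intro drop0_in hbar_br_closed \<Gamma> sub that)
  have nest: "ham_br \<epsilon> x (ham_br \<epsilon> y z) = drop0 (hbar_br \<epsilon> x (hbar_br \<epsilon> y z))"
    if "x \<in> fspace (\<Gamma> - {0})" for x y z
    using drop0_quotient(4)[OF \<epsilon>(2,3) \<Gamma>(1), of x "hbar_br \<epsilon> y z"] drop0_id[OF that]
    by (simp add: ham_br_def)
  show ?thesis
    unfolding lie_algebra_def linear_into_def
  proof (intro conjI ballI allI)
    fix x y z :: "'f ^ ('n + 'n) \<Rightarrow>\<^sub>0 'f"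
    assume xyz: "x \<in> fspace (\<Gamma> - {0})" "y \<in> fspace (\<Gamma> - {0})" "z \<in> fspace (\<Gamma> - {0})"
    show "ham_br \<epsilon> x (ham_br \<epsilon> y z) + ham_br \<epsilon> y (ham_br \<epsilon> z x) + ham_br \<epsilon> z (ham_br \<epsilon> x y) = 0"
      using hbar_br_jacobi[OF \<epsilon>, of x y z] by (simp add: nest xyz flip: drop0_add) (simp add: drop0_def)
  qed (simp_all add: closed, simp_all add: ham_br_def hbar_br_add_left hbar_br_add_right
      hbar_br_scal_left hbar_br_scal_right drop0_add drop0_scal hbar_br_self drop0_def[of 0])
qed

end

theory Submission
  imports Defs
begin

text \<open>
  Fix one conjugate pair \<open>p\<close>, put \<open>\<sigma> = \<sigma>\<^sub>p\<close> and let \<open>\<lambda>(\<alpha>) = \<alpha>\<^bsub>n+p\<^esub> - \<alpha>\<^sub>p\<close>, so that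
  \<open>[t\<^bsup>k\<sigma>\<^esup>, t\<^sup>\<alpha>] = k \<lambda>(\<alpha>) t\<^bsup>\<alpha>+(k-1)\<sigma>\<^esup>\<close>. Elements of the tensor square are graded by pairs of
  \<open>\<lambda>\<close>-weights. If \<open>t\<^sup>\<beta>\<close> has a weight far from those of a tensor, then its action moves the weight of
  one leg at a time, which rules out cancellation; hence there are no invariants.

  Given a derivation \<open>d\<close>, inner derivations are subtracted in three steps. First, \<open>t\<^sup>\<sigma>\<close> is semisimple,
  so one may assume \<open>d(t\<^sup>\<sigma>) = 0\<close>, and then \<open>d\<close> preserves weights. Second, let \<open>X\<close> and \<open>Y\<close> be
  multiplication by \<open>t\<^sup>\<sigma>\<close> in the two legs. Computing \<open>d(t\<^bsup>\<beta>+2\<sigma>\<^esup>)\<close> in two ways gives an identity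
  which, for far \<open>\<beta>\<close>, shows that the part of \<open>d(t\<^bsup>2\<sigma>\<^esup>)\<close> in weight \<open>(-\<nu>, \<nu>)\<close> with \<open>\<nu> \<noteq> 0\<close> is divisible
  by \<open>X - Y\<close>; this makes it an inner value. Once it is removed, the same identity shows that
  \<open>d(t\<^sup>\<beta>)\<close> has a leg of weight zero whenever \<open>\<lambda>(\<beta>) \<noteq> 0\<close>. Third, the cocycle condition in mixed
  weight relates the two kinds of components, and a left inverse of one injective \<open>ad y\<close> on weight
  zero turns this relation into an element \<open>r\<close> with \<open>d = r\<^sub>i\<^sub>n\<^sub>n\<close>.

  For (1), \<open>\<Delta> = \<Delta>\<^sub>r\<close> is skew, so \<open>r + \<tau> r\<close> is invariant, hence zero; by Drinfeld's identity the
  co-Jacobi condition says that \<open>c(r)\<close> is invariant, hence zero.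
\<close>

section \<open>Linear maps on finitely supported functions\<close>

abbreviation bas :: "'a \<Rightarrow> ('a \<Rightarrow>\<^sub>0 'f::field)" where "bas a \<equiv> Poly_Mapping.single a 1"

abbreviation glin :: "(('a \<Rightarrow>\<^sub>0 'f) \<Rightarrow> ('b \<Rightarrow>\<^sub>0 'f::field)) \<Rightarrow> bool"
  where "glin \<equiv> linear_into UNIV UNIV"

lemma fspace_UNIV [simp]: "fspace UNIV = UNIV"
  by (simp add: fspace_def)

lemma fspace_lookup: "x \<in> fspace S \<longleftrightarrow> (\<forall>a. a \<notin> S \<longrightarrow> Poly_Mapping.lookup x a = 0)"
  by (auto simp: fspace_def in_keys_iff)

lemma fspace_mono: "x \<in> fspace S \<Longrightarrow> S \<subseteq> T \<Longrightarrow> x \<in> fspace T"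
  by (auto simp: fspace_def)

lemma fspace_diff: "x \<in> fspace S \<Longrightarrow> y \<in> fspace S \<Longrightarrow> x - y \<in> fspace S"
  by (simp add: fspace_lookup lookup_minus)

lemma glin_expand: "glin f \<Longrightarrow> f x = lin (\<lambda>a. f (Poly_Mapping.single a 1)) x"
  using lin_unique[of UNIV f x] by simp

lemma glin_add: "glin f \<Longrightarrow> f (x + y) = f x + f y"
  and glin_scal: "glin f \<Longrightarrow> f (c \<odot> x) = c \<odot> f x"
  by (simp_all add: linear_into_def)

lemma glin_0: "glin f \<Longrightarrow> f 0 = 0"
  using glin_expand[of f 0] by simp

lemma glin_single: "glin f \<Longrightarrow> f (Poly_Mapping.single a c) = c \<odot> f (Poly_Mapping.single a 1)"
  using glin_scal[of f c "Poly_Mapping.single a 1"] by simp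

lemma glin_diff: "glin f \<Longrightarrow> f (x - y) = f x - f y"
  using glin_add[of f "x - y" y] by simp

lemma glin_sum: "glin f \<Longrightarrow> f (\<Sum>i\<in>I. x i) = (\<Sum>i\<in>I. f (x i))"
  by (induction I rule: infinite_finite_induct) (simp_all add: glin_0 glin_add)

lemma glin_lin: "glin (lin \<phi>)"
  by (rule linear_into_lin)

lemma glin_id: "glin id"
  by (simp add: linear_into_def)

lemma glin_comp: "glin f \<Longrightarrow> glin g \<Longrightarrow> glin (f \<circ> g)"
  by (simp add: linear_into_def)

lemma glin_of_lin: "glin f \<Longrightarrow> f (lin \<phi> x) = lin (\<lambda>a. f (\<phi> a)) x"
  by (simp add: lin_def glin_sum glin_scal)

lemma lin_add_fun: "lin (\<lambda>a. \<phi> a + \<psi> a) x = lin \<phi> x + lin \<psi> x"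
  by (simp add: lin_def fs.scale_right_distrib sum.distrib)

lemma scal_eq_mult: "c \<odot> f = Poly_Mapping.single 0 c * f"
  for f :: "'a::monoid_add \<Rightarrow>\<^sub>0 'f::field"
  by (simp add: scal_def mult_map_scale_conv_mult)

lemma mult_scal: "f * (c \<odot> g) = c \<odot> (f * g)"
  for f g :: "'a::comm_monoid_add \<Rightarrow>\<^sub>0 'f::field"
  by (simp add: scal_eq_mult mult_ac)

text \<open>An injective relabelling merges no two basis vectors, so each coefficient of the image
  has a single source. With \<open>s = id\<close> it describes a rescaling of coefficients.\<close>

lemma lookup_lin_shift:
  assumes "inj s"
  shows "Poly_Mapping.lookup (lin (\<lambda>k. Poly_Mapping.single (s k) (g k)) v) (s k) = Poly_Mapping.lookup v k * g k"
proof (induction v rule: pm_induct)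
  case (single a c)
  show ?case using assms by (auto simp: lookup_single when_def inj_eq)
qed (simp_all add: lin_add lookup_add distrib_right)

text \<open>In characteristic zero the natural numbers give infinitely many scalars. Multiples of an
  element of nonzero weight therefore reach weights outside any finite set.\<close>

lemma finite_avoid_nat: "finite E \<Longrightarrow> \<exists>k::nat. k \<noteq> 0 \<and> of_nat k \<notin> (E :: 'f::field_char_0 set)"
proof -
  assume "finite E"
  then have "finite ((of_nat :: nat \<Rightarrow> 'f) -` E)"
    by (rule finite_vimageI) (simp add: inj_of_nat)
  then have "finite (insert 0 ((of_nat :: nat \<Rightarrow> 'f) -` E))" by simp
  from ex_new_if_finite[OF infinite_UNIV_nat this] show ?thesis by auto
qed

lemma lookup_bas_mult:
  fixes v :: "'a::ab_group_add \<Rightarrow>\<^sub>0 'f::field"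
  shows "Poly_Mapping.lookup (bas s * v) k = Poly_Mapping.lookup v (k - s)"
proof (induction v rule: pm_induct)
  case (single a c)
  show ?case by (auto simp: mult_single lookup_single when_def)
qed (simp_all add: distrib_left lookup_add)

lemma bas_mult_in:
  fixes v :: "'a::ab_group_add \<Rightarrow>\<^sub>0 'f::field"
  shows "v \<in> fspace A \<Longrightarrow> (\<And>k. k \<in> A \<Longrightarrow> s + k \<in> B) \<Longrightarrow> bas s * v \<in> fspace B"
  unfolding fspace_lookup lookup_bas_mult
  by (metis add.commute diff_add_cancel)

lemma fspaceD: "x \<in> fspace A \<Longrightarrow> k \<notin> A \<Longrightarrow> Poly_Mapping.lookup x k = 0"
  by (simp add: fspace_lookup)

subsection \<open>Restriction of the support\<close>

text \<open>An arbitrary index set lets one operator serve both as the projection to a weight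
  component and, with \<open>- {0}\<close>, as the quotient map \<open>drop0\<close> (see
  \<open>drop0_eq\<close>).\<close>

definition pm_restrict :: "'a set \<Rightarrow> ('a \<Rightarrow>\<^sub>0 'f) \<Rightarrow> ('a \<Rightarrow>\<^sub>0 'f::field)"
  where "pm_restrict A = lin (\<lambda>k. if k \<in> A then Poly_Mapping.single k 1 else 0)"

lemma pm_restrict_single:
  "pm_restrict A (Poly_Mapping.single k c) = (if k \<in> A then Poly_Mapping.single k c else 0)"
  by (simp add: pm_restrict_def)

lemma glin_pm_restrict: "glin (pm_restrict A)"
  unfolding pm_restrict_def by (rule glin_lin)

lemmas pm_restrict_add = glin_add[OF glin_pm_restrict]
  and pm_restrict_diff = glin_diff[OF glin_pm_restrict]
  and pm_restrict_scal = glin_scal[OF glin_pm_restrict]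
  and pm_restrict_sum = glin_sum[OF glin_pm_restrict]

lemma pm_restrict_0 [simp]: "pm_restrict A 0 = 0"
  by (rule glin_0[OF glin_pm_restrict])

lemma lookup_pm_restrict:
  "Poly_Mapping.lookup (pm_restrict A v) k = (if k \<in> A then Poly_Mapping.lookup v k else 0)"
proof (induction v rule: pm_induct)
  case (single a c)
  show ?case by (auto simp: pm_restrict_single lookup_single when_def)
qed (simp_all add: pm_restrict_add lookup_add)

lemma pm_restrict_in: "v \<in> fspace B \<Longrightarrow> pm_restrict A v \<in> fspace (A \<inter> B)"
  by (auto simp: fspace_lookup lookup_pm_restrict)

lemma pm_restrict_in': "pm_restrict A v \<in> fspace A"
  by (auto simp: fspace_lookup lookup_pm_restrict)

lemma pm_restrict_id: "v \<in> fspace A \<Longrightarrow> pm_restrict A v = v"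
  by (auto simp: fspace_lookup lookup_pm_restrict intro!: poly_mapping_eqI)

lemma pm_restrict_disjoint: "v \<in> fspace B \<Longrightarrow> A \<inter> B = {} \<Longrightarrow> pm_restrict A v = 0"
  by (rule poly_mapping_eqI) (metis disjoint_iff fspace_lookup lookup_pm_restrict lookup_zero)

lemma pm_restrict_restrict: "pm_restrict A (pm_restrict B v) = pm_restrict (A \<inter> B) v"
  by (auto simp: lookup_pm_restrict intro!: poly_mapping_eqI)

lemma pm_restrict_lin:
  assumes "\<And>k. k \<in> B \<Longrightarrow> \<phi> k \<in> fspace A" "\<And>k. k \<notin> B \<Longrightarrow> \<phi> k \<in> fspace (- A)"
  shows "pm_restrict A (lin \<phi> v) = lin \<phi> (pm_restrict B v)"
proof (induction v rule: pm_induct)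
  case (single k c)
  show ?case
    using assms[of k] pm_restrict_id[of "\<phi> k" A] pm_restrict_disjoint[of "\<phi> k" "- A" A]
    by (auto simp: pm_restrict_single pm_restrict_scal)
qed (simp_all add: pm_restrict_add lin_add)

subsection \<open>Tensor products of linear maps\<close>

lemma glin_tmap: "glin (tmap f g)"
  unfolding tmap_def by (rule glin_lin)

lemmas tmap_add = glin_add[OF glin_tmap]
  and tmap_diff = glin_diff[OF glin_tmap]
  and tmap_scal = glin_scal[OF glin_tmap]

lemma tmap_0 [simp]: "tmap f g 0 = 0"
  by (rule glin_0[OF glin_tmap])

lemma tmap_single:
  "tmap f g (Poly_Mapping.single (a, b) c) = c \<odot> (f (Poly_Mapping.single a 1) \<otimes>\<^sub>t g (Poly_Mapping.single b 1))"
  by (simp add: tmap_def)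

lemma tmap_tensor': "glin f \<Longrightarrow> glin g \<Longrightarrow> tmap f g (x \<otimes>\<^sub>t y) = f x \<otimes>\<^sub>t g y"
  using tmap_tensor[of UNIV f UNIV g x y] by simp

lemma tmap_tmap: "glin f \<Longrightarrow> glin g \<Longrightarrow> tmap f g (tmap f' g' v) = tmap (f \<circ> f') (g \<circ> g') v"
proof (induction v rule: pm_induct)
  case (single k c)
  show ?case by (cases k) (simp add: tmap_single tmap_scal tmap_tensor' single)
qed (simp_all add: tmap_add)

lemma tmap_id_id [simp]: "tmap id id v = v"
proof (induction v rule: pm_induct)
  case (single k c)
  show ?case by (cases k) (simp add: tmap_single tensor_single)
qed (simp_all add: tmap_add)

lemma tmap_add_fun_left: "tmap (\<lambda>x. f x + f' x) g v = tmap f g v + tmap f' g v"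
proof (induction v rule: pm_induct)
  case (single k c)
  show ?case by (cases k) (simp add: tmap_single tensor_add_left fs.scale_right_distrib)
qed (simp_all add: tmap_add add_ac)

lemma tmap_add_fun_right: "tmap f (\<lambda>x. g x + g' x) v = tmap f g v + tmap f g' v"
proof (induction v rule: pm_induct)
  case (single k c)
  show ?case by (cases k) (simp add: tmap_single tensor_add_right fs.scale_right_distrib)
qed (simp_all add: tmap_add add_ac)

lemma tmap_0_right: "tmap f (\<lambda>x. 0) v = 0"
  by (simp add: tmap_def lin_def case_prod_unfold)

lemma tmap_sum_fun_right: "tmap f (\<lambda>x. \<Sum>i\<in>I. g i x) v = (\<Sum>i\<in>I. tmap f (g i) v)"
  by (induction I rule: infinite_finite_induct) (simp_all add: tmap_0_right tmap_add_fun_right)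

lemma tmap_in_fspace:
  assumes "v \<in> fspace (S \<times> T)"
    and "\<And>a. a \<in> S \<Longrightarrow> f (Poly_Mapping.single a 1) \<in> fspace S'"
    and "\<And>b. b \<in> T \<Longrightarrow> g (Poly_Mapping.single b 1) \<in> fspace T'"
  shows "tmap f g v \<in> fspace (S' \<times> T')"
  unfolding tmap_def using assms
  by (intro lin_in_fspace) (auto simp: fspace_def[of "S \<times> T"] intro!: tensor_in_fspace)

lemma tmap_cong:
  assumes "v \<in> fspace (S \<times> T)"
    and "\<And>a. a \<in> S \<Longrightarrow> f (Poly_Mapping.single a 1) = f' (Poly_Mapping.single a 1)"
    and "\<And>b. b \<in> T \<Longrightarrow> g (Poly_Mapping.single b 1) = g' (Poly_Mapping.single b 1)"
  shows "tmap f g v = tmap f' g' v"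
  unfolding tmap_def using assms
  by (intro lin_cong) (auto simp: fspace_def)

text \<open>For an abelian group, the tensor square of its group algebra is again a group algebra.
  Writing the shift of one leg as a product there turns later computations into identities in a
  commutative ring.\<close>

lemma tensor_shift_left: "(bas s * x) \<otimes>\<^sub>t y = bas (s, 0) * (x \<otimes>\<^sub>t y)"
  for x :: "'a::monoid_add \<Rightarrow>\<^sub>0 'g::field" and y :: "'b::monoid_add \<Rightarrow>\<^sub>0 'g"
  using tensor_mult[of "bas s" "bas 0" x y] by (simp add: tensor_single del: single_one) simp

lemma tensor_shift_right: "x \<otimes>\<^sub>t (bas s * y) = bas (0, s) * (x \<otimes>\<^sub>t y)"
  for x :: "'a::monoid_add \<Rightarrow>\<^sub>0 'g::field" and y :: "'b::monoid_add \<Rightarrow>\<^sub>0 'g"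
  using tensor_mult[of "bas 0" "bas s" x y] by (simp add: tensor_single del: single_one) simp

lemma tmap_commute:
  assumes "glin f" "glin g"
  shows "tmap f id (tmap id g v) = tmap id g (tmap f id v)"
  using assms by (simp add: tmap_tmap glin_id)

lemma glin_act2: "glin (act2 br x)"
  by (simp add: linear_into_def act2_def tmap_add tmap_scal fs.scale_right_distrib add_ac)

lemma tmap_scal_fun_left: "tmap (\<lambda>x. c \<odot> f x) g v = c \<odot> tmap f g v"
proof (induction v rule: pm_induct)
  case (single k d)
  show ?case by (cases k) (simp add: tmap_single tensor_scal_left mult.commute)
qed (simp_all add: tmap_add fs.scale_right_distrib)

lemma tmap_scal_fun_right: "tmap f (\<lambda>x. c \<odot> g x) v = c \<odot> tmap f g v"
proof (induction v rule: pm_induct)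
  case (single k d)
  show ?case by (cases k) (simp add: tmap_single tensor_scal_right mult.commute)
qed (simp_all add: tmap_add fs.scale_right_distrib)

lemma tmap_diff_fun_left: "tmap (\<lambda>x. f x - f' x) g v = tmap f g v - tmap f' g v"
  using tmap_add_fun_left[of "\<lambda>x. f x - f' x" f' g v] by simp

lemma tmap_diff_fun_right: "tmap f (\<lambda>x. g x - g' x) v = tmap f g v - tmap f g' v"
  using tmap_add_fun_right[of f "\<lambda>x. g x - g' x" g' v] by simp

subsection \<open>Slices of a tensor\<close>

text \<open>The coefficient of the basis vector \<open>c\<close> in the second leg. Maps acting on
  the first leg alone commute with it, so statements about tensors reduce to statements about
  vectors.\<close>

definition slice :: "'b \<Rightarrow> (('a \<times> 'b) \<Rightarrow>\<^sub>0 'f) \<Rightarrow> ('a \<Rightarrow>\<^sub>0 'f::field)"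
  where "slice c = lin (\<lambda>(a, b). if b = c then Poly_Mapping.single a 1 else 0)"

lemma glin_slice: "glin (slice c)"
  unfolding slice_def by (rule glin_lin)

lemma slice_single:
  "slice c (Poly_Mapping.single (a, b) d) = (if b = c then Poly_Mapping.single a d else 0)"
  by (simp add: slice_def)

lemma lookup_slice: "Poly_Mapping.lookup (slice c v) a = Poly_Mapping.lookup v (a, c)"
proof (induction v rule: pm_induct)
  case (single k d)
  show ?case by (cases k) (auto simp: slice_def lookup_single when_def)
qed (simp_all add: glin_add[OF glin_slice] lookup_add glin_0[OF glin_slice])

lemma slice_eq_0: "(\<And>c. slice c v = 0) \<Longrightarrow> v = 0"
  by (rule poly_mapping_eqI) (metis lookup_slice lookup_zero surj_pair)

lemma slice_in: "v \<in> fspace (S \<times> T) \<Longrightarrow> slice c v \<in> fspace S"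
  by (simp add: fspace_lookup lookup_slice)

lemma slice_tensor: "slice c (x \<otimes>\<^sub>t y) = Poly_Mapping.lookup y c \<odot> x"
  by (rule poly_mapping_eqI) (simp add: lookup_slice lookup_tensor)

lemma slice_tmap_id:
  assumes "glin f"
  shows "slice c (tmap f id v) = f (slice c v)"
proof (induction v rule: pm_induct)
  case (single k d)
  show ?case
    by (cases k) (simp add: tmap_single glin_scal[OF glin_slice] slice_tensor lookup_single
        slice_single glin_0[OF assms] glin_single[OF assms, of _ d])
qed (simp_all add: tmap_add glin_add[OF glin_slice] glin_add[OF assms] glin_0[OF glin_slice] glin_0[OF assms])

text \<open>In contrast to \<open>twist\<close>, the two legs may have different types. This allows
  a triple tensor to be split into one leg and a pair.\<close>

definition swap2 :: "(('a \<times> 'b) \<Rightarrow>\<^sub>0 'f) \<Rightarrow> (('b \<times> 'a) \<Rightarrow>\<^sub>0 'f::field)"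
  where "swap2 = lin (\<lambda>(a, b). Poly_Mapping.single (b, a) 1)"

lemma glin_swap2: "glin swap2"
  unfolding swap2_def by (rule glin_lin)

lemma lookup_swap2: "Poly_Mapping.lookup (swap2 v) (b, a) = Poly_Mapping.lookup v (a, b)"
proof (induction v rule: pm_induct)
  case (single k d)
  show ?case by (cases k) (auto simp: swap2_def lookup_single when_def)
qed (simp_all add: glin_add[OF glin_swap2] lookup_add glin_0[OF glin_swap2])

lemma swap2_tensor: "swap2 (x \<otimes>\<^sub>t y) = y \<otimes>\<^sub>t x"
  by (rule poly_mapping_eqI) (auto simp: lookup_swap2 lookup_tensor split: prod.splits)

lemma swap2_tmap: "swap2 (tmap f g v) = tmap g f (swap2 v)"
proof (induction v rule: pm_induct)
  case (single k d)
  show ?case by (cases k) (simp add: tmap_single glin_scal[OF glin_swap2] swap2_tensor, simp add: swap2_def tmap_single)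
qed (simp_all add: tmap_add glin_add[OF glin_swap2] glin_0[OF glin_swap2])

lemma swap2_eq_0: "swap2 v = 0 \<Longrightarrow> v = 0"
  by (rule poly_mapping_eqI) (metis lookup_swap2 lookup_zero surj_pair)

lemma swap2_in: "v \<in> fspace (S \<times> T) \<Longrightarrow> swap2 v \<in> fspace (T \<times> S)"
  by (auto simp: fspace_lookup lookup_swap2)

lemma twist_eq_swap2: "twist = swap2"
  by (simp add: twist_def swap2_def fun_eq_iff)

lemma twist_twist: "twist (twist r) = r"
  by (rule poly_mapping_eqI) (auto simp: twist_eq_swap2 lookup_swap2 split: prod.splits)

subsection \<open>The cyclic sum and the classical Yang-Baxter element\<close>

lemma glin_tensor_right: "glin (\<lambda>y. x \<otimes>\<^sub>t y)"
  by (simp add: linear_into_def tensor_add_right tensor_scal_right)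

lemma tensor_uminus_left: "(- x) \<otimes>\<^sub>t y = - (x \<otimes>\<^sub>t y)"
  and tensor_uminus_right: "x \<otimes>\<^sub>t (- y) = - (x \<otimes>\<^sub>t y)"
  using tensor_diff_left[of 0 x y] tensor_diff_right[of x 0 y] by simp_all

lemma glin_twist: "glin twist"
  unfolding twist_def by (rule glin_lin)

lemma glin_cyc: "glin cyc"
  unfolding cyc_def by (rule glin_lin)

lemma cyc_tensor: "cyc (x \<otimes>\<^sub>t y \<otimes>\<^sub>t z) = y \<otimes>\<^sub>t z \<otimes>\<^sub>t x"
proof (induction x rule: pm_induct)
  case (single a c)
  show ?case
  proof (induction y rule: pm_induct)
    case (single b d)
    show ?case
      by (induction z rule: pm_induct)
        (simp_all add: tensor_add_left tensor_add_right glin_add[OF glin_cyc] glin_0[OF glin_cyc]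
          tensor_single_single mult_ac, simp add: cyc_def mult_ac)
  qed (simp_all add: tensor_add_left tensor_add_right glin_add[OF glin_cyc] glin_0[OF glin_cyc])
qed (simp_all add: tensor_add_left tensor_add_right glin_add[OF glin_cyc] glin_0[OF glin_cyc])

text \<open>For r = sum of a \<otimes> b and a second copy r = sum of c \<otimes> d, this is the sum
  of F over both copies. Both c(r) and the co-Jacobi expression of \<Delta> = \<Delta>_r have this
  shape.\<close>

definition quad :: "('a \<Rightarrow> 'a \<Rightarrow> 'a \<Rightarrow> 'a \<Rightarrow> ('b \<Rightarrow>\<^sub>0 'f)) \<Rightarrow> (('a \<times> 'a) \<Rightarrow>\<^sub>0 'f) \<Rightarrow> ('b \<Rightarrow>\<^sub>0 'f::field)"
  where "quad F r = bilin (\<lambda>(a, b) (c, d). F a b c d) r r"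

lemma quad_lin: "quad F r = lin (\<lambda>(a, b). lin (\<lambda>(c, d). F a b c d) r) r"
  by (simp add: quad_def bilin_def case_prod_unfold)

lemma quad_add: "quad (\<lambda>a b c d. F a b c d + G a b c d) r = quad F r + quad G r"
  by (simp add: quad_lin case_prod_unfold lin_add_fun)

lemma glin_quad: "glin f \<Longrightarrow> f (quad F r) = quad (\<lambda>a b c d. f (F a b c d)) r"
  by (simp add: quad_lin glin_of_lin case_prod_unfold)

lemma quad_uminus: "quad (\<lambda>a b c d. - F a b c d) r = - quad F r"
  using glin_quad[of uminus F r] by (simp add: linear_into_def fs.scale_minus_right)

lemma quad_swap: "quad F r = quad (\<lambda>a b c d. F c d a b) r"
proof -
  have "quad F r = (\<Sum>p\<in>Poly_Mapping.keys r. \<Sum>q\<in>Poly_Mapping.keys r.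
      Poly_Mapping.lookup r p \<odot> Poly_Mapping.lookup r q \<odot> F (fst p) (snd p) (fst q) (snd q))" for F
    by (simp add: quad_lin lin_def fs.scale_sum_right case_prod_unfold del: fs.scale_scale)
  note this[of F] this[of "\<lambda>a b c d. F c d a b"]
  then show ?thesis
    by (simp only:) (subst sum.swap, simp only: fs.scale_left_commute)
qed

lemma lin_twist:
  assumes "twist r = - r"
  shows "lin (\<lambda>(a, b). g a b) r = - lin (\<lambda>(a, b). g b a) r"
proof -
  have "lin (\<lambda>(a, b). g b a) r = lin (\<lambda>(a, b). g a b) (twist r)"
    by (simp add: twist_def lin_lin case_prod_unfold)
  also have "\<dots> = - lin (\<lambda>(a, b). g a b) r"
    using lin_diff[of _ 0 r] by (simp add: assms)
  finally show ?thesis by simp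
qed

lemma quad_flip_right:
  assumes "twist r = - r"
  shows "quad F r = - quad (\<lambda>a b c d. F a b d c) r"
proof -
  have "quad F r = quad (\<lambda>a b c d. - F a b d c) r"
    unfolding quad_lin by (subst lin_twist[OF assms]) (simp add: glin_of_lin linear_into_def fs.scale_minus_right case_prod_unfold)
  then show ?thesis by (simp add: quad_uminus)
qed

lemma quad_flip_left:
  assumes "twist r = - r"
  shows "quad F r = - quad (\<lambda>a b c d. F b a c d) r"
  unfolding quad_lin by (rule lin_twist[OF assms])

text \<open>No carrier set is needed: the Hamiltonian bracket satisfies these laws on all finitely
  supported functions.\<close>

locale pm_lie =
  fixes br :: "('a \<Rightarrow>\<^sub>0 'f) \<Rightarrow> ('a \<Rightarrow>\<^sub>0 'f) \<Rightarrow> ('a \<Rightarrow>\<^sub>0 'f::field)"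
  assumes glin_br: "glin (br x)" and glin_br_left: "glin (\<lambda>x. br x y)"
    and br_swap: "br x y = - br y x"
    and br_br: "br (br x y) z = br x (br y z) - br y (br x z)"
begin

lemma act2_add_left: "act2 br (x + y) v = act2 br x v + act2 br y v"
proof -
  have "br (x + y) = (\<lambda>z. br x z + br y z)"
    using glin_add[OF glin_br_left] by blast
  then show ?thesis by (simp add: act2_def tmap_add_fun_left tmap_add_fun_right add_ac)
qed

lemma act2_scal_left: "act2 br (c \<odot> x) v = c \<odot> act2 br x v"
proof -
  have "br (c \<odot> x) = (\<lambda>z. c \<odot> br x z)"
    using glin_scal[OF glin_br_left] by blast
  then show ?thesis by (simp add: act2_def tmap_scal_fun_left tmap_scal_fun_right fs.scale_right_distrib)
qed

lemma glin_act2_left: "glin (\<lambda>x. act2 br x v)"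
  by (simp add: linear_into_def act2_add_left act2_scal_left)

lemma act2_br: "act2 br (br x y) v = act2 br x (act2 br y v) - act2 br y (act2 br x v)"
proof -
  have *: "br (br x y) = (\<lambda>z. (br x \<circ> br y) z - (br y \<circ> br x) z)"
    by (simp add: fun_eq_iff br_br)
  show ?thesis
    unfolding act2_def * tmap_diff_fun_left tmap_diff_fun_right tmap_add
      tmap_tmap[OF glin_br glin_id] tmap_tmap[OF glin_id glin_br] comp_id id_comp
    by (simp add: algebra_simps comp_def)
qed

lemma twist_act2: "twist (act2 br x r) = act2 br x (twist r)"
  by (simp add: act2_def twist_eq_swap2 glin_add[OF glin_swap2] swap2_tmap add.commute)

lemma act3_tensor:
  "act3 br x (u \<otimes>\<^sub>t v \<otimes>\<^sub>t w) = br x u \<otimes>\<^sub>t v \<otimes>\<^sub>t w + u \<otimes>\<^sub>t br x v \<otimes>\<^sub>t w + u \<otimes>\<^sub>t v \<otimes>\<^sub>t br x w"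
  by (simp add: act3_def tmap_tensor' glin_br glin_id glin_tmap)

lemma glin_act3: "glin (act3 br x)"
  by (simp add: linear_into_def act3_def tmap_add tmap_scal fs.scale_right_distrib add_ac)

lemma act2_lin: "act2 br x r = lin (\<lambda>(a, b). br x (bas a) \<otimes>\<^sub>t bas b + bas a \<otimes>\<^sub>t br x (bas b)) r"
  by (simp add: act2_def tmap_def case_prod_unfold flip: lin_add_fun)

text \<open>The three summands are [r12, r13], [r12, r23] and [r13, r23] on a \<otimes> b and c
  \<otimes> d, so \<open>quad cy r\<close> is c(r) written inside the triple tensor power of
  L.\<close>

definition cy where
  "cy a b c d = br (bas a) (bas c) \<otimes>\<^sub>t bas b \<otimes>\<^sub>t bas d + bas a \<otimes>\<^sub>t br (bas b) (bas c) \<otimes>\<^sub>t bas d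
    + bas a \<otimes>\<^sub>t bas c \<otimes>\<^sub>t br (bas b) (bas d)"

text \<open>Each of the twelve terms of \<open>x \<cdot> c(r)\<close> is one of the twelve terms of the cyclic sum
  after exchanging the two copies of \<open>r\<close> or flipping the two legs of a copy.\<close>

theorem cyclic_sum_eq_act3_cybe:
  fixes x :: "'a \<Rightarrow>\<^sub>0 'f" and r :: "'a \<times> 'a \<Rightarrow>\<^sub>0 'f"
  assumes r: "twist r = - r"
  defines "w \<equiv> tmap id (\<lambda>y. act2 br y r) (act2 br x r)"
  shows "w + cyc w + cyc (cyc w) = act3 br x (quad cy r)"
proof -
  \<comment> \<open>These four terms make up w and also occur literally in x acting on c(r).\<close>
  define B where "B = (\<lambda>i a b c d. [br x (bas a) \<otimes>\<^sub>t br (bas b) (bas c) \<otimes>\<^sub>t bas d,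
      br x (bas a) \<otimes>\<^sub>t bas c \<otimes>\<^sub>t br (bas b) (bas d),
      bas a \<otimes>\<^sub>t br (br x (bas b)) (bas c) \<otimes>\<^sub>t bas d,
      bas a \<otimes>\<^sub>t bas c \<otimes>\<^sub>t br (br x (bas b)) (bas d)] ! i)"
  note B = B_def
  have tens: "x \<otimes>\<^sub>t lin \<psi> y = lin (\<lambda>a. x \<otimes>\<^sub>t \<psi> a) y" for x :: "'a \<Rightarrow>\<^sub>0 'f" and \<psi> :: "'a \<times> 'a \<Rightarrow> ('a \<times> 'a \<Rightarrow>\<^sub>0 'f)" and y
    by (rule glin_of_lin[OF glin_tensor_right])
  have "w = quad (\<lambda>a b c d. B 0 a b c d + B 1 a b c d + B 2 a b c d + B 3 a b c d) r"
  proof -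
    define D where "D = (\<lambda>y. act2 br y r)"
    have D: "glin D" "\<And>y. D y = lin (\<lambda>(a, b). br y (bas a) \<otimes>\<^sub>t bas b + bas a \<otimes>\<^sub>t br y (bas b)) r"
      using glin_act2_left[of r] by (simp_all add: D_def act2_lin[of _ r])
    have "w = lin (\<lambda>(a, b). br x (bas a) \<otimes>\<^sub>t D (bas b) + bas a \<otimes>\<^sub>t D (br x (bas b))) r"
      unfolding w_def D_def[symmetric] act2_lin[of x r]
      by (simp add: glin_of_lin[OF glin_tmap] case_prod_unfold tmap_add tmap_tensor'[OF glin_id D(1)])
    then show ?thesis
      by (simp add: D(2) case_prod_unfold quad_lin tens tensor_add_right lin_add_fun B add_ac numeral_nat)
  qed
  then have w: "w = quad (B 0) r + quad (B 1) r + quad (B 2) r + quad (B 3) r"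
    by (simp only: quad_add)
  let ?q = "\<lambda>F. quad F r"
  \<comment> \<open>The remaining eight terms of x acting on c(r), once the Jacobi identity has
    split x applied to a bracket. The two rotations of \<open>B\<close> must account for
    them.\<close>
  define R where "R = (\<lambda>i a b c d. [br (br x (bas a)) (bas c) \<otimes>\<^sub>t bas b \<otimes>\<^sub>t bas d,
      br (bas a) (br x (bas c)) \<otimes>\<^sub>t bas b \<otimes>\<^sub>t bas d,
      br (bas a) (bas c) \<otimes>\<^sub>t br x (bas b) \<otimes>\<^sub>t bas d,
      br (bas a) (bas c) \<otimes>\<^sub>t bas b \<otimes>\<^sub>t br x (bas d),
      bas a \<otimes>\<^sub>t br (bas b) (br x (bas c)) \<otimes>\<^sub>t bas d,
      bas a \<otimes>\<^sub>t br (bas b) (bas c) \<otimes>\<^sub>t br x (bas d),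
      bas a \<otimes>\<^sub>t br x (bas c) \<otimes>\<^sub>t br (bas b) (bas d),
      bas a \<otimes>\<^sub>t bas c \<otimes>\<^sub>t br (bas b) (br x (bas d))] ! i)"
  have x_br: "br x (br y z) = br (br x y) z + br y (br x z)" for y z
    by (simp add: br_br)
  have "act3 br x (quad cy r) = quad (\<lambda>a b c d. R 0 a b c d + R 1 a b c d + R 2 a b c d + R 3 a b c d
      + R 4 a b c d + R 5 a b c d + R 6 a b c d + R 7 a b c d
      + B 0 a b c d + B 1 a b c d + B 2 a b c d + B 3 a b c d) r"
    unfolding glin_quad[OF glin_act3] cy_def glin_add[OF glin_act3] act3_tensor x_br
    by (simp add: R_def B tensor_add_left tensor_add_right add_ac numeral_nat)
  then have R: "act3 br x (quad cy r) = ?q (R 0) + ?q (R 1) + ?q (R 2) + ?q (R 3)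
      + ?q (R 4) + ?q (R 5) + ?q (R 6) + ?q (R 7) + ?q (B 0) + ?q (B 1) + ?q (B 2) + ?q (B 3)"
    by (simp only: quad_add)
  \<comment> \<open>Three symmetries for skew r: flipping both copies keeps the sign, whereas one
    flip followed by an exchange of the copies changes it. In \<open>f\<close> and \<open>g\<close>
    this sign is absorbed by \<open>br_swap\<close>.\<close>
  have both: "quad F r = quad (\<lambda>a b c d. F b a d c) r" for F :: "'a \<Rightarrow> 'a \<Rightarrow> 'a \<Rightarrow> 'a \<Rightarrow> ('a \<times> 'a \<times> 'a \<Rightarrow>\<^sub>0 'f)"
    using quad_flip_left[OF r, of F] quad_flip_right[OF r, of "\<lambda>a b c d. F b a c d"] by simp
  have rl1: "quad F r = - quad (\<lambda>a b c d. F d c a b) r" for F :: "'a \<Rightarrow> 'a \<Rightarrow> 'a \<Rightarrow> 'a \<Rightarrow> ('a \<times> 'a \<times> 'a \<Rightarrow>\<^sub>0 'f)"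
    using quad_flip_left[OF r, of F] quad_swap[of "\<lambda>a b c d. F b a c d" r] by simp
  have rl2: "quad F r = - quad (\<lambda>a b c d. F c d b a) r" for F :: "'a \<Rightarrow> 'a \<Rightarrow> 'a \<Rightarrow> 'a \<Rightarrow> ('a \<times> 'a \<times> 'a \<Rightarrow>\<^sub>0 'f)"
    using quad_flip_right[OF r, of F] quad_swap[of "\<lambda>a b c d. F a b d c" r] by simp
  let ?c = "\<lambda>i. ?q (\<lambda>a b c d. cyc (B i a b c d))" and ?cc = "\<lambda>i. ?q (\<lambda>a b c d. cyc (cyc (B i a b c d)))"
  have e: "?cc 3 = ?q (R 0)" "?cc 1 = ?q (R 2)"
    by (subst both; simp add: B R_def cyc_tensor numeral_nat)+
  have neg: "- quad F r = quad (\<lambda>a b c d. - F a b c d) r" for F :: "'a \<Rightarrow> 'a \<Rightarrow> 'a \<Rightarrow> 'a \<Rightarrow> ('a \<times> 'a \<times> 'a \<Rightarrow>\<^sub>0 'f)"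
    by (simp add: quad_uminus)
  have f: "?c 2 = ?q (R 1)" "?c 0 = ?q (R 3)" "?c 3 = ?q (R 4)" "?c 1 = ?q (R 5)"
    by (subst rl1, unfold neg, rule arg_cong[of _ _ "\<lambda>F. quad F r"], intro ext,
        simp add: B R_def cyc_tensor numeral_nat,
        subst br_swap, simp add: tensor_uminus_left tensor_uminus_right)+
  have g: "?cc 0 = ?q (R 6)" "?cc 2 = ?q (R 7)"
    by (subst rl2, unfold neg, rule arg_cong[of _ _ "\<lambda>F. quad F r"], intro ext,
        simp add: B R_def cyc_tensor numeral_nat,
        subst br_swap, simp add: tensor_uminus_left tensor_uminus_right)+
  show ?thesis
    unfolding R w glin_add[OF glin_cyc] glin_quad[OF glin_cyc]
    unfolding e f g
    by (simp add: add_ac)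
qed

section \<open>The adjoint representation of the enveloping algebra\<close>

definition wact :: "'a word \<Rightarrow> ('a \<Rightarrow>\<^sub>0 'f) \<Rightarrow> ('a \<Rightarrow>\<^sub>0 'f)"
  where "wact w y = foldr (\<lambda>a. br (bas a)) (letters w) y"

lemma wact_plus: "wact (v + w) y = wact v (wact w y)"
  by (simp add: wact_def plus_word_def)

lemma glin_wact: "glin (wact w)"
proof -
  have "glin (foldr (\<lambda>a. br (bas a)) l)" for l
  proof (induction l)
    case Nil
    show ?case using glin_id by (simp add: id_def)
  next
    case (Cons a l)
    then have "glin (br (bas a) \<circ> foldr (\<lambda>a. br (bas a)) l)"
      by (rule glin_comp[OF glin_br])
    then show ?case by (simp add: comp_def)
  qed
  then show ?thesis by (simp add: wact_def[abs_def])
qed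

definition adrep :: "('a word \<Rightarrow>\<^sub>0 'f) \<Rightarrow> ('a \<Rightarrow>\<^sub>0 'f) \<Rightarrow> ('a \<Rightarrow>\<^sub>0 'f)"
  where "adrep u y = lin (\<lambda>w. wact w y) u"

lemma glin_adrep_left: "glin (\<lambda>u. adrep u y)"
  unfolding adrep_def by (rule glin_lin)

lemma glin_adrep: "glin (adrep u)"
proof (induction u rule: pm_induct)
  case (single w c)
  show ?case
    using glin_wact[of w] by (simp add: adrep_def linear_into_def fs.scale_right_distrib mult.commute)
qed (auto simp: linear_into_def adrep_def lin_add add_ac fs.scale_right_distrib)

lemma adrep_mult: "adrep (u * v) y = adrep u (adrep v y)"
proof (induction u rule: pm_induct)
  case (single w c)
  show ?case
  proof (induction v rule: pm_induct)
    case (single w' c')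
    show ?case
      by (simp add: adrep_def mult_single wact_plus glin_scal[OF glin_wact])
  qed (simp_all add: distrib_left glin_add[OF glin_adrep_left] glin_0[OF glin_adrep_left]
      glin_add[OF glin_adrep] glin_0[OF glin_adrep])
qed (simp_all add: distrib_right glin_add[OF glin_adrep_left] glin_0[OF glin_adrep_left])

lemma adrep_incl: "adrep (incl x) y = br x y"
  unfolding adrep_def incl_def lin_lin
  by (subst glin_expand[OF glin_br_left]) (simp add: wact_def)

text \<open>By the Jacobi identity the relation xy - yx - [x, y] acts as zero, so the action of the
  tensor algebra descends to the enveloping algebra.\<close>

lemma adrep_env_ideal:
  assumes "u \<in> env_ideal S br"
  shows "adrep u y = 0"
proof -
  have sub: "fs.subspace {u. \<forall>y. adrep u y = 0}"
    by (simp add: fs.subspace_def glin_add[OF glin_adrep_left] glin_0[OF glin_adrep_left] glin_scal[OF glin_adrep_left])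
  have "env_ideal S br \<subseteq> {u. \<forall>y. adrep u y = 0}"
    unfolding env_ideal_def
  proof (rule fs.span_minimal[OF _ sub], clarify)
    fix u v :: "'a word \<Rightarrow>\<^sub>0 'f" and x y z :: "'a \<Rightarrow>\<^sub>0 'f"
    show "adrep (u * (incl x * incl y - incl y * incl x - incl (br x y)) * v) z = 0"
      by (simp add: adrep_mult glin_diff[OF glin_adrep_left] adrep_incl br_br glin_0[OF glin_adrep])
  qed
  then show ?thesis using assms by blast
qed

text \<open>The three legs act on three test vectors separately. The result depends only on the
  class in the triple tensor power of the enveloping algebra, by
  \<open>adrep3_env_ideal3\<close>.\<close>

definition adrep3 where
  "adrep3 x y z = tmap (\<lambda>u. adrep u x) (tmap (\<lambda>u. adrep u y) (\<lambda>u. adrep u z))"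

lemma adrep3_tensor: "adrep3 x y z (p \<otimes>\<^sub>t q \<otimes>\<^sub>t s) = adrep p x \<otimes>\<^sub>t adrep q y \<otimes>\<^sub>t adrep s z"
  by (simp add: adrep3_def tmap_tensor' glin_adrep_left glin_tmap)

lemma adrep3_env_ideal3:
  assumes "u \<in> env_ideal3 S br"
  shows "adrep3 x y z u = 0"
proof -
  have "glin (adrep3 x y z)" by (simp add: adrep3_def glin_tmap)
  then have sub: "fs.subspace {u. adrep3 x y z u = 0}"
    by (simp add: fs.subspace_def glin_add glin_0 glin_scal)
  have "env_ideal3 S br \<subseteq> {u. adrep3 x y z u = 0}"
    unfolding env_ideal3_def
    by (rule fs.span_minimal[OF _ sub]) (auto simp: adrep3_tensor adrep_env_ideal)
  then show ?thesis using assms by blast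
qed

lemma adrep3_incl:
  "adrep3 x y z (tmap incl (tmap incl incl) c) =
    tmap (\<lambda>a. br a x) (tmap (\<lambda>b. br b y) (\<lambda>c. br c z)) c"
proof -
  have i: "(\<lambda>u. adrep u x) \<circ> incl = (\<lambda>a. br a x)" for x
    by (simp add: fun_eq_iff adrep_incl)
  have "tmap (\<lambda>u. adrep u y) (\<lambda>u. adrep u z) \<circ> tmap incl incl = tmap (\<lambda>b. br b y) (\<lambda>c. br c z)"
    by (simp add: fun_eq_iff tmap_tmap[OF glin_adrep_left glin_adrep_left] i)
  then show ?thesis
    by (simp add: adrep3_def tmap_tmap[OF glin_adrep_left glin_tmap] i)
qed

lemma slice_separates:
  assumes center: "\<forall>f\<in>fspace S. (\<forall>y. br f y = 0) \<longrightarrow> f = 0"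
    and v: "v \<in> fspace (S \<times> T)" and "\<And>y. tmap (\<lambda>a. br a y) id v = 0"
  shows "v = 0"
proof (rule slice_eq_0)
  fix c
  have "br (slice c v) y = 0" for y
    using assms(3)[of y] slice_tmap_id[OF glin_br_left, of c y v] by (simp add: glin_0[OF glin_slice])
  then show "slice c v = 0" using center slice_in[OF v] by blast
qed

text \<open>The legs are freed one at a time. For fixed y and z the first leg is removed by
  \<open>slice_separates\<close>; slicing along the first leg then leaves double tensors, for which
  the same argument is run twice with a swap in between.\<close>

lemma ad_tensor3_separates:
  assumes center: "\<forall>f\<in>fspace S. (\<forall>y. br f y = 0) \<longrightarrow> f = 0"
    and c: "c \<in> fspace (S \<times> S \<times> S)"
    and zero: "\<And>x y z. tmap (\<lambda>a. br a x) (tmap (\<lambda>b. br b y) (\<lambda>c. br c z)) c = 0"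
  shows "c = 0"
proof -
  note sep = slice_separates[OF center]
  have split: "tmap f g v = tmap f id (tmap id g v)" if "glin f" for f g v
    using tmap_tmap[OF that glin_id, of id g v] by simp
  have 2: "s = 0" if s: "s \<in> fspace (S \<times> S)"
    "\<And>y z. tmap (\<lambda>b. br b y) (\<lambda>c. br c z) s = 0" for s
  proof -
    have "tmap id (\<lambda>c. br c z) s = 0" for z
    proof (rule sep)
      show "tmap id (\<lambda>c. br c z) s \<in> fspace (S \<times> UNIV)"
        by (rule tmap_in_fspace[OF s(1)]) (auto intro: fspace_single)
      show "tmap (\<lambda>a. br a y) id (tmap id (\<lambda>c. br c z) s) = 0" for y
        by (subst split[OF glin_br_left, symmetric]) (rule s(2))
    qed
    then have "swap2 s = 0"
      by (intro sep[OF swap2_in[OF s(1)]]) (simp_all add: glin_0[OF glin_swap2] flip: swap2_tmap)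
    then show ?thesis by (rule swap2_eq_0)
  qed
  have 1: "tmap id (tmap (\<lambda>b. br b y) (\<lambda>c. br c z)) c = 0" for y z
  proof (rule sep)
    show "tmap id (tmap (\<lambda>b. br b y) (\<lambda>c. br c z)) c \<in> fspace (S \<times> UNIV)"
      by (rule tmap_in_fspace[OF c]) (auto intro: fspace_single)
    show "tmap (\<lambda>a. br a x) id (tmap id (tmap (\<lambda>b. br b y) (\<lambda>c. br c z)) c) = 0" for x
      by (subst split[OF glin_br_left, symmetric]) (rule zero)
  qed
  have "slice a (swap2 c) = 0" for a
  proof (rule 2)
    show "slice a (swap2 c) \<in> fspace (S \<times> S)"
      by (rule slice_in[OF swap2_in[OF c]])
    show "tmap (\<lambda>b. br b y) (\<lambda>c. br c z) (slice a (swap2 c)) = 0" for y z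
      using 1[of y z] swap2_tmap[of id "tmap (\<lambda>b. br b y) (\<lambda>c. br c z)" c]
        slice_tmap_id[OF glin_tmap, of a "\<lambda>b. br b y" "\<lambda>c. br c z" "swap2 c"]
      by (simp add: glin_0[OF glin_swap2] glin_0[OF glin_slice])
  qed
  then show ?thesis by (rule swap2_eq_0[OF slice_eq_0])
qed

text \<open>Instead of appealing to Poincare-Birkhoff-Witt, uniqueness of \<open>c(r)\<close> is read off from the
  adjoint representation, which is faithful because the centre is trivial.\<close>

lemma cybe_eq_quad:
  assumes center: "\<forall>f\<in>fspace S. (\<forall>y. br f y = 0) \<longrightarrow> f = 0"
    and closed: "\<forall>x\<in>fspace S. \<forall>y\<in>fspace S. br x y \<in> fspace S"
    and r: "r \<in> fspace (S \<times> S)"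
  shows "cybe S br r = quad cy r" and "quad cy r \<in> fspace (S \<times> S \<times> S)"
proof -
  have q: "quad cy r = bilin (\<lambda>(a, b) (c, d). br (bas a) (bas c) \<otimes>\<^sub>t bas b \<otimes>\<^sub>t bas d +
      bas a \<otimes>\<^sub>t br (bas b) (bas c) \<otimes>\<^sub>t bas d + bas a \<otimes>\<^sub>t bas c \<otimes>\<^sub>t br (bas b) (bas d)) r r"
    by (simp add: quad_def cy_def)
  show in3: "quad cy r \<in> fspace (S \<times> S \<times> S)"
    unfolding q by (rule cybe_exists(1)[OF closed[rule_format] r])
  have e: "tmap incl (tmap incl incl) (quad cy r) - cybe_env r \<in> env_ideal3 S br"
    unfolding q by (rule cybe_exists(2)[OF closed[rule_format] r])
  show "cybe S br r = quad cy r"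
    unfolding cybe_def
  proof (rule the_equality)
    show "quad cy r \<in> fspace (S \<times> S \<times> S) \<and> tmap incl (tmap incl incl) (quad cy r) - cybe_env r \<in> env_ideal3 S br"
      using in3 e by blast
    fix c assume c: "c \<in> fspace (S \<times> S \<times> S) \<and> tmap incl (tmap incl incl) c - cybe_env r \<in> env_ideal3 S br"
    have "tmap incl (tmap incl incl) (c - quad cy r) \<in> env_ideal3 S br"
    proof -
      have "(tmap incl (tmap incl incl) c - cybe_env r) - (tmap incl (tmap incl incl) (quad cy r) - cybe_env r)
          \<in> env_ideal3 S br"
        using fs.span_diff[OF conjunct2[OF c, unfolded env_ideal3_def] e[unfolded env_ideal3_def]]
        unfolding env_ideal3_def .
      then show ?thesis by (simp add: tmap_diff)
    qed
    note ideal = this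
    have "c - quad cy r = 0"
    proof (rule ad_tensor3_separates[OF center])
      show "c - quad cy r \<in> fspace (S \<times> S \<times> S)" using c in3 by (intro fspace_diff) auto
      show "tmap (\<lambda>a. br a x) (tmap (\<lambda>b. br b y) (\<lambda>c. br c z)) (c - quad cy r) = 0" for x y z
        unfolding adrep3_incl[symmetric] by (rule adrep3_env_ideal3[OF ideal])
    qed
    then show "c = quad cy r" by simp
  qed
qed

end

text \<open>When all derivations are inner, the equivalence relation relates any two of them, so
  there is exactly one class.\<close>

lemma Der_quotient_trivial:
  assumes "Der S br V act = Inn S V act" and "0 \<in> V"
    and diff: "\<And>x y. x \<in> V \<Longrightarrow> y \<in> V \<Longrightarrow> x - y \<in> V"
    and act: "\<And>x y z. act x (y - z) = act x y - act x z"
  shows "H1 S br V act = {Inn S V act}"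
proof -
  have sub: "(\<lambda>x. d x - e x) \<in> Inn S V act" if "d \<in> Inn S V act" "e \<in> Inn S V act" for d e
  proof -
    obtain a b where "a \<in> V" "b \<in> V" "d = (\<lambda>x. if x \<in> fspace S then act x a else 0)"
      "e = (\<lambda>x. if x \<in> fspace S then act x b else 0)"
      using \<open>d \<in> _\<close> \<open>e \<in> _\<close> unfolding Inn_def by blast
    then show ?thesis
      unfolding Inn_def using diff act by (auto intro!: exI[of _ "a - b"])
  qed
  have "Inn S V act \<noteq> {}" using assms(2) by (auto simp: Inn_def)
  moreover have "{(d, e). d \<in> Inn S V act \<and> e \<in> Inn S V act \<and> (\<lambda>x. d x - e x) \<in> Inn S V act}
      = Inn S V act \<times> Inn S V act"
    using sub by auto
  ultimately show ?thesis
    unfolding H1_def assms(1) quotient_def by auto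
qed

subsection \<open>The Hamiltonian Lie algebra\<close>

locale ham =
  fixes \<epsilon> :: "'n::finite + 'n \<Rightarrow> 'f::field_char_0 ^ ('n + 'n)"
    and \<Gamma> :: "('f ^ ('n + 'n)) set" and p :: 'n
  assumes zero_in: "0 \<in> \<Gamma>"
    and diff_in: "\<alpha> \<in> \<Gamma> \<Longrightarrow> \<beta> \<in> \<Gamma> \<Longrightarrow> \<alpha> - \<beta> \<in> \<Gamma>"
    and eps: "inj \<epsilon>" "vec.independent (range \<epsilon>)" "vec.span (range \<epsilon>) = UNIV"
    and eps_in': "range \<epsilon> \<subseteq> \<Gamma>"
begin

abbreviation S where "S \<equiv> \<Gamma> - {0}"

abbreviation hb where "hb \<equiv> ham_br \<epsilon>"

abbreviation sg where "sg \<equiv> ham_sigma \<epsilon> p"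

text \<open>The eigenvalue of \<open>ad sg\<close> on the basis vector at a (see
  \<open>ad_sg\<close>); it provides the grading by weights.\<close>

definition lam :: "'f ^ ('n + 'n) \<Rightarrow> 'f"
  where "lam a = coord \<epsilon> a (Inr p) - coord \<epsilon> a (Inl p)"

definition W :: "'f \<Rightarrow> 'f \<Rightarrow> (('f ^ ('n + 'n)) \<times> ('f ^ ('n + 'n))) set"
  where "W \<mu> \<nu> = {(a, c). lam a = \<mu> \<and> lam c = \<nu>}"

text \<open>The bracket is taken before the constants are factored out, because the shift formulas
  then hold without exception. \<open>hb_bas\<close> gives the passage to the quotient.\<close>

definition ad :: "'f ^ ('n + 'n) \<Rightarrow> ('f ^ ('n + 'n) \<Rightarrow>\<^sub>0 'f) \<Rightarrow> ('f ^ ('n + 'n) \<Rightarrow>\<^sub>0 'f)"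
  where "ad b = hbar_br \<epsilon> (bas b)"

definition adl where "adl b = tmap (ad b) id"

definition adr where "adr b = tmap id (ad b)"

lemmas coord_simps = coord_linear[OF eps(2,3)] coord_basis[OF eps(1,2)]

lemma coord_scale: "coord \<epsilon> (c *s a) q = c * coord \<epsilon> a q"
  unfolding coord_def using eps by (simp add: vec.representation_scale)

lemma coord_eq_0: "(\<And>q. coord \<epsilon> a q = 0) \<Longrightarrow> a = 0"
proof -
  assume *: "\<And>q. coord \<epsilon> a q = 0"
  have "(\<Sum>v | vec.representation (range \<epsilon>) a v \<noteq> 0. vec.representation (range \<epsilon>) a v *s v) = a"
    using eps by (intro vec.sum_nonzero_representation_eq) auto
  moreover have "{v. vec.representation (range \<epsilon>) a v \<noteq> 0} = {}"
    using * vec.representation_ne_zero[of "range \<epsilon>" a] unfolding coord_def by blast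
  ultimately show "a = 0" by simp
qed

lemma coord_sigma: "coord \<epsilon> (ham_sigma \<epsilon> i) q = (if q = Inl i \<or> q = Inr i then 1 else 0)"
  by (auto simp: ham_sigma_def coord_simps)

lemma eps_in: "\<epsilon> q \<in> \<Gamma>"
  using eps_in' by auto

lemma uminus_in: "a \<in> \<Gamma> \<Longrightarrow> - a \<in> \<Gamma>"
  using diff_in[OF zero_in, of a] by simp

lemma add_in: "a \<in> \<Gamma> \<Longrightarrow> b \<in> \<Gamma> \<Longrightarrow> a + b \<in> \<Gamma>"
  using diff_in[of a "- b"] uminus_in by simp

lemma scale_in: "a \<in> \<Gamma> \<Longrightarrow> of_nat k *s a \<in> \<Gamma>"
  by (induction k) (simp_all add: zero_in add_in vec.scale_left_distrib)

lemma sigma_in: "ham_sigma \<epsilon> i \<in> \<Gamma>"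
  by (simp add: ham_sigma_def add_in eps_in)

lemma lam_add [simp]: "lam (a + b) = lam a + lam b"
  and lam_diff [simp]: "lam (a - b) = lam a - lam b"
  and lam_0 [simp]: "lam 0 = 0"
  and lam_scale [simp]: "lam (c *s a) = c * lam a"
  and lam_sigma [simp]: "lam (ham_sigma \<epsilon> i) = 0"
  and lam_eps [simp]: "lam (\<epsilon> q) = (if q = Inr p then 1 else if q = Inl p then - 1 else 0)"
  by (auto simp: lam_def coord_simps coord_scale coord_sigma algebra_simps)

lemma sg_neq_0: "sg \<noteq> 0"
  using coord_sigma[of p "Inl p"] by (auto simp: coord_simps)

lemma glin_ad: "glin (ad b)"
  by (simp add: ad_def linear_into_def hbar_br_add_right hbar_br_scal_right)

lemma ad_bas: "ad b (bas a) = (\<Sum>i\<in>UNIV. Poly_Mapping.single (b + a - ham_sigma \<epsilon> i) (ham_omega \<epsilon> i b a))"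
  by (simp add: ad_def hbar_br_single)

lemma ad_weight: "ad b (bas a) \<in> fspace {c. lam c = lam b + lam a}"
  unfolding ad_bas by (intro fspace_sum fspace_single) simp

lemma ad_in: "a \<in> \<Gamma> \<Longrightarrow> b \<in> \<Gamma> \<Longrightarrow> ad b (bas a) \<in> fspace \<Gamma>"
  unfolding ad_bas by (intro fspace_sum fspace_single diff_in add_in sigma_in)

lemma drop0_eq: "drop0 x = pm_restrict (- {0}) x"
  by (rule poly_mapping_eqI) (simp add: drop0_def lookup_minus lookup_single lookup_pm_restrict when_def)

lemma hb_bas: "hb (bas b) x = pm_restrict (- {0}) (ad b x)"
  by (simp add: ham_br_def drop0_eq ad_def)

section \<open>Shifts by \<sigma> and the actions on the two legs\<close>

lemma omega_sigma:
  "ham_omega \<epsilon> i b (sg + a) = ham_omega \<epsilon> i b a - (if i = p then lam b else 0)"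
  "ham_omega \<epsilon> i (b + sg) a = ham_omega \<epsilon> i b a + (if i = p then lam a else 0)"
  by (auto simp: ham_omega_def coord_simps coord_sigma lam_def algebra_simps)

lemma single_if: "Poly_Mapping.single k (if P then c else 0) = (if P then Poly_Mapping.single k c else 0)"
  by simp

text \<open>Adding \<open>sg\<close> raises both coordinates of the pair \<open>p\<close> by one,
  which changes only the \<open>p\<close>-th summand of the bracket. Hence \<open>ad b\<close>
  commutes with multiplication by t^\<sigma> up to one monomial.\<close>

lemma ad_sg_right: "ad b (bas (sg + a)) = bas sg * ad b (bas a) - Poly_Mapping.single (b + a) (lam b)"
proof -
  have "ad b (bas (sg + a)) = (\<Sum>i\<in>UNIV. Poly_Mapping.single (b + (sg + a) - ham_sigma \<epsilon> i) (ham_omega \<epsilon> i b a)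
      - (if i = p then Poly_Mapping.single (b + a) (lam b) else 0))"
    unfolding ad_bas omega_sigma single_diff single_if by (intro sum.cong refl) simp
  then show ?thesis
    by (simp add: sum_subtractf ad_bas sum_distrib_left mult_single algebra_simps)
qed

lemma ad_sg_left: "ad (b + sg) (bas a) = bas sg * ad b (bas a) + Poly_Mapping.single (b + a) (lam a)"
proof -
  have "ad (b + sg) (bas a) = (\<Sum>i\<in>UNIV. Poly_Mapping.single (b + sg + a - ham_sigma \<epsilon> i) (ham_omega \<epsilon> i b a)
      + (if i = p then Poly_Mapping.single (b + a) (lam a) else 0))"
    unfolding ad_bas omega_sigma single_add single_if by (intro sum.cong refl) simp
  then show ?thesis
    by (simp add: sum.distrib ad_bas sum_distrib_left mult_single algebra_simps)
qed

lemma ad_0: "ad 0 x = 0"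
  by (subst glin_expand[OF glin_ad]) (simp add: ad_bas ham_omega_def coord_simps lin_def)

lemma ad_sg: "ad sg (bas a) = Poly_Mapping.single a (lam a)"
  using ad_sg_left[of 0 a] by (simp add: ad_0)

lemma glin_adl: "glin (adl b)" and glin_adr: "glin (adr b)"
  unfolding adl_def adr_def by (rule glin_tmap)+

lemmas adl_add = glin_add[OF glin_adl] and adr_add = glin_add[OF glin_adr]
  and adl_diff = glin_diff[OF glin_adl] and adr_diff = glin_diff[OF glin_adr]
  and adl_0 [simp] = glin_0[OF glin_adl] and adr_0 [simp] = glin_0[OF glin_adr]

lemma adl_single: "adl b (Poly_Mapping.single (a, c) d) = d \<odot> (ad b (bas a) \<otimes>\<^sub>t bas c)"
  and adr_single: "adr b (Poly_Mapping.single (c, a) d) = d \<odot> (bas c \<otimes>\<^sub>t ad b (bas a))"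
  by (simp_all add: adl_def adr_def tmap_single)

abbreviation "X \<equiv> bas (sg, 0 :: 'f ^ ('n + 'n)) :: _ \<Rightarrow>\<^sub>0 'f"

abbreviation "Y \<equiv> bas (0 :: 'f ^ ('n + 'n), sg) :: _ \<Rightarrow>\<^sub>0 'f"

text \<open>The correction term is what later produces the multiples of u by a monomial in
  \<open>der_W_identity\<close>; the divisibility by \<open>X - Y\<close> is read off from
  them.\<close>

lemma adl_X: "adl b (X * u) = X * adl b u - lam b \<odot> (bas (b, 0) * u)"
proof (induction u rule: pm_induct)
  case (single k d)
  show ?case
    by (cases k) (simp add: mult_single adl_single ad_sg_right tensor_diff_left tensor_shift_left
        tensor_single_single mult_scal fs.scale_right_diff_distrib mult.commute[of "lam b"])
qed (simp_all add: adl_add distrib_left fs.scale_right_distrib)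

lemma adl_Y: "adl b (Y * u) = Y * adl b u"
proof (induction u rule: pm_induct)
  case (single k d)
  obtain a c where k: "k = (a, c)" by force
  show ?case
    using tensor_shift_right[of "ad b (bas a)" sg "bas c"]
    by (simp add: k mult_single adl_single mult_scal)
qed (simp_all add: adl_add distrib_left fs.scale_right_distrib)

lemma adr_Y: "adr b (Y * u) = Y * adr b u - lam b \<odot> (bas (0, b) * u)"
proof (induction u rule: pm_induct)
  case (single k d)
  show ?case
    by (cases k) (simp add: mult_single adr_single ad_sg_right tensor_diff_right tensor_shift_right
        tensor_single_single mult_scal fs.scale_right_diff_distrib mult.commute[of "lam b"])
qed (simp_all add: adr_add distrib_left fs.scale_right_distrib)

lemma adr_X: "adr b (X * u) = X * adr b u"
proof (induction u rule: pm_induct)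
  case (single k d)
  obtain a c where k: "k = (a, c)" by force
  show ?case
    using tensor_shift_left[of sg "bas a" "ad b (bas c)"]
    by (simp add: k mult_single adr_single mult_scal)
qed (simp_all add: adr_add distrib_left fs.scale_right_distrib)

lemma adl_add_sg: "adl (b + sg) u = X * adl b u + bas (b, 0) * adl sg u"
proof (induction u rule: pm_induct)
  case (single k d)
  show ?case
    by (cases k) (simp add: mult_single adl_single ad_sg_left ad_sg tensor_add_left tensor_shift_left
        tensor_single_single mult_scal fs.scale_right_distrib mult.commute)
qed (simp_all add: adl_add distrib_left add_ac)

lemma adr_add_sg: "adr (b + sg) u = Y * adr b u + bas (0, b) * adr sg u"
proof (induction u rule: pm_induct)
  case (single k d)
  show ?case
    by (cases k) (simp add: mult_single adr_single ad_sg_left ad_sg tensor_add_right tensor_shift_right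
        tensor_single_single mult_scal fs.scale_right_distrib mult.commute)
qed (simp_all add: adr_add distrib_left add_ac)

lemma lookup_adl_sg: "Poly_Mapping.lookup (adl sg u) k = lam (fst k) * Poly_Mapping.lookup u k"
proof (induction u rule: pm_induct)
  case (single k d)
  show ?case
    by (cases k) (auto simp: adl_single ad_sg tensor_single_single lookup_single when_def)
qed (simp_all add: adl_add lookup_add distrib_left)

lemma lookup_adr_sg: "Poly_Mapping.lookup (adr sg u) k = lam (snd k) * Poly_Mapping.lookup u k"
proof (induction u rule: pm_induct)
  case (single k d)
  show ?case
    by (cases k) (auto simp: adr_single ad_sg tensor_single_single lookup_single when_def)
qed (simp_all add: adr_add lookup_add distrib_left)

lemma adl_sg: "u \<in> fspace {k. lam (fst k) = \<mu>} \<Longrightarrow> adl sg u = \<mu> \<odot> u"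
  and adr_sg: "u \<in> fspace {k. lam (snd k) = \<mu>} \<Longrightarrow> adr sg u = \<mu> \<odot> u"
  by (rule poly_mapping_eqI, force simp: lookup_adl_sg lookup_adr_sg fspace_lookup)+

section \<open>Weight components of the action\<close>

lemma W_Int: "W \<mu> \<nu> \<inter> W \<mu>' \<nu>' = (if \<mu> = \<mu>' \<and> \<nu> = \<nu>' then W \<mu> \<nu> else {})"
  by (auto simp: W_def)

lemma restrict_W_adl: "pm_restrict (W \<mu> \<nu>) (adl b v) = adl b (pm_restrict (W (\<mu> - lam b) \<nu>) v)"
proof -
  have *: "ad b (bas a) \<otimes>\<^sub>t bas c \<in> fspace {k. lam (fst k) = lam b + lam a \<and> snd k = c}" for a c
    using tensor_in_fspace[OF ad_weight[of b a], of "bas c" "{c}"]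
    by (auto simp: fspace_def)
  show ?thesis
    unfolding adl_def tmap_def
    by (intro pm_restrict_lin) (auto simp: W_def intro!: fspace_mono[OF *])
qed

lemma restrict_W_adr: "pm_restrict (W \<mu> \<nu>) (adr b v) = adr b (pm_restrict (W \<mu> (\<nu> - lam b)) v)"
proof -
  have *: "bas c \<otimes>\<^sub>t ad b (bas a) \<in> fspace {k. lam (snd k) = lam b + lam a \<and> fst k = c}" for a c
    using tensor_in_fspace[OF _ ad_weight[of b a], of "bas c" "{c}"]
    by (auto simp: fspace_def)
  show ?thesis
    unfolding adr_def tmap_def
    by (intro pm_restrict_lin) (auto simp: W_def intro!: fspace_mono[OF *])
qed

lemma tmap_hb_left: "tmap (hb (bas b)) id v = pm_restrict {k. fst k \<noteq> 0} (adl b v)"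
proof (induction v rule: pm_induct)
  case (single k d)
  show ?case
    by (cases k) (auto simp: tmap_single adl_single pm_restrict_scal hb_bas lookup_tensor
        lookup_pm_restrict intro!: poly_mapping_eqI)
qed (simp_all add: tmap_add adl_add pm_restrict_add)

lemma tmap_hb_right: "tmap id (hb (bas b)) v = pm_restrict {k. snd k \<noteq> 0} (adr b v)"
proof (induction v rule: pm_induct)
  case (single k d)
  show ?case
    by (cases k) (auto simp: tmap_single adr_single pm_restrict_scal hb_bas lookup_tensor
        lookup_pm_restrict intro!: poly_mapping_eqI)
qed (simp_all add: tmap_add adr_add pm_restrict_add)

lemma act2_bas:
  "act2 hb (bas b) v = pm_restrict {k. fst k \<noteq> 0} (adl b v) + pm_restrict {k. snd k \<noteq> 0} (adr b v)"
  by (simp add: act2_def tmap_hb_left tmap_hb_right)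

lemma W_fst: "\<mu> \<noteq> 0 \<Longrightarrow> W \<mu> \<nu> \<inter> {k. fst k \<noteq> 0} = W \<mu> \<nu>"
  and W_snd: "\<nu> \<noteq> 0 \<Longrightarrow> W \<mu> \<nu> \<inter> {k. snd k \<noteq> 0} = W \<mu> \<nu>"
  by (auto simp: W_def)

text \<open>The constant t^0 has weight zero. In weights with both entries nonzero the quotient
  therefore erases nothing, and the action can be computed in the group algebra.\<close>

lemma restrict_W_act2:
  assumes "\<mu> \<noteq> 0" "\<nu> \<noteq> 0"
  shows "pm_restrict (W \<mu> \<nu>) (act2 hb (bas b) v) =
    adl b (pm_restrict (W (\<mu> - lam b) \<nu>) v) + adr b (pm_restrict (W \<mu> (\<nu> - lam b)) v)"
  using assms by (simp add: act2_bas pm_restrict_add pm_restrict_restrict W_fst W_snd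
      restrict_W_adl restrict_W_adr)

lemma restrict_tot_act2:
  "pm_restrict {k. lam (fst k) + lam (snd k) = \<kappa>} (act2 hb (bas b) v) =
    act2 hb (bas b) (pm_restrict {k. lam (fst k) + lam (snd k) = \<kappa> - lam b} v)"
proof -
  have *: "ad b (bas a) \<otimes>\<^sub>t bas c \<in> fspace {k. lam (fst k) = lam b + lam a \<and> snd k = c}" for a c
    using tensor_in_fspace[OF ad_weight[of b a], of "bas c" "{c}"]
    by (auto simp: fspace_def)
  have **: "bas c \<otimes>\<^sub>t ad b (bas a) \<in> fspace {k. lam (snd k) = lam b + lam a \<and> fst k = c}" for a c
    using tensor_in_fspace[OF _ ad_weight[of b a], of "bas c" "{c}"]
    by (auto simp: fspace_def)
  let ?A = "\<lambda>\<kappa>. {k. lam (fst k) + lam (snd k) = \<kappa>}"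
  have 1: "pm_restrict (?A \<kappa>) (adl b v) = adl b (pm_restrict (?A (\<kappa> - lam b)) v)"
    unfolding adl_def tmap_def
    by (intro pm_restrict_lin) (auto intro!: fspace_mono[OF *] simp: algebra_simps)
  have 2: "pm_restrict (?A \<kappa>) (adr b v) = adr b (pm_restrict (?A (\<kappa> - lam b)) v)"
    unfolding adr_def tmap_def
    by (intro pm_restrict_lin) (auto intro!: fspace_mono[OF **] simp: algebra_simps)
  show ?thesis
    by (simp add: act2_bas pm_restrict_add pm_restrict_restrict flip: 1 2) (simp add: Int_commute)
qed

section \<open>Joint kernels of the operators \<open>ad b\<close>, and invariants\<close>

lemma ad_monomial:
  assumes "\<And>i. i \<noteq> j \<Longrightarrow> ham_omega \<epsilon> i b a = 0"
  shows "ad b (bas a) = Poly_Mapping.single (b + a - ham_sigma \<epsilon> j) (ham_omega \<epsilon> j b a)"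
proof -
  have "ad b (bas a) = (\<Sum>i\<in>UNIV. if i = j then Poly_Mapping.single (b + a - ham_sigma \<epsilon> j) (ham_omega \<epsilon> j b a) else 0)"
    unfolding ad_bas using assms by (intro sum.cong) auto
  then show ?thesis by simp
qed

text \<open>If only the j-th summand of the bracket survives on the support of f, then
  \<open>ad b\<close> is a translation with coefficients. Nothing can cancel, so every coefficient
  must vanish.\<close>

lemma ad_monomial_kernel:
  assumes "ad b f = 0" and "\<And>i a. a \<in> Poly_Mapping.keys f \<Longrightarrow> i \<noteq> j \<Longrightarrow> ham_omega \<epsilon> i b a = 0"
    and "a \<in> Poly_Mapping.keys f"
  shows "ham_omega \<epsilon> j b a = 0"
proof -
  let ?s = "\<lambda>a. b + a - ham_sigma \<epsilon> j"
  have "ad b f = lin (\<lambda>a. Poly_Mapping.single (?s a) (ham_omega \<epsilon> j b a)) f"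
    unfolding glin_expand[OF glin_ad, of b f] using assms(2) by (intro lin_cong ad_monomial)
  moreover have "inj ?s" by (auto simp: inj_def)
  ultimately show ?thesis
    using lookup_lin_shift[of ?s "\<lambda>a. ham_omega \<epsilon> j b a" f a] assms(1,3) by (simp add: in_keys_iff)
qed

lemmas omega_simps = ham_omega_def coord_simps coord_scale

text \<open>The test elements read off coordinates of the support. A multiple of
  \<open>\<epsilon> (Inr p)\<close> forces the coordinate at \<open>Inl p\<close> to vanish; weight
  zero, or a multiple of \<open>\<epsilon> (Inl p)\<close>, does so for \<open>Inr p\<close>. Adding
  \<open>\<epsilon> q\<close> then isolates the coordinate conjugate to q, since the
  \<open>p\<close>-th summand is already zero.\<close>

lemma ad_kernel:
  assumes f: "0 \<notin> Poly_Mapping.keys f"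
    and k: "k \<noteq> 0" "ad (of_nat k *s \<epsilon> (Inr p)) f = 0"
    and k': "(\<forall>a\<in>Poly_Mapping.keys f. lam a = 0) \<or> (\<exists>k. k \<noteq> 0 \<and> ad (of_nat k *s \<epsilon> (Inl p)) f = 0)"
    and q: "\<And>q. q \<noteq> Inl p \<Longrightarrow> q \<noteq> Inr p \<Longrightarrow> \<exists>k. ad (of_nat k *s \<epsilon> (Inr p) + \<epsilon> q) f = 0"
  shows "f = 0"
proof -
  have 1: "coord \<epsilon> a (Inl p) = 0" if "a \<in> Poly_Mapping.keys f" for a
    using ad_monomial_kernel[OF k(2) _ that, of p] k(1) by (auto simp: omega_simps)
  have 2: "coord \<epsilon> a (Inr p) = 0" if a: "a \<in> Poly_Mapping.keys f" for a
    using k'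
  proof
    assume "\<forall>a\<in>Poly_Mapping.keys f. lam a = 0"
    then show ?thesis using 1[OF a] a by (simp add: lam_def)
  next
    assume "\<exists>k. k \<noteq> 0 \<and> ad (of_nat k *s \<epsilon> (Inl p)) f = 0"
    then obtain k where k: "k \<noteq> 0" "ad (of_nat k *s \<epsilon> (Inl p)) f = 0" by blast
    show ?thesis
      using ad_monomial_kernel[OF k(2) _ a, of p] k(1) by (auto simp: omega_simps)
  qed
  have 3: "coord \<epsilon> a q = 0" if a: "a \<in> Poly_Mapping.keys f" for a q
  proof (cases "q = Inl p \<or> q = Inr p")
    case True
    then show ?thesis using 1 2 a by auto
  next
    case False
    show ?thesis
    proof (cases q)
      case (Inl i)
      then obtain k where k: "ad (of_nat k *s \<epsilon> (Inr p) + \<epsilon> (Inr i)) f = 0"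
        using q[of "Inr i"] False by auto
      show ?thesis
        using ad_monomial_kernel[OF k _ a, of i] 1 a Inl False
        by (fastforce simp: omega_simps split: if_splits)
    next
      case (Inr i)
      then obtain k where k: "ad (of_nat k *s \<epsilon> (Inr p) + \<epsilon> (Inl i)) f = 0"
        using q[of "Inl i"] False by auto
      show ?thesis
        using ad_monomial_kernel[OF k _ a, of i] 1 a Inr False
        by (fastforce simp: omega_simps split: if_splits)
    qed
  qed
  have "a = 0" if "a \<in> Poly_Mapping.keys f" for a
    using 3[OF that] by (rule coord_eq_0)
  then have "Poly_Mapping.keys f = {}" using f by blast
  then show ?thesis by simp
qed

lemma ad_generic_kernel:
  assumes "finite E" "f \<in> fspace (- {0})" "\<And>b. b \<in> \<Gamma> \<Longrightarrow> lam b \<notin> E \<Longrightarrow> ad b f = 0"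
  shows "f = 0"
proof -
  \<comment> \<open>\<open>\<epsilon> (Inl p)\<close> has weight -1, so both k and -k have to avoid
    E.\<close>
  have "finite (E \<union> uminus ` E)" using assms(1) by simp
  then obtain k :: nat where k: "k \<noteq> 0" "of_nat k \<notin> E \<union> uminus ` E"
    using finite_avoid_nat by blast
  then have k': "- of_nat k \<notin> E" by force
  show ?thesis
  proof (rule ad_kernel[OF _ k(1)])
    show "0 \<notin> Poly_Mapping.keys f" using assms(2) by (auto simp: fspace_def)
    show "ad (of_nat k *s \<epsilon> (Inr p)) f = 0"
      using k by (intro assms(3) scale_in eps_in) simp
    show "(\<forall>a\<in>Poly_Mapping.keys f. lam a = 0) \<or> (\<exists>k. k \<noteq> 0 \<and> ad (of_nat k *s \<epsilon> (Inl p)) f = 0)"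
      using k k' by (intro disjI2 exI[of _ k] conjI assms(3) scale_in eps_in) simp_all
    show "\<exists>k. ad (of_nat k *s \<epsilon> (Inr p) + \<epsilon> q) f = 0" if "q \<noteq> Inl p" "q \<noteq> Inr p" for q
      using k that by (intro exI[of _ k] assms(3) scale_in eps_in add_in) simp
  qed
qed

lemma adl_generic_kernel:
  assumes "finite E" "v \<in> fspace ((- {0}) \<times> UNIV)" "\<And>b. b \<in> \<Gamma> \<Longrightarrow> lam b \<notin> E \<Longrightarrow> adl b v = 0"
  shows "v = 0"
proof (rule slice_eq_0)
  fix c
  show "slice c v = 0"
  proof (rule ad_generic_kernel[OF assms(1) slice_in[OF assms(2)]])
    fix b assume "b \<in> \<Gamma>" "lam b \<notin> E"
    then show "ad b (slice c v) = 0"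
      using assms(3)[of b] slice_tmap_id[OF glin_ad, of c b v] by (simp add: adl_def glin_0[OF glin_slice])
  qed
qed

lemma adr_generic_kernel:
  assumes "finite E" "v \<in> fspace (UNIV \<times> (- {0}))" "\<And>b. b \<in> \<Gamma> \<Longrightarrow> lam b \<notin> E \<Longrightarrow> adr b v = 0"
  shows "v = 0"
proof (rule swap2_eq_0, rule adl_generic_kernel[OF assms(1) swap2_in[OF assms(2)]])
  fix b assume "b \<in> \<Gamma>" "lam b \<notin> E"
  then show "adl b (swap2 v) = 0"
    using assms(3)[of b] by (simp add: adl_def adr_def glin_0[OF glin_swap2] flip: swap2_tmap)
qed

text \<open>If the weight of \<open>b\<close> is far from all weights of \<open>v\<close>, then the two summands of \<open>b \<cdot> v\<close> live in
  different weights of the first factor, so neither can cancel the other.\<close>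

lemma invariants_zero:
  assumes E: "finite E" and v: "v \<in> fspace ((- {0}) \<times> UNIV)"
    and inv: "\<And>b. b \<in> \<Gamma> \<Longrightarrow> lam b \<notin> E \<Longrightarrow> tmap (hb (bas b)) id v + tmap id (\<psi> b) v = 0"
  shows "v = 0"
proof -
  define Wt where "Wt = lam ` fst ` Poly_Mapping.keys v"
  \<comment> \<open>Avoiding the negatives of \<open>Wt\<close> keeps the constant t^0 out of the
    first leg of the result; avoiding the differences moves its weight outside \<open>Wt\<close>.
    The second leg may be any space with any maps \<open>\<psi> b\<close>, which covers triple
    tensors as well.\<close>
  define E' where "E' = E \<union> uminus ` Wt \<union> (\<lambda>(x, y). x - y) ` (Wt \<times> Wt)"
  have "finite E'" using E by (simp add: E'_def Wt_def)
  then show ?thesis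
  proof (rule adl_generic_kernel[OF _ v])
    fix b assume b: "b \<in> \<Gamma>" "lam b \<notin> E'"
    let ?A = "{k. lam (fst k) \<in> Wt}" and ?B = "{a. lam a \<notin> Wt \<and> a \<noteq> 0} \<times> UNIV"
    have A: "v \<in> fspace ({a. lam a \<in> Wt} \<times> UNIV)"
      by (force simp: fspace_def Wt_def)
    have "ad b (bas a) \<in> fspace {a. lam a \<notin> Wt \<and> a \<noteq> 0}" if "lam a \<in> Wt" for a
    proof (rule fspace_mono[OF ad_weight], rule subsetI)
      fix c assume "c \<in> {c. lam c = lam b + lam a}"
      then have c: "lam c = lam b + lam a" by simp
      have "lam c \<notin> Wt"
      proof
        assume "lam c \<in> Wt"
        then have "lam b \<in> (\<lambda>(x, y). x - y) ` (Wt \<times> Wt)"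
          using that c by (intro image_eqI[of _ _ "(lam c, lam a)"]) auto
        then show False using b by (simp add: E'_def)
      qed
      moreover have "c \<noteq> 0"
      proof
        assume "c = 0"
        then have "lam b = - lam a" using c by (simp add: eq_neg_iff_add_eq_0)
        then show False using b that by (auto simp: E'_def)
      qed
      ultimately show "c \<in> {a. lam a \<notin> Wt \<and> a \<noteq> 0}" by simp
    qed
    then have l: "adl b v \<in> fspace ?B"
      unfolding adl_def by (intro tmap_in_fspace[OF A]) auto
    then have "tmap (hb (bas b)) id v = adl b v"
      unfolding tmap_hb_left by (intro pm_restrict_id) (auto intro: fspace_mono)
    then have "pm_restrict ?B (adl b v) + pm_restrict ?B (tmap id (\<psi> b) v) = 0"
      using inv[of b] b by (simp add: E'_def flip: pm_restrict_add)
    moreover have "tmap id (\<psi> b) v \<in> fspace ({a. lam a \<in> Wt} \<times> UNIV)"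
      by (rule tmap_in_fspace[OF A]) (auto intro: fspace_single)
    then have "pm_restrict ?B (tmap id (\<psi> b) v) = 0"
      by (rule pm_restrict_disjoint) auto
    ultimately show "adl b v = 0" using l by (simp add: pm_restrict_id)
  qed
qed

text \<open>If \<open>X * v = Y * v\<close>, the coefficients of v are invariant under translation
  by \<open>(sg, - sg)\<close>. This translation has infinite order, so a nonzero v would have
  infinite support.\<close>

lemma XY_cancel: "(X - Y) * v = 0 \<Longrightarrow> v = 0"
proof (rule ccontr)
  assume eq: "(X - Y) * v = 0" and "v \<noteq> 0"
  then obtain k0 where k0: "k0 \<in> Poly_Mapping.keys v" by (meson all_not_in_conv keys_eq_empty)
  have XY: "X * v = Y * v" using eq by (simp add: left_diff_distrib)
  have step: "Poly_Mapping.lookup v (k + (sg, - sg)) = Poly_Mapping.lookup v k" for k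
    using lookup_bas_mult[of "(sg, 0)" v "k + (sg, 0)"] lookup_bas_mult[of "(0, sg)" v "k + (sg, 0)"] XY
    by (simp add: add_diff_eq[symmetric] diff_add_eq[symmetric])
  define s where "s m = k0 + (of_nat m *s sg, - (of_nat m *s sg))" for m
  have s: "s m \<in> Poly_Mapping.keys v" for m
  proof (induction m)
    case (Suc m)
    have "s (Suc m) = s m + (sg, - sg)"
      by (simp add: s_def vec.scale_left_distrib plus_prod_def)
    then show ?case using Suc step[of "s m"] by (simp add: in_keys_iff)
  qed (simp add: s_def k0 flip: zero_prod_def)
  have "inj s"
    using sg_neq_0 by (auto simp: inj_def s_def)
  then have "infinite (range s)" by (rule range_inj_infinite)
  moreover have "range s \<subseteq> Poly_Mapping.keys v" using s by auto
  ultimately show False using finite_subset finite_keys by blast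
qed

definition "H0 = {a \<in> S. lam a = 0}"

text \<open>Take y to be the sum of t^b over finitely many b with distinct nonzero weights. For f of
  weight zero the terms [t^b, f] lie in different weights, so [y, f] = 0 kills each of them and
  \<open>ad_kernel\<close> gives f = 0. An injective linear map has a linear left inverse.\<close>

lemma ex_sum_ad_left_inverse:
  obtains J :: "('f ^ ('n + 'n)) set" and G where "finite J" "J \<subseteq> \<Gamma>" "\<And>b. b \<in> J \<Longrightarrow> lam b \<noteq> 0"
    "glin G" "\<And>x. G x \<in> fspace H0" "\<And>f. f \<in> fspace H0 \<Longrightarrow> G (\<Sum>b\<in>J. ad b f) = f"
proof -
  obtain kk :: "'n + 'n \<Rightarrow> nat" where kk: "inj kk"
    using finite_imp_inj_to_nat_seg[of "UNIV :: ('n + 'n) set"] by auto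
  \<comment> \<open>One test element of \<open>ad_kernel\<close> for each index. The injection
    \<open>kk\<close> makes the weights distinct, and the successor makes them nonzero.\<close>
  define B where "B q = of_nat (Suc (kk q)) *s \<epsilon> (Inr p) + (if q = Inl p \<or> q = Inr p then 0 else \<epsilon> q)" for q
  have lamB: "lam (B q) = of_nat (Suc (kk q))" for q
    by (auto simp: B_def)
  have injB: "inj B"
    using kk lamB by (metis injI injD of_nat_eq_iff Suc_inject)
  define J where "J = range B"
  define A where "A f = (\<Sum>b\<in>J. ad b f)" for f
  have A_eq: "A f = (\<Sum>q\<in>UNIV. ad (B q) f)" for f
    unfolding A_def J_def using injB by (simp add: sum.reindex)
  have glinA: "glin A"
    by (simp add: A_def linear_into_def glin_add[OF glin_ad] glin_scal[OF glin_ad] sum.distrib fs.scale_sum_right)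
  have inj0: "f = 0" if f: "f \<in> fspace H0" "A f = 0" for f
  proof -
    have w: "ad (B q) f \<in> fspace {c. lam c = lam (B q)}" for q
      unfolding glin_expand[OF glin_ad, of "B q" f] using f(1)
      by (intro lin_in_fspace fspace_mono[OF ad_weight]) (auto simp: fspace_def H0_def)
    have z: "ad (B q) f = 0" for q
    proof -
      have "pm_restrict {c. lam c = lam (B q)} (ad (B q') f) = (if q' = q then ad (B q) f else 0)" for q'
      proof (cases "q' = q")
        case True
        then show ?thesis using pm_restrict_id[OF w] by simp
      next
        case False
        then have "lam (B q') \<noteq> lam (B q)" using injD[OF kk, of q' q] by (auto simp: lamB)
        then show ?thesis using False by (auto intro!: pm_restrict_disjoint[OF w])
      qed
      then have "pm_restrict {c. lam c = lam (B q)} (A f) = ad (B q) f"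
        unfolding A_eq by (simp add: pm_restrict_sum)
      then show ?thesis using f(2) by simp
    qed
    show ?thesis
    proof (rule ad_kernel)
      show "0 \<notin> Poly_Mapping.keys f" using f(1) by (auto simp: fspace_def H0_def)
      show "ad (of_nat (Suc (kk (Inr p))) *s \<epsilon> (Inr p)) f = 0"
        using z[of "Inr p"] by (simp add: B_def)
      show "(\<forall>a\<in>Poly_Mapping.keys f. lam a = 0) \<or> (\<exists>k. k \<noteq> 0 \<and> ad (of_nat k *s \<epsilon> (Inl p)) f = 0)"
        using f(1) by (auto simp: fspace_def H0_def)
      show "\<exists>k. ad (of_nat k *s \<epsilon> (Inr p) + \<epsilon> q) f = 0" if "q \<noteq> Inl p" "q \<noteq> Inr p" for q
        using z[of q] that unfolding B_def by (intro exI[of _ "Suc (kk q)"]) simp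
    qed simp
  qed
  have span: "fs.span (fspace H0) = fspace H0"
    by (rule fs.span_eq_iff[THEN iffD2]) (auto simp: fs.subspace_def fspace_0 fspace_add fspace_scal)
  interpret vector_space_pair "scal :: 'f \<Rightarrow> ('f ^ ('n + 'n) \<Rightarrow>\<^sub>0 'f) \<Rightarrow> _" "scal :: 'f \<Rightarrow> ('f ^ ('n + 'n) \<Rightarrow>\<^sub>0 'f) \<Rightarrow> _" ..
  have "Vector_Spaces.linear scal scal A"
    by unfold_locales (simp_all add: glin_add[OF glinA] glin_scal[OF glinA])
  moreover have "inj_on A (fs.span (fspace H0))"
    unfolding span by (rule inj_onI) (metis inj0 glin_diff[OF glinA] fspace_diff right_minus_eq)
  ultimately obtain G where G: "range G \<subseteq> fs.span (fspace H0)" "Vector_Spaces.linear scal scal G"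
    "\<forall>x\<in>fs.span (fspace H0). G (A x) = x"
    using linear_inj_on_left_inverse by blast
  interpret G: Vector_Spaces.linear "scal :: 'f \<Rightarrow> ('f ^ ('n + 'n) \<Rightarrow>\<^sub>0 'f) \<Rightarrow> _" scal G
    by (rule G(2))
  have "glin G"
    by (simp add: linear_into_def G.add G.scale)
  moreover have "J \<subseteq> \<Gamma>"
    unfolding J_def B_def using eps_in zero_in by (auto intro!: add_in scale_in simp del: of_nat_Suc)
  moreover have "lam b \<noteq> 0" if "b \<in> J" for b
    using that lamB by (auto simp: J_def simp del: of_nat_Suc)
  moreover have "finite J" by (simp add: J_def)
  moreover have "G x \<in> fspace H0" for x
    using G(1) unfolding span by (rule subsetD) (rule rangeI)
  moreover have "G (\<Sum>b\<in>J. ad b f) = f" if "f \<in> fspace H0" for f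
    using G(3) that unfolding span by (simp add: A_def)
  ultimately show thesis
    using that[of J G] by blast
qed

section \<open>The induced bracket on all finitely supported functions\<close>

lemma glin_hb: "glin (hb x)" and glin_hb_left: "glin (\<lambda>x. hb x y)"
  by (simp_all add: ham_br_def linear_into_def hbar_br_add_right hbar_br_add_left
      hbar_br_scal_left hbar_br_scal_right drop0_add drop0_scal)

lemma hb_swap: "hb x y = - hb y x"
  using hbar_br_swap[of \<epsilon> x y] by (simp add: ham_br_def drop0_def single_uminus)

lemma hb_drop0_right: "hb x (drop0 y) = hb x y"
proof -
  have "hbar_br \<epsilon> (Poly_Mapping.single 0 c) x = 0" for c
    using ad_0[of "x"] hbar_br_scal_left[of \<epsilon> c "bas 0" x] by (simp add: ad_def del: single_one)
  then have "hbar_br \<epsilon> x (Poly_Mapping.single 0 c) = 0" for c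
    by (subst hbar_br_swap) simp
  then show ?thesis
    by (simp add: ham_br_def hbar_br_diff_right drop0_def[of y])
qed

lemma hb_jacobi: "hb x (hb y z) + hb y (hb z x) + hb z (hb x y) = 0"
proof -
  have nest: "hb x (hb y z) = drop0 (hbar_br \<epsilon> x (hbar_br \<epsilon> y z))" for x y z
    using hb_drop0_right[of x "hbar_br \<epsilon> y z"] by (simp add: ham_br_def)
  show ?thesis
    by (simp add: nest hbar_br_jacobi[OF eps] drop0_def[of 0] flip: drop0_add)
qed

lemma hb_hb: "hb (hb x y) z = hb x (hb y z) - hb y (hb x z)"
proof -
  have "hb (hb x y) z = - hb z (hb x y)" by (rule hb_swap)
  also have "\<dots> = hb x (hb y z) + hb y (hb z x)"
    using hb_jacobi[of x y z] unfolding add_eq_0_iff by simp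
  also have "hb y (hb z x) = - hb y (hb x z)"
    using hb_swap[of z x] glin_diff[OF glin_hb, of y 0 "hb x z"] glin_0[OF glin_hb, of y] by simp
  finally show ?thesis by simp
qed

sublocale pm_lie hb
  by unfold_locales (rule glin_hb glin_hb_left hb_swap hb_hb)+

lemma hb_in: "x \<in> fspace S \<Longrightarrow> y \<in> fspace S \<Longrightarrow> hb x y \<in> fspace S"
  unfolding ham_br_def
  by (intro drop0_in hbar_br_closed eps_in' diff_in) (auto intro: fspace_mono)

lemma act2_in: "x \<in> fspace S \<Longrightarrow> v \<in> fspace (S \<times> S) \<Longrightarrow> act2 hb x v \<in> fspace (S \<times> S)"
  unfolding act2_def by (intro fspace_add tmap_in_fspace) (auto intro: hb_in fspace_single)

text \<open>Derivations into the tensor square, taken as linear maps on all finitely supported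
  functions so that the conditions need testing only on basis vectors.
  \<open>derivation_inner\<close> extends a given derivation to this form.\<close>

definition der :: "(('f ^ ('n + 'n) \<Rightarrow>\<^sub>0 'f) \<Rightarrow> (('f ^ ('n + 'n)) \<times> ('f ^ ('n + 'n)) \<Rightarrow>\<^sub>0 'f)) \<Rightarrow> bool"
  where "der d \<longleftrightarrow> glin d \<and> (\<forall>b\<in>S. d (bas b) \<in> fspace (S \<times> S)) \<and>
    (\<forall>b\<in>S. \<forall>c\<in>S. d (hb (bas b) (bas c)) = act2 hb (bas b) (d (bas c)) - act2 hb (bas c) (d (bas b)))"

lemma der_glin: "der d \<Longrightarrow> glin d"
  and der_in: "der d \<Longrightarrow> b \<in> S \<Longrightarrow> d (bas b) \<in> fspace (S \<times> S)"
  and der_br: "der d \<Longrightarrow> b \<in> S \<Longrightarrow> c \<in> S \<Longrightarrow>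
    d (hb (bas b) (bas c)) = act2 hb (bas b) (d (bas c)) - act2 hb (bas c) (d (bas b))"
  by (simp_all add: der_def)

lemma der_diff_inner:
  assumes "der d" "r \<in> fspace (S \<times> S)"
  shows "der (\<lambda>x. d x - act2 hb x r)"
  unfolding der_def
proof (intro conjI ballI)
  show "glin (\<lambda>x. d x - act2 hb x r)"
    using der_glin[OF assms(1)] glin_act2_left[of r]
    by (simp add: linear_into_def fs.scale_right_diff_distrib)
  show "d (bas b) - act2 hb (bas b) r \<in> fspace (S \<times> S)" if "b \<in> S" for b
    by (rule fspace_diff[OF der_in[OF assms(1) that] act2_in[OF fspace_single[OF that] assms(2)]])
  show "d (hb (bas b) (bas c)) - act2 hb (hb (bas b) (bas c)) r =
      act2 hb (bas b) (d (bas c) - act2 hb (bas c) r) - act2 hb (bas c) (d (bas b) - act2 hb (bas b) r)"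
    if "b \<in> S" "c \<in> S" for b c
    using that assms(1) by (simp add: der_br act2_br glin_diff[OF glin_act2])
qed

section \<open>First normalisation: the value at t^\<sigma>\<close>

lemma lookup_act2_sg:
  assumes "v \<in> fspace (S \<times> S)"
  shows "Poly_Mapping.lookup (act2 hb (bas sg) v) k = (lam (fst k) + lam (snd k)) * Poly_Mapping.lookup v k"
proof (cases "k \<in> S \<times> S")
  case True
  then show ?thesis
    by (auto simp: act2_bas lookup_add lookup_pm_restrict lookup_adl_sg lookup_adr_sg distrib_right)
next
  case False
  then have "Poly_Mapping.lookup v k = 0" using assms unfolding fspace_lookup by blast
  then show ?thesis
    by (simp add: act2_bas lookup_add lookup_pm_restrict lookup_adl_sg lookup_adr_sg)
qed

abbreviation "tot k \<equiv> lam (fst k) + lam (snd k)"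

lemma act2_tot: "v \<in> fspace {k. tot k = \<kappa>} \<Longrightarrow> act2 hb (bas b) v \<in> fspace {k. tot k = lam b + \<kappa>}"
  using restrict_tot_act2[of "lam b + \<kappa>" b v] pm_restrict_in'[of "{k. tot k = lam b + \<kappa>}" "act2 hb (bas b) v"]
  by (simp add: pm_restrict_id)

lemma hb_sg: "b \<noteq> 0 \<Longrightarrow> hb (bas sg) (bas b) = lam b \<odot> bas b"
  by (simp add: hb_bas ad_sg pm_restrict_single)

lemma sg_in: "sg \<in> S"
  using sigma_in sg_neq_0 by auto

lemma act2_invariants_zero:
  assumes "finite E" "v \<in> fspace (S \<times> S)" "\<And>b. b \<in> \<Gamma> \<Longrightarrow> lam b \<notin> E \<Longrightarrow> act2 hb (bas b) v = 0"
  shows "v = 0"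
  using assms invariants_zero[of E v "\<lambda>b. hb (bas b)"] fspace_mono[OF assms(2), of "(- {0}) \<times> UNIV"]
  by (auto simp: act2_def)

text \<open>t^\<sigma> multiplies each coefficient by its total weight, so the part of nonzero total
  weight is an inner value, found by division. For the rest w, the cocycle condition on
  [t^\<sigma>, t^b] gives t^b . w the factor \<open>tot k - lam b\<close>; as t^b . w has total
  weight \<open>lam b\<close>, it vanishes, and w is invariant.\<close>

lemma der_sg_zero:
  assumes d: "der d"
  shows "\<exists>r\<in>fspace (S \<times> S). d (bas sg) = act2 hb (bas sg) r"
proof -
  \<comment> \<open>The inverse of the total weight; the value 0 leaves total weight zero
    untouched.\<close>
  define g where "g k = (if tot k = 0 then 0 else inverse (tot k))" for k
  define r where "r = lin (\<lambda>k. Poly_Mapping.single k (g k)) (d (bas sg))"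
  have in1: "d (bas sg) \<in> fspace (S \<times> S)" using d sg_in by (rule der_in)
  have lr: "Poly_Mapping.lookup r k = Poly_Mapping.lookup (d (bas sg)) k * g k" for k
    unfolding r_def using lookup_lin_shift[of id g] by simp
  have r: "r \<in> fspace (S \<times> S)"
    using in1 by (auto simp: fspace_lookup lr)
  define d' where "d' = (\<lambda>x. d x - act2 hb x r)"
  have d': "der d'" unfolding d'_def using d r by (rule der_diff_inner)
  define w where "w = d' (bas sg)"
  have w0: "w \<in> fspace {k. tot k = 0}"
    unfolding w_def d'_def fspace_lookup lookup_minus lookup_act2_sg[OF r] lr
    by (auto simp: g_def)
  have w1: "w \<in> fspace (S \<times> S)"
    unfolding w_def using d' sg_in by (rule der_in)
  have "w = 0"
  proof (rule act2_invariants_zero[OF finite.emptyI w1])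
    fix b assume b: "b \<in> \<Gamma>"
    show "act2 hb (bas b) w = 0"
    proof (cases "b = 0")
      case True
      have "act2 hb 0 w = 0" by (rule glin_0[OF glin_act2_left])
      moreover have "hb (bas 0) = hb 0"
        by (simp add: fun_eq_iff hb_bas ad_0 glin_0[OF glin_hb_left] del: single_one)
      ultimately show ?thesis using True by (simp add: act2_def)
    next
      case False
      with b have b: "b \<in> S" by simp
      have "lam b \<odot> d' (bas b) = act2 hb (bas sg) (d' (bas b)) - act2 hb (bas b) w"
        using der_br[OF d' sg_in b] False by (simp add: hb_sg glin_scal[OF der_glin[OF d']] w_def del: scal_single)
      then have *: "Poly_Mapping.lookup (act2 hb (bas b) w) k = (tot k - lam b) * Poly_Mapping.lookup (d' (bas b)) k" for k
        by (metis (no_types, lifting) diff_eq_eq eq_diff_eq lookup_act2_sg[OF der_in[OF d' b]] lookup_minus lookup_scal left_diff_distrib add.commute)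
      have "act2 hb (bas b) w \<in> fspace {k. tot k = lam b}"
        using act2_tot[OF w0, of b] by simp
      then show ?thesis
        using * by (intro poly_mapping_eqI) (force simp: fspace_lookup)
    qed
  qed
  then show ?thesis using r by (auto simp: w_def d'_def)
qed

text \<open>Applied to [t^\<sigma>, t^b], the cocycle condition makes d(t^b) an eigenvector of
  t^\<sigma> for the eigenvalue \<open>lam b\<close>.\<close>

lemma der_tot:
  assumes d: "der d" "d (bas sg) = 0" and b: "b \<in> S"
  shows "d (bas b) \<in> fspace {k. tot k = lam b}"
proof -
  have "lam b \<odot> d (bas b) = act2 hb (bas sg) (d (bas b))"
    using der_br[OF d(1) sg_in b] b d(2) glin_0[OF glin_act2, of hb "bas b"]
    by (simp add: hb_sg glin_scal[OF der_glin[OF d(1)]] del: scal_single)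
  then have *: "lam b * Poly_Mapping.lookup (d (bas b)) k = tot k * Poly_Mapping.lookup (d (bas b)) k" for k
    using lookup_act2_sg[OF der_in[OF d(1) b], of k] by (metis lookup_scal)
  show ?thesis
    unfolding fspace_lookup
  proof (intro allI impI)
    fix k assume "k \<notin> {k. tot k = lam b}"
    then show "Poly_Mapping.lookup (d (bas b)) k = 0" using *[of k] by simp
  qed
qed

lemma W_lookup:
  "pm_restrict (W \<mu> \<nu>) v = 0 \<longleftrightarrow> (\<forall>k. lam (fst k) = \<mu> \<longrightarrow> lam (snd k) = \<nu> \<longrightarrow> Poly_Mapping.lookup v k = 0)"
  by (auto simp: W_def poly_mapping_eq_iff fun_eq_iff lookup_pm_restrict)

lemma der_W_zero:
  assumes d: "der d" "d (bas sg) = 0" and b: "b \<in> S" and "\<mu> + \<nu> \<noteq> lam b"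
  shows "pm_restrict (W \<mu> \<nu>) (d (bas b)) = 0"
  unfolding W_lookup
proof (intro allI impI)
  fix k assume "lam (fst k) = \<mu>" "lam (snd k) = \<nu>"
  then have "k \<notin> {k. tot k = lam b}" using assms(4) by simp
  then show "Poly_Mapping.lookup (d (bas b)) k = 0" by (rule fspaceD[OF der_tot[OF d b]])
qed

section \<open>Second normalisation: the value at t^(2\<sigma>)\<close>

definition h2 where "h2 = sg + sg"

definition h3 where "h3 = h2 + sg"

lemma lam_h [simp]: "lam h2 = 0" "lam h3 = 0"
  unfolding h2_def h3_def lam_add by simp_all

lemma h_in: "h2 \<in> S" "h3 \<in> S"
proof -
  have "coord \<epsilon> h2 (Inl p) = 2" "coord \<epsilon> h3 (Inl p) = 3"
    unfolding h2_def h3_def coord_simps coord_sigma by simp_all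
  then have "h2 \<noteq> 0" "h3 \<noteq> 0" using coord_simps(3) by (metis zero_neq_numeral)+
  moreover have "h2 \<in> \<Gamma>" "h3 \<in> \<Gamma>"
    unfolding h2_def h3_def by (intro add_in sigma_in)+
  ultimately show "h2 \<in> S" "h3 \<in> S" by auto
qed

lemma ad_h: "ad h2 (bas b) = (2 * lam b) \<odot> bas (b + sg)" "ad h3 (bas b) = (3 * lam b) \<odot> bas (b + sg + sg)"
proof -
  show 1: "ad h2 (bas b) = (2 * lam b) \<odot> bas (b + sg)"
    using ad_sg_left[of sg b, folded h2_def]
    by (simp add: ad_sg mult_single add.commute[of sg b] flip: single_add)
  show "ad h3 (bas b) = (3 * lam b) \<odot> bas (b + sg + sg)"
    using ad_sg_left[of h2 b, folded h3_def] unfolding 1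
    by (simp add: mult_single add.commute[of _ b] add.left_commute[of _ b] flip: single_add)
      (simp add: h2_def add.assoc mult_2[symmetric] flip: single_add)
qed

lemma hb_h2: "lam b \<noteq> 0 \<Longrightarrow> hb (bas h2) (bas b) = (2 * lam b) \<odot> bas (b + sg)"
  and hb_h3: "lam b \<noteq> 0 \<Longrightarrow> hb (bas h3) (bas b) = (3 * lam b) \<odot> bas (b + sg + sg)"
proof -
  assume "lam b \<noteq> 0"
  then have "lam (b + sg) \<noteq> 0" "lam (b + sg + sg) \<noteq> 0" by (simp_all only: lam_add lam_sigma add.right_neutral not_False_eq_True)
  then have "b + sg \<noteq> 0" "b + sg + sg \<noteq> 0" using lam_0 by metis+
  then show "hb (bas h2) (bas b) = (2 * lam b) \<odot> bas (b + sg)"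
    "hb (bas h3) (bas b) = (3 * lam b) \<odot> bas (b + sg + sg)"
    unfolding hb_bas ad_h pm_restrict_scal pm_restrict_single by simp_all
qed

lemma hb_h2_h3: "hb (bas h2) (bas h3) = 0"
  by (simp add: hb_bas ad_h)

text \<open>Scalars are embedded as constants of the group algebra, so that they obey the same ring
  calculus as \<open>X\<close> and \<open>Y\<close>.\<close>

abbreviation C :: "'f \<Rightarrow> (('f ^ ('n + 'n)) \<times> ('f ^ ('n + 'n)) \<Rightarrow>\<^sub>0 'f)" where "C c \<equiv> Poly_Mapping.single 0 c"

lemma adl_h: "adl h2 u = 2 * X * adl sg u" "adl h3 u = 3 * X\<^sup>2 * adl sg u"
proof -
  show 1: "adl h2 u = 2 * X * adl sg u" for u
    using adl_add_sg[of sg u, folded h2_def] by (simp add: algebra_simps)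
  have "bas (h2, 0) = X * X" by (simp add: mult_single h2_def)
  then show "adl h3 u = 3 * X\<^sup>2 * adl sg u"
    using adl_add_sg[of h2 u, folded h3_def] unfolding 1 by (simp add: algebra_simps power2_eq_square)
qed

lemma adr_h: "adr h2 u = 2 * Y * adr sg u" "adr h3 u = 3 * Y\<^sup>2 * adr sg u"
proof -
  show 1: "adr h2 u = 2 * Y * adr sg u" for u
    using adr_add_sg[of sg u, folded h2_def] by (simp add: algebra_simps)
  have "bas (0, h2) = Y * Y" by (simp add: mult_single h2_def)
  then show "adr h3 u = 3 * Y\<^sup>2 * adr sg u"
    using adr_add_sg[of h2 u, folded h3_def] unfolding 1 by (simp add: algebra_simps power2_eq_square)
qed

lemma sg_restrict_W:
  "adl sg (pm_restrict (W \<mu> \<nu>) v) = C \<mu> * pm_restrict (W \<mu> \<nu>) v"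
  "adr sg (pm_restrict (W \<mu> \<nu>) v) = C \<nu> * pm_restrict (W \<mu> \<nu>) v"
proof -
  let ?v = "pm_restrict (W \<mu> \<nu>) v"
  have "?v \<in> fspace {k. lam (fst k) = \<mu>}" "?v \<in> fspace {k. lam (snd k) = \<nu>}"
    by (rule fspace_mono[OF pm_restrict_in'], force simp: W_def)+
  then show "adl sg ?v = C \<mu> * ?v" "adr sg ?v = C \<nu> * ?v"
    by (simp_all add: adl_sg adr_sg flip: scal_eq_mult)
qed

lemma act2_h:
  assumes "\<mu> \<noteq> 0" "\<nu> \<noteq> 0"
  shows "pm_restrict (W \<mu> \<nu>) (act2 hb (bas h2) v) = 2 * (C \<mu> * X + C \<nu> * Y) * pm_restrict (W \<mu> \<nu>) v"
    and "pm_restrict (W \<mu> \<nu>) (act2 hb (bas h3) v) = 3 * (C \<mu> * X\<^sup>2 + C \<nu> * Y\<^sup>2) * pm_restrict (W \<mu> \<nu>) v"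
  using assms by (simp_all add: restrict_W_act2 adl_h adr_h sg_restrict_W algebra_simps)

lemma C_cancel: "c \<noteq> 0 \<Longrightarrow> C c * v = 0 \<Longrightarrow> v = 0"
  by (simp add: fs.scale_eq_0_iff flip: scal_eq_mult)

lemma C_numeral: "C (numeral m) = numeral m"
  by (simp add: single_numeral)

abbreviation "Gw \<mu> \<equiv> {a \<in> \<Gamma>. lam a = \<mu>}"

lemma restrict_W_in:
  "v \<in> fspace (S \<times> S) \<Longrightarrow> pm_restrict (W \<mu> \<nu>) v \<in> fspace (Gw \<mu> \<times> Gw \<nu>)"
  by (rule fspace_mono[OF pm_restrict_in]) (auto simp: W_def)

lemma adl_in: "b \<in> \<Gamma> \<Longrightarrow> v \<in> fspace (Gw \<mu> \<times> Gw \<nu>) \<Longrightarrow> adl b v \<in> fspace (Gw (lam b + \<mu>) \<times> Gw \<nu>)"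
  unfolding adl_def
proof (rule tmap_in_fspace, assumption)
  fix a assume "b \<in> \<Gamma>" "a \<in> Gw \<mu>"
  then have "ad b (bas a) \<in> fspace (\<Gamma> \<inter> {c. lam c = lam b + lam a})"
    using ad_weight[of b a] ad_in[of a b] by (simp add: fspace_def)
  then show "ad b (bas a) \<in> fspace (Gw (lam b + \<mu>))"
    by (rule fspace_mono) (use \<open>a \<in> Gw \<mu>\<close> in auto)
qed (auto intro: fspace_single)

lemma three_cancel: "- 3 * z = 0 \<Longrightarrow> z = 0" for z :: "('f ^ ('n + 'n)) \<times> ('f ^ ('n + 'n)) \<Rightarrow>\<^sub>0 'f"
  using C_cancel[of 3 z] by (simp add: C_numeral)

lemma scal_numeral:
  "(2 * c) \<odot> z = 2 * C c * z" "(3 * c) \<odot> z = 3 * C c * z"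
  using mult_single[of "0 :: ('f ^ ('n + 'n)) \<times> ('f ^ ('n + 'n))" 2 0 c]
    mult_single[of "0 :: ('f ^ ('n + 'n)) \<times> ('f ^ ('n + 'n))" 3 0 c] by (simp_all add: scal_eq_mult C_numeral)

lemma C_uminus: "C (- c) = - C c"
  by (simp add: single_uminus)

lemma der_h3_ring_identity:
  fixes n X Y u2 u3 :: "'a::comm_ring_1"
  shows "- n * ((X - Y) * (2 * u3 - 3 * (X + Y) * u2)) =
    2 * (- n * X + n * Y) * u3 - 3 * (- n * X\<^sup>2 + n * Y\<^sup>2) * u2"
  by (simp add: algebra_simps power2_eq_square)

text \<open>The elimination behind \<open>der_W_identity\<close>: the combination of the three
  relations is chosen so that e1 and e2 drop out. The coefficient of e is governed by
  (m+n)(mX^2+nY^2) - (mX+nY)^2 = mn(X-Y)^2.\<close>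

lemma der_W_ring_identity:
  fixes m n X Y e A A' B B' e1 e2 :: "'a::comm_ring_1"
  shows "- 3 * (- 2 * m * n * (X - Y)\<^sup>2 * e
      - (m * ((X - Y) * A + (m + n) * B) + n * ((Y - X) * A' + (m + n) * B'))) =
    3 * (m + n) * (2 * (m + n) * e2 - 2 * (m * X + n * Y) * e1 + (X * A - n * B + (Y * A' - m * B')))
    - (m + n) * (6 * (m + n) * e2 - 6 * (m * X\<^sup>2 + n * Y\<^sup>2) * e
      + 3 * (X * A - (m + n) * B + Y * A + (Y * A' - (m + n) * B' + X * A')))
    + 3 * (m * X + n * Y) * (2 * (m + n) * e1 - 2 * (m * X + n * Y) * e + (A + A'))"
  by (simp add: algebra_simps power2_eq_square)

text \<open>t^(2\<sigma>) and t^(3\<sigma>) commute. In weight (-\<nu>, \<nu>) they act as -2\<nu>(X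
  - Y) and -3\<nu>(X^2 - Y^2), and the common factor X - Y can be cancelled.\<close>

lemma der_h3_W:
  assumes d: "der d" and \<nu>: "\<nu> \<noteq> 0"
  shows "2 * pm_restrict (W (- \<nu>) \<nu>) (d (bas h3)) = 3 * (X + Y) * pm_restrict (W (- \<nu>) \<nu>) (d (bas h2))"
proof -
  let ?u2 = "pm_restrict (W (- \<nu>) \<nu>) (d (bas h2))" and ?u3 = "pm_restrict (W (- \<nu>) \<nu>) (d (bas h3))"
  have "act2 hb (bas h2) (d (bas h3)) = act2 hb (bas h3) (d (bas h2))"
    using der_br[OF d h_in] by (simp add: hb_h2_h3 glin_0[OF der_glin[OF d]])
  from arg_cong[OF this, of "pm_restrict (W (- \<nu>) \<nu>)"]
  have "2 * (C (- \<nu>) * X + C \<nu> * Y) * ?u3 - 3 * (C (- \<nu>) * X\<^sup>2 + C \<nu> * Y\<^sup>2) * ?u2 = 0"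
    using \<nu> act2_h[of "- \<nu>" \<nu>] by (simp only: right_minus_eq neg_equal_0_iff_equal not_False_eq_True)
  moreover have "C (- \<nu>) * ((X - Y) * (2 * ?u3 - 3 * (X + Y) * ?u2)) =
      2 * (C (- \<nu>) * X + C \<nu> * Y) * ?u3 - 3 * (C (- \<nu>) * X\<^sup>2 + C \<nu> * Y\<^sup>2) * ?u2"
    unfolding C_uminus by (rule der_h3_ring_identity)
  ultimately have "C (- \<nu>) * ((X - Y) * (2 * ?u3 - 3 * (X + Y) * ?u2)) = 0"
    by (simp only:)
  then have "2 * ?u3 - 3 * (X + Y) * ?u2 = 0"
    using \<nu> C_cancel[of "- \<nu>"] XY_cancel neg_equal_0_iff_equal by blast
  then show ?thesis by (simp only: right_minus_eq)
qed

text \<open>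
  Computing \<open>d t\<^bsup>b + 2\<sigma>\<^esup>\<close> both from \<open>[t\<^bsup>2\<sigma>\<^esup>, [t\<^bsup>2\<sigma>\<^esup>, t\<^sup>b]]\<close> and from \<open>[t\<^bsup>3\<sigma>\<^esup>, t\<^sup>b]\<close>.
\<close>

lemma der_W_identity:
  assumes d: "der d" and b: "b \<in> S" and lb: "lam b = \<mu> + \<nu>"
    and nz: "\<mu> \<noteq> 0" "\<nu> \<noteq> 0" "lam b \<noteq> 0"
  defines "u \<equiv> pm_restrict (W (- \<nu>) \<nu>) (d (bas h2))"
    and "u' \<equiv> pm_restrict (W \<mu> (- \<mu>)) (d (bas h2))"
  shows "- 2 * C \<mu> * C \<nu> * (X - Y)\<^sup>2 * pm_restrict (W \<mu> \<nu>) (d (bas b)) =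
    C \<mu> * ((X - Y) * adl b u + C (lam b) * bas (b, 0) * u) +
    C \<nu> * ((Y - X) * adr b u' + C (lam b) * bas (0, b) * u')"
proof -
  let ?R = "pm_restrict (W \<mu> \<nu>)"
  define l \<beta> \<beta>' where "l = C (lam b)" and "\<beta> = (bas (b, 0 :: 'f ^ ('n + 'n)) :: _ \<Rightarrow>\<^sub>0 'f)"
    and "\<beta>' = (bas (0 :: 'f ^ ('n + 'n), b) :: _ \<Rightarrow>\<^sub>0 'f)"
  define M N where "M = C \<mu> * X + C \<nu> * Y" and "N = C \<mu> * X\<^sup>2 + C \<nu> * Y\<^sup>2"
  define e e1 e2 where "e = ?R (d (bas b))" and "e1 = ?R (d (bas (b + sg)))" and "e2 = ?R (d (bas (b + sg + sg)))"
  have bs: "b + sg \<in> S" "b + sg + sg \<in> S"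
  proof -
    have "lam (b + sg) \<noteq> 0" "lam (b + sg + sg) \<noteq> 0"
      using nz(3) by (simp_all only: lam_add lam_sigma add.right_neutral not_False_eq_True)
    then have "b + sg \<noteq> 0" "b + sg + sg \<noteq> 0" using lam_0 by metis+
    moreover have "b + sg \<in> \<Gamma>" "b + sg + sg \<in> \<Gamma>"
      using b by (intro add_in sigma_in; simp)+
    ultimately show "b + sg \<in> S" "b + sg + sg \<in> S" by auto
  qed
  have lbs: "lam (b + sg) = lam b" by simp
  \<comment> \<open>Only the components of weight (-\<nu>, \<nu>) and (\<mu>, -\<mu>) of
    d(t^(2\<sigma>)) can reach weight (\<mu>, \<nu>) under t^b.\<close>
  have W: "W (\<mu> - lam b) \<nu> = W (- \<nu>) \<nu>" "W \<mu> (\<nu> - lam b) = W \<mu> (- \<mu>)"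
    by (simp_all add: lb)
  have l: "l = C \<mu> + C \<nu>" by (simp add: l_def lb single_add)
  note dl = glin_scal[OF der_glin[OF d]]
  have E1: "2 * l * e1 = 2 * M * e - (adl b u + adr b u')"
  proof -
    have "(2 * lam b) \<odot> d (bas (b + sg)) = act2 hb (bas h2) (d (bas b)) - act2 hb (bas b) (d (bas h2))"
      using der_br[OF d h_in(1) b] by (simp only: hb_h2[OF nz(3)] dl)
    from arg_cong[OF this, of ?R] show ?thesis
      unfolding pm_restrict_scal pm_restrict_diff act2_h[OF nz(1,2)]
      unfolding restrict_W_act2[OF nz(1,2)] lbs W scal_numeral u_def u'_def M_def l_def e_def e1_def .
  qed
  have E2: "2 * l * e2 = 2 * M * e1 - (adl (b + sg) u + adr (b + sg) u')"
  proof -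
    have "(2 * lam b) \<odot> d (bas (b + sg + sg)) = act2 hb (bas h2) (d (bas (b + sg))) - act2 hb (bas (b + sg)) (d (bas h2))"
      using der_br[OF d h_in(1) bs(1)] hb_h2[of "b + sg"] nz(3) by (simp only: lbs dl not_False_eq_True simp_thms)
    from arg_cong[OF this, of ?R] show ?thesis
      unfolding pm_restrict_scal pm_restrict_diff act2_h[OF nz(1,2)]
      unfolding restrict_W_act2[OF nz(1,2)] lbs W scal_numeral u_def u'_def M_def l_def e2_def e1_def .
  qed
  define u3 u3' where "u3 = pm_restrict (W (- \<nu>) \<nu>) (d (bas h3))" and "u3' = pm_restrict (W \<mu> (- \<mu>)) (d (bas h3))"
  have E3: "3 * l * e2 = 3 * N * e - (adl b u3 + adr b u3')"
  proof -
    have "(3 * lam b) \<odot> d (bas (b + sg + sg)) = act2 hb (bas h3) (d (bas b)) - act2 hb (bas b) (d (bas h3))"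
      using der_br[OF d h_in(2) b] by (simp only: hb_h3[OF nz(3)] dl)
    from arg_cong[OF this, of ?R] show ?thesis
      unfolding pm_restrict_scal pm_restrict_diff act2_h[OF nz(1,2)]
      unfolding restrict_W_act2[OF nz(1,2)] lbs W scal_numeral u3_def u3'_def N_def l_def e_def e2_def .
  qed
  have u3: "2 * u3 = 3 * (X + Y) * u" "2 * u3' = 3 * (X + Y) * u'"
    using der_h3_W[OF d nz(2)] der_h3_W[OF d, of "- \<mu>"] nz(1) by (simp_all add: u_def u'_def u3_def u3'_def)
  have n2: "2 * z = z + z" and n3: "3 * z = z + z + z" for z :: "('f ^ ('n + 'n)) \<times> ('f ^ ('n + 'n)) \<Rightarrow>\<^sub>0 'f"
    by (simp_all add: algebra_simps)
  \<comment> \<open>Doubling allows u3 to be replaced by u through \<open>der_h3_W\<close> without a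
    division.\<close>
  have F1: "2 * adl b u3 = 3 * (X * adl b u - l * \<beta> * u + Y * adl b u)"
  proof -
    have "2 * adl b u3 = adl b (2 * u3)" by (simp only: n2 adl_add)
    also have "\<dots> = 3 * (adl b (X * u) + adl b (Y * u))"
      by (simp only: u3 mult.assoc n3 distrib_right adl_add)
    finally show ?thesis
      unfolding adl_X adl_Y scal_eq_mult by (simp add: l_def \<beta>_def algebra_simps)
  qed
  have F2: "2 * adr b u3' = 3 * (Y * adr b u' - l * \<beta>' * u' + X * adr b u')"
  proof -
    have "2 * adr b u3' = adr b (2 * u3')" by (simp only: n2 adr_add)
    also have "\<dots> = 3 * (adr b (X * u') + adr b (Y * u'))"
      by (simp only: u3 mult.assoc n3 distrib_right adr_add)
    finally show ?thesis
      unfolding adr_X adr_Y scal_eq_mult by (simp add: l_def \<beta>'_def algebra_simps)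
  qed
  have G1: "adl (b + sg) u = X * adl b u - C \<nu> * \<beta> * u"
    unfolding adl_add_sg u_def sg_restrict_W \<beta>_def C_uminus by (simp add: mult_ac)
  have G2: "adr (b + sg) u' = Y * adr b u' - C \<mu> * \<beta>' * u'"
    unfolding adr_add_sg u'_def sg_restrict_W \<beta>'_def C_uminus by (simp add: mult_ac)
  define A A' B B' where "A = adl b u" and "A' = adr b u'" and "B = \<beta> * u" and "B' = \<beta>' * u'"
  have D1: "2 * l * e1 - 2 * M * e + (A + A') = 0"
    using E1 by (simp add: A_def A'_def)
  have D2: "2 * l * e2 - 2 * M * e1 + (X * A - C \<nu> * B + (Y * A' - C \<mu> * B')) = 0"
    using E2 unfolding G1 G2 by (simp add: A_def A'_def B_def B'_def mult.assoc)
  have D3: "6 * l * e2 - 6 * N * e + 3 * (X * A - l * B + Y * A + (Y * A' - l * B' + X * A')) = 0"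
  proof -
    have "2 * (3 * l * e2) = 2 * (3 * N * e) - (2 * adl b u3 + 2 * adr b u3')"
      unfolding E3 by (simp add: algebra_simps)
    then show ?thesis
      unfolding F1 F2 by (simp add: A_def A'_def B_def B'_def algebra_simps)
  qed
  let ?L = "- 2 * C \<mu> * C \<nu> * (X - Y)\<^sup>2 * e" and ?RR = "C \<mu> * ((X - Y) * A + l * B) + C \<nu> * ((Y - X) * A' + l * B')"
  have "- 3 * (?L - ?RR) = 3 * l * (2 * l * e2 - 2 * M * e1 + (X * A - C \<nu> * B + (Y * A' - C \<mu> * B')))
      - l * (6 * l * e2 - 6 * N * e + 3 * (X * A - l * B + Y * A + (Y * A' - l * B' + X * A')))
      + 3 * M * (2 * l * e1 - 2 * M * e + (A + A'))"
    unfolding l M_def N_def by (rule der_W_ring_identity)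
  then have "- 3 * (?L - ?RR) = 0"
    unfolding D1 D2 D3 by simp
  then have "?L - ?RR = 0"
    by (rule three_cancel)
  then show ?thesis
    unfolding e_def A_def A'_def B_def B'_def \<beta>_def \<beta>'_def l_def right_minus_eq mult.assoc .
qed

lemma XY_mult_in: "v \<in> fspace (Gw \<mu> \<times> Gw \<nu>) \<Longrightarrow> (X - Y) * v \<in> fspace (Gw \<mu> \<times> Gw \<nu>)"
  unfolding left_diff_distrib
  by (intro fspace_diff bas_mult_in[where A = "Gw \<mu> \<times> Gw \<nu>"]) (auto intro!: add_in sigma_in)

text \<open>For b far away the other component u' in \<open>der_W_identity\<close> vanishes, and the
  identity exhibits a monomial multiple of u as a multiple of \<open>X - Y\<close>. Monomials are
  invertible, and 2(C(-\<nu>) X + C(\<nu>) Y) is -2\<nu>(X - Y).\<close>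

lemma der_h2_component:
  assumes d: "der d" "d (bas sg) = 0" and \<nu>: "\<nu> \<noteq> 0"
  shows "\<exists>r\<in>fspace (Gw (- \<nu>) \<times> Gw \<nu>).
    pm_restrict (W (- \<nu>) \<nu>) (d (bas h2)) = 2 * (C (- \<nu>) * X + C \<nu> * Y) * r"
proof -
  let ?w = "d (bas h2)"
  define u where "u = pm_restrict (W (- \<nu>) \<nu>) ?w"
  \<comment> \<open>Avoiding \<nu> makes \<mu> nonzero; avoiding the image set makes \<mu> differ
    from every first weight in d(t^(2\<sigma>)).\<close>
  have "finite (insert \<nu> ((\<lambda>k. lam (fst k) + \<nu>) ` Poly_Mapping.keys ?w))" by simp
  then obtain k :: nat where k: "k \<noteq> 0" "of_nat k \<notin> insert \<nu> ((\<lambda>k. lam (fst k) + \<nu>) ` Poly_Mapping.keys ?w)"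
    using finite_avoid_nat by blast
  define b where "b = of_nat k *s \<epsilon> (Inr p)"
  define \<mu> where "\<mu> = of_nat k - \<nu>"
  have lb: "lam b = \<mu> + \<nu>" "lam b \<noteq> 0" and \<mu>: "\<mu> \<noteq> 0"
    using k by (auto simp: b_def \<mu>_def)
  have b\<Gamma>: "b \<in> \<Gamma>" unfolding b_def by (intro scale_in eps_in)
  then have b: "b \<in> S" using lb(2) by auto
  have u': "pm_restrict (W \<mu> (- \<mu>)) ?w = 0"
    unfolding W_lookup
  proof (intro allI impI)
    fix q :: "('f ^ ('n + 'n)) \<times> ('f ^ ('n + 'n))"
    assume q: "lam (fst q) = \<mu>"
    { assume "q \<in> Poly_Mapping.keys ?w"
      then have "of_nat k \<in> (\<lambda>k. lam (fst k) + \<nu>) ` Poly_Mapping.keys ?w"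
        using q by (intro image_eqI[of _ _ q]) (simp_all add: \<mu>_def)
      then have False using k(2) by simp }
    then show "Poly_Mapping.lookup ?w q = 0" by (auto simp: in_keys_iff)
  qed
  let ?e = "pm_restrict (W \<mu> \<nu>) (d (bas b))"
  have w_in: "?w \<in> fspace (S \<times> S)" using d(1) h_in(1) by (rule der_in)
  have u_in: "u \<in> fspace (Gw (- \<nu>) \<times> Gw \<nu>)" unfolding u_def using w_in by (rule restrict_W_in)
  have e_in: "?e \<in> fspace (Gw \<mu> \<times> Gw \<nu>)" by (intro restrict_W_in der_in d b)
  \<comment> \<open>The cofactor of \<open>X - Y\<close> after \<mu> is cancelled and the term with
    \<open>adl b u\<close> is moved to the other side.\<close>
  define y where "y = (- 2 * \<nu>) \<odot> ((X - Y) * ?e) - adl b u"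
  have "lam b + - \<nu> = \<mu>" by (simp add: lb)
  then have y_in: "y \<in> fspace (Gw \<mu> \<times> Gw \<nu>)"
    unfolding y_def using adl_in[OF b\<Gamma> u_in] e_in by (intro fspace_diff fspace_scal XY_mult_in) simp_all
  have "C \<mu> * (C (lam b) * bas (b, 0) * u - (X - Y) * y) = 0"
  proof -
    have "- 2 * C \<mu> * C \<nu> * (X - Y)\<^sup>2 * ?e = C \<mu> * ((X - Y) * adl b u + C (lam b) * bas (b, 0) * u)"
      using der_W_identity[OF d(1) b lb(1) \<mu> \<nu> lb(2)] u' by (simp add: u_def)
    moreover have "C (- 2 * \<nu>) = - (2 * C \<nu>)"
      using scal_numeral(1)[of "\<nu>" "1"] by (simp add: scal_eq_mult C_uminus)
    ultimately show ?thesis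
      unfolding y_def scal_eq_mult by (simp add: algebra_simps power2_eq_square)
  qed
  then have eq: "C (lam b) * bas (b, 0) * u = (X - Y) * y"
    using C_cancel[OF \<mu>] by (metis right_minus_eq)
  define r where "r = (- inverse (2 * \<nu> * lam b)) \<odot> (bas (- b, 0) * y)"
  have r_in: "r \<in> fspace (Gw (- \<nu>) \<times> Gw \<nu>)"
    unfolding r_def
    by (intro fspace_scal bas_mult_in[OF y_in]) (auto simp: lb(1) diff_in b\<Gamma> uminus_in add_in)
  have "bas (- b, 0 :: 'f ^ ('n + 'n)) * bas (b, 0) = (1 :: _ \<Rightarrow>\<^sub>0 'f)"
    by (simp add: mult_single flip: zero_prod_def)
  then have "C (lam b) * u = bas (- b, 0) * (C (lam b) * bas (b, 0) * u)"
    by (metis (no_types, lifting) mult.assoc mult.left_commute mult.left_neutral)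
  also have "\<dots> = (X - Y) * (bas (- b, 0) * y)"
    unfolding eq by (simp only: mult.left_commute)
  finally have u: "C (lam b) * u = (X - Y) * (bas (- b, 0) * y)" .
  have r: "C (- 2 * \<nu> * lam b) * r = bas (- b, 0) * y"
    unfolding r_def using \<nu> lb(2) by (simp add: field_simps flip: scal_eq_mult)
  have cm: "C (- 2 * \<nu> * lam b) = C (lam b) * C (- 2 * \<nu>)"
    by (simp add: mult_single mult_ac)
  have "C (lam b) * (u - (X - Y) * (C (- 2 * \<nu>) * r)) = 0"
    unfolding right_diff_distrib u r[symmetric] cm by (simp add: mult_ac)
  then have "u = (X - Y) * (C (- 2 * \<nu>) * r)"
    using C_cancel[OF lb(2)] by (metis right_minus_eq)
  also have "C (- 2 * \<nu>) = - (2 * C \<nu>)"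
    using scal_numeral(1)[of "\<nu>" "1"] by (simp add: scal_eq_mult C_uminus)
  finally have "u = 2 * (C (- \<nu>) * X + C \<nu> * Y) * r"
    by (simp add: C_uminus algebra_simps)
  then show ?thesis using r_in by (auto simp: u_def)
qed

text \<open>Only finitely many weights occur, so the local solutions can be summed. The sum has
  total weight zero; hence subtracting its inner derivation preserves d(t^\<sigma>) = 0.\<close>

lemma der_h2_zero:
  assumes d: "der d" "d (bas sg) = 0"
  shows "\<exists>r\<in>fspace (S \<times> S). act2 hb (bas sg) r = 0 \<and>
    (\<forall>\<nu>. \<nu> \<noteq> 0 \<longrightarrow> pm_restrict (W (- \<nu>) \<nu>) (d (bas h2)) = pm_restrict (W (- \<nu>) \<nu>) (act2 hb (bas h2) r))"
proof -
  let ?w = "d (bas h2)"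
  define N where "N = (\<lambda>k. lam (snd k)) ` Poly_Mapping.keys ?w - {0}"
  have N: "finite N" by (simp add: N_def)
  have "\<forall>\<nu>. \<exists>r. \<nu> \<noteq> 0 \<longrightarrow> r \<in> fspace (Gw (- \<nu>) \<times> Gw \<nu>) \<and>
      pm_restrict (W (- \<nu>) \<nu>) ?w = 2 * (C (- \<nu>) * X + C \<nu> * Y) * r"
    using der_h2_component[OF d] by blast
  then obtain f where f: "\<And>\<nu>. \<nu> \<noteq> 0 \<Longrightarrow> f \<nu> \<in> fspace (Gw (- \<nu>) \<times> Gw \<nu>)"
    "\<And>\<nu>. \<nu> \<noteq> 0 \<Longrightarrow> pm_restrict (W (- \<nu>) \<nu>) ?w = 2 * (C (- \<nu>) * X + C \<nu> * Y) * f \<nu>"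
    using choice[of "\<lambda>\<nu> r. \<nu> \<noteq> 0 \<longrightarrow> r \<in> fspace (Gw (- \<nu>) \<times> Gw \<nu>) \<and>
      pm_restrict (W (- \<nu>) \<nu>) ?w = 2 * (C (- \<nu>) * X + C \<nu> * Y) * r"] by blast
  define r where "r = (\<Sum>\<nu>\<in>N. f \<nu>)"
  have f_in: "f \<nu> \<in> fspace (S \<times> S)" "f \<nu> \<in> fspace (W (- \<nu>) \<nu>)" if "\<nu> \<noteq> 0" for \<nu>
    using that by (auto intro!: fspace_mono[OF f(1)] simp: W_def)
  have r: "r \<in> fspace (S \<times> S)"
    unfolding r_def by (intro fspace_sum f_in) (auto simp: N_def)
  have rW: "pm_restrict (W (- \<nu>) \<nu>) r = (if \<nu> \<in> N then f \<nu> else 0)" if "\<nu> \<noteq> 0" for \<nu>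
  proof -
    have "pm_restrict (W (- \<nu>) \<nu>) (f \<nu>') = (if \<nu>' = \<nu> then f \<nu> else 0)" if "\<nu>' \<in> N" for \<nu>'
    proof -
      have "\<nu>' \<noteq> 0" using that by (simp add: N_def)
      note i = f_in(2)[OF this]
      show ?thesis
        using pm_restrict_id[OF i] pm_restrict_disjoint[OF i, of "W (- \<nu>) \<nu>"]
        by (cases "\<nu>' = \<nu>") (simp_all add: W_Int)
    qed
    then show ?thesis by (simp add: r_def pm_restrict_sum N)
  qed
  have "act2 hb (bas sg) r = 0"
  proof (rule poly_mapping_eqI)
    fix k
    have "f \<nu> \<in> fspace {k. tot k = 0}" if "\<nu> \<in> N" for \<nu>
      using that by (intro fspace_mono[OF f_in(2)]) (auto simp: N_def W_def)
    then have "r \<in> fspace {k. tot k = 0}" unfolding r_def by (rule fspace_sum)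
    then show "Poly_Mapping.lookup (act2 hb (bas sg) r) k = Poly_Mapping.lookup 0 k"
      using fspaceD[of r "{k. tot k = 0}" k] by (cases "tot k = 0") (simp_all add: lookup_act2_sg[OF r])
  qed
  moreover have "pm_restrict (W (- \<nu>) \<nu>) ?w = pm_restrict (W (- \<nu>) \<nu>) (act2 hb (bas h2) r)" if \<nu>: "\<nu> \<noteq> 0" for \<nu>
  proof (cases "\<nu> \<in> N")
    case True
    have "pm_restrict (W (- \<nu>) \<nu>) (act2 hb (bas h2) r) = 2 * (C (- \<nu>) * X + C \<nu> * Y) * f \<nu>"
      using act2_h(1)[of "- \<nu>" \<nu> r] rW[OF \<nu>] \<nu> True by simp
    then show ?thesis using f(2)[OF \<nu>] by simp
  next
    case False
    then have "Poly_Mapping.lookup ?w k = 0" if "lam (snd k) = \<nu>" for k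
      using that \<nu> by (auto simp: N_def in_keys_iff)
    then have "pm_restrict (W (- \<nu>) \<nu>) ?w = 0" by (simp add: W_lookup)
    moreover have "pm_restrict (W (- \<nu>) \<nu>) (act2 hb (bas h2) r) = 0"
      using act2_h(1)[of "- \<nu>" \<nu> r] rW[OF \<nu>] \<nu> False by simp
    ultimately show ?thesis by simp
  qed
  ultimately show ?thesis using r by blast
qed

text \<open>Now the right-hand side of \<open>der_W_identity\<close> is zero, and
  \<open>X - Y\<close> is cancelled twice.\<close>

lemma der_mixed_zero:
  assumes d: "der d" "d (bas sg) = 0"
    and h2: "\<And>\<nu>. \<nu> \<noteq> 0 \<Longrightarrow> pm_restrict (W (- \<nu>) \<nu>) (d (bas h2)) = 0"
    and b: "b \<in> S" "lam b \<noteq> 0" and nz: "\<mu> \<noteq> 0" "\<nu> \<noteq> 0"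
  shows "pm_restrict (W \<mu> \<nu>) (d (bas b)) = 0"
proof (cases "lam b = \<mu> + \<nu>")
  case True
  let ?e = "pm_restrict (W \<mu> \<nu>) (d (bas b))"
  have "- 2 * C \<mu> * C \<nu> * (X - Y)\<^sup>2 * ?e = 0"
    using der_W_identity[OF d(1) b(1) True nz b(2)] h2[OF nz(2)] h2[of "- \<mu>"] nz by simp
  moreover have "C \<mu> * (C (- 2 * \<nu>) * ((X - Y) * ((X - Y) * ?e))) = - 2 * C \<mu> * C \<nu> * (X - Y)\<^sup>2 * ?e"
  proof -
    have "C (- 2 * \<nu>) = - (2 * C \<nu>)"
      using scal_numeral(1)[of "\<nu>" "1"] by (simp add: scal_eq_mult C_uminus)
    then show ?thesis by (simp add: power2_eq_square mult_ac)
  qed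
  ultimately have "C \<mu> * (C (- 2 * \<nu>) * ((X - Y) * ((X - Y) * ?e))) = 0" by (simp only:)
  then have "C (- 2 * \<nu>) * ((X - Y) * ((X - Y) * ?e)) = 0"
    by (rule C_cancel[OF nz(1)])
  then have "(X - Y) * ((X - Y) * ?e) = 0"
    by (rule C_cancel[rotated]) (use nz(2) in simp)
  then show ?thesis
    by (rule XY_cancel[OF XY_cancel])
next
  case False
  then show ?thesis using der_W_zero[OF d b(1)] by metis
qed

section \<open>Third normalisation: components with one leg of weight zero\<close>

lemma act2_H0:
  assumes r: "r \<in> fspace (H0 \<times> H0)" and b: "b \<in> S" "lam b \<noteq> 0"
  shows "act2 hb (bas b) r = adl b r + adr b r"
    and "adl b r \<in> fspace (Gw (lam b) \<times> H0)" and "adr b r \<in> fspace (H0 \<times> Gw (lam b))"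
proof -
  have w: "ad b (bas a) \<in> fspace (Gw (lam b))" if "a \<in> H0" for a
    using ad_weight[of b a] ad_in[of a b] that b by (auto simp: fspace_lookup H0_def)
  show l: "adl b r \<in> fspace (Gw (lam b) \<times> H0)"
    unfolding adl_def by (rule tmap_in_fspace[OF r], erule w) (auto intro: fspace_single)
  show rr: "adr b r \<in> fspace (H0 \<times> Gw (lam b))"
    unfolding adr_def by (rule tmap_in_fspace[OF r]) (auto intro: fspace_single w)
  have "pm_restrict {k. fst k \<noteq> 0} (adl b r) = adl b r" "pm_restrict {k. snd k \<noteq> 0} (adr b r) = adr b r"
    using b by (auto intro!: pm_restrict_id fspace_mono[OF l] fspace_mono[OF rr])
  then show "act2 hb (bas b) r = adl b r + adr b r"
    unfolding act2_bas by simp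
qed

text \<open>Each d(t^b) is P b + Q b, with weight zero in the second and in the first leg
  respectively. The target is one r with P b = \<open>adl b r\<close> and Q b =
  \<open>adr b r\<close>; the compatibility \<open>comm\<close> of the two families determines
  it.\<close>

lemma der_inner_aux:
  assumes d: "der d" "d (bas sg) = 0"
    and h2: "\<And>\<nu>. \<nu> \<noteq> 0 \<Longrightarrow> pm_restrict (W (- \<nu>) \<nu>) (d (bas h2)) = 0"
  shows "\<exists>r\<in>fspace (S \<times> S). \<forall>b\<in>S. lam b \<noteq> 0 \<longrightarrow> d (bas b) = act2 hb (bas b) r"
proof -
  have mixed: "pm_restrict (W \<mu> \<nu>) (d (bas b)) = 0"
    if "b \<in> S" "lam b \<noteq> 0" "\<mu> \<noteq> 0" "\<nu> \<noteq> 0" for b \<mu> \<nu>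
    using der_mixed_zero[OF d _ that] h2 by blast
  define P where "P b = pm_restrict (W (lam b) 0) (d (bas b))" for b
  define Q where "Q b = pm_restrict (W 0 (lam b)) (d (bas b))" for b
  have PQ: "d (bas b) = P b + Q b" if b: "b \<in> S" "lam b \<noteq> 0" for b
  proof (rule poly_mapping_eqI)
    fix k
    obtain a c :: "'f ^ ('n + 'n)" where k: "k = (a, c)" by force
    consider "lam a \<noteq> 0" "lam c \<noteq> 0" | "tot k \<noteq> lam b" | "lam a = lam b" "lam c = 0" | "lam a = 0" "lam c = lam b"
      by (cases "tot k = lam b"; cases "lam a = 0"; cases "lam c = 0") (auto simp: k)
    then show "Poly_Mapping.lookup (d (bas b)) k = Poly_Mapping.lookup (P b + Q b) k"
    proof cases
      case 1
      then show ?thesis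
        using mixed[OF b 1] unfolding W_lookup
        by (simp add: k lookup_add P_def Q_def lookup_pm_restrict W_def)
    next
      case 2
      then show ?thesis
        using fspaceD[OF der_tot[OF d b(1)], of k]
        by (simp add: k lookup_add P_def Q_def lookup_pm_restrict W_def)
    qed (use b in \<open>auto simp: k lookup_add P_def Q_def lookup_pm_restrict W_def\<close>)
  qed
  have P_in: "P b \<in> fspace (S \<times> H0)" and Q_in: "Q b \<in> fspace (H0 \<times> S)" if "b \<in> S" for b
    unfolding P_def Q_def
    by (rule fspace_mono[OF pm_restrict_in[OF der_in[OF d(1) that]]], auto simp: W_def H0_def)+
  \<comment> \<open>This is the cocycle condition in weight (\<open>lam b'\<close>,
    \<open>lam b\<close>). There d of the bracket vanishes, since the bracket has nonzero weight; as
    the two weights differ, the other two terms are mixed components and vanish too.\<close>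
  have comm: "adr b (P b') = adl b' (Q b)"
    if b: "b \<in> S" "b' \<in> S" "lam b \<noteq> 0" "lam b' \<noteq> 0" "lam b + lam b' \<noteq> 0" "lam b \<noteq> lam b'" for b b'
  proof -
    let ?Z = "W (lam b') (lam b)"
    have "ad b (bas b') \<in> fspace (Gw (lam b + lam b'))"
      using ad_weight[of b b'] ad_in[of b' b] b by (auto simp: fspace_lookup)
    then have "hb (bas b) (bas b') \<in> fspace (Gw (lam b + lam b'))"
      unfolding hb_bas by (auto intro!: fspace_mono[OF pm_restrict_in])
    then have "pm_restrict ?Z (d (hb (bas b) (bas b'))) = lin (\<lambda>a. 0) (hb (bas b) (bas b'))"
      unfolding glin_expand[OF der_glin[OF d(1)], of "hb (bas b) (bas b')"] glin_of_lin[OF glin_pm_restrict]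
      using b by (intro lin_cong mixed) (auto simp: fspace_def)
    also have "\<dots> = 0" by (simp add: lin_def)
    finally have "pm_restrict ?Z (act2 hb (bas b) (d (bas b'))) = pm_restrict ?Z (act2 hb (bas b') (d (bas b)))"
      unfolding der_br[OF d(1) b(1,2)] pm_restrict_diff right_minus_eq .
    then show ?thesis
      using b mixed[OF b(1,3), of "lam b'" "lam b - lam b'"] mixed[OF b(2,4), of "lam b' - lam b" "lam b"]
      by (simp add: restrict_W_act2 P_def Q_def)
  qed
  obtain J :: "('f ^ ('n + 'n)) set" and G where J: "finite J" "J \<subseteq> \<Gamma>" "\<And>b. b \<in> J \<Longrightarrow> lam b \<noteq> 0"
    and G: "glin G" "\<And>x. G x \<in> fspace H0" "\<And>f. f \<in> fspace H0 \<Longrightarrow> G (\<Sum>b\<in>J. ad b f) = f"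
    using ex_sum_ad_left_inverse by blast
  have JS: "b \<in> S" if "b \<in> J" for b using that J(2) J(3)[OF that] by auto
  \<comment> \<open>If Q b = \<open>adr b r\<close> is to hold on J, the sum of the Q b is y acting
    on the second leg of r, and G recovers r from it.\<close>
  define r where "r = tmap id G (\<Sum>b\<in>J. Q b)"
  have "(\<Sum>b\<in>J. Q b) \<in> fspace (H0 \<times> S)" using JS by (intro fspace_sum Q_in)
  then have r: "r \<in> fspace (H0 \<times> H0)"
    unfolding r_def by (rule tmap_in_fspace) (auto intro: G(2) fspace_single)
  \<comment> \<open>The weights for which \<open>comm\<close> cannot be applied with every b in
    J.\<close>
  define E where "E = insert 0 (lam ` J \<union> (\<lambda>b. - lam b) ` J)"
  have E: "finite E" using J(1) by (simp add: E_def)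
  have P_far: "P b' = adl b' r" if b': "b' \<in> S" "lam b' \<notin> E" for b'
  proof -
    have glin_sum_ad: "glin (\<lambda>f. \<Sum>b\<in>J. ad b f)"
      by (simp add: linear_into_def glin_add[OF glin_ad] glin_scal[OF glin_ad] sum.distrib fs.scale_sum_right)
    have "P b' = tmap id G (tmap id (\<lambda>f. \<Sum>b\<in>J. ad b f) (P b'))"
      unfolding tmap_tmap[OF glin_id G(1)]
      using tmap_cong[OF P_in[OF b'(1)], of id id "G \<circ> (\<lambda>f. \<Sum>b\<in>J. ad b f)" id] G(3) by (simp add: fspace_single)
    also have "tmap id (\<lambda>f. \<Sum>b\<in>J. ad b f) (P b') = (\<Sum>b\<in>J. adr b (P b'))"
      by (simp add: tmap_sum_fun_right adr_def)
    also have "\<dots> = (\<Sum>b\<in>J. adl b' (Q b))"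
    proof (intro sum.cong refl comm)
      fix b assume b: "b \<in> J"
      show "b \<in> S" by (rule JS[OF b])
      show "b' \<in> S" by (rule b'(1))
      show "lam b \<noteq> 0" by (rule J(3)[OF b])
      show "lam b' \<noteq> 0" using b' by (auto simp: E_def)
      have "lam b \<in> E" "- lam b \<in> E" using b by (simp_all add: E_def)
      then show "lam b \<noteq> lam b'" "lam b + lam b' \<noteq> 0"
        using b'(2) by (auto simp: add_eq_0_iff)
    qed
    also have "\<dots> = adl b' (\<Sum>b\<in>J. Q b)" by (simp add: glin_sum[OF glin_adl])
    also have "tmap id G \<dots> = adl b' r"
      unfolding r_def adl_def by (rule tmap_commute[OF glin_ad G(1), symmetric])
    finally show ?thesis .
  qed
  \<comment> \<open>From far P to all Q: \<open>comm\<close> against every far b' shows that the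
    difference lies in a joint kernel. The same argument with the roles exchanged then gives all
    P.\<close>
  have Q: "Q b = adr b r" if b: "b \<in> S" "lam b \<noteq> 0" for b
  proof -
    have "Q b - adr b r = 0"
    proof (rule adl_generic_kernel[of "E \<union> {lam b, - lam b}"])
      show "Q b - adr b r \<in> fspace ((- {0}) \<times> UNIV)"
        by (intro fspace_diff fspace_mono[OF Q_in[OF b(1)]] fspace_mono[OF act2_H0(3)[OF r b]])
          (auto simp: H0_def)
      fix b' assume b': "b' \<in> \<Gamma>" "lam b' \<notin> E \<union> {lam b, - lam b}"
      then have "lam b' \<noteq> 0" "b' \<in> S" by (auto simp: E_def)
      then have "adl b' (Q b) = adr b (P b')"
        using b b' by (intro comm[symmetric]) (auto simp: add_eq_0_iff)
      also have "\<dots> = adr b (adl b' r)" using P_far[of b'] b' \<open>b' \<in> S\<close> by simp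
      also have "\<dots> = adl b' (adr b r)"
        unfolding adl_def adr_def by (rule tmap_commute[OF glin_ad glin_ad, symmetric])
      finally show "adl b' (Q b - adr b r) = 0" by (simp add: adl_diff)
    qed (use E in simp)
    then show ?thesis by simp
  qed
  have P: "P b' = adl b' r" if b': "b' \<in> S" "lam b' \<noteq> 0" for b'
  proof -
    have "P b' - adl b' r = 0"
    proof (rule adr_generic_kernel[of "{0, lam b', - lam b'}"])
      show "P b' - adl b' r \<in> fspace (UNIV \<times> (- {0}))"
        by (intro fspace_diff fspace_mono[OF P_in[OF b'(1)]] fspace_mono[OF act2_H0(2)[OF r b']])
          (auto simp: H0_def)
      fix b assume b: "b \<in> \<Gamma>" "lam b \<notin> {0, lam b', - lam b'}"
      then have "lam b \<noteq> 0" "b \<in> S" by auto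
      then have "adr b (P b') = adl b' (Q b)"
        using b b' by (intro comm) (auto simp: add_eq_0_iff2)
      also have "\<dots> = adl b' (adr b r)" using Q \<open>b \<in> S\<close> \<open>lam b \<noteq> 0\<close> by simp
      also have "\<dots> = adr b (adl b' r)"
        unfolding adl_def adr_def by (rule tmap_commute[OF glin_ad glin_ad])
      finally show "adr b (P b' - adl b' r) = 0" by (simp add: adr_diff)
    qed simp
    then show ?thesis by simp
  qed
  have "r \<in> fspace (S \<times> S)" by (rule fspace_mono[OF r]) (auto simp: H0_def)
  then show ?thesis
    using act2_H0(1)[OF r] PQ P Q by (intro bexI[of _ r]) auto
qed

text \<open>After the three subtractions d3 vanishes in nonzero weight. For c of weight zero and b
  of nonzero weight, [t^b, t^c] has nonzero weight, so the cocycle condition makes d3(t^c) invariant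
  under all such b, hence zero.\<close>

theorem der_inner:
  assumes d: "der d"
  shows "\<exists>r\<in>fspace (S \<times> S). \<forall>x\<in>fspace S. d x = act2 hb x r"
proof -
  obtain r1 where r1: "r1 \<in> fspace (S \<times> S)" "d (bas sg) = act2 hb (bas sg) r1"
    using der_sg_zero[OF d] by blast
  define d1 where "d1 = (\<lambda>x. d x - act2 hb x r1)"
  have d1: "der d1" "d1 (bas sg) = 0"
    unfolding d1_def using d r1 by (auto intro: der_diff_inner)
  obtain r2 where r2: "r2 \<in> fspace (S \<times> S)" "act2 hb (bas sg) r2 = 0"
    "\<And>\<nu>. \<nu> \<noteq> 0 \<Longrightarrow> pm_restrict (W (- \<nu>) \<nu>) (d1 (bas h2)) = pm_restrict (W (- \<nu>) \<nu>) (act2 hb (bas h2) r2)"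
    using der_h2_zero[OF d1] by blast
  define d2 where "d2 = (\<lambda>x. d1 x - act2 hb x r2)"
  have d2: "der d2" "d2 (bas sg) = 0"
    unfolding d2_def using d1 r2 by (auto intro: der_diff_inner)
  have "pm_restrict (W (- \<nu>) \<nu>) (d2 (bas h2)) = 0" if "\<nu> \<noteq> 0" for \<nu>
    using r2(3)[OF that] by (simp add: d2_def pm_restrict_diff)
  then obtain r3 where r3: "r3 \<in> fspace (S \<times> S)" "\<And>b. b \<in> S \<Longrightarrow> lam b \<noteq> 0 \<Longrightarrow> d2 (bas b) = act2 hb (bas b) r3"
    using der_inner_aux[OF d2] by blast
  define d3 where "d3 = (\<lambda>x. d2 x - act2 hb x r3)"
  have d3: "der d3" unfolding d3_def using d2(1) r3(1) by (rule der_diff_inner)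
  have zero: "d3 (bas b) = 0" if "b \<in> S" "lam b \<noteq> 0" for b
    using r3(2)[OF that] by (simp add: d3_def)
  have all: "d3 (bas c) = 0" if c: "c \<in> S" for c
  proof (cases "lam c = 0")
    case True
    show ?thesis
    proof (rule act2_invariants_zero[of "{0}"])
      show "d3 (bas c) \<in> fspace (S \<times> S)" using d3 c by (rule der_in)
      fix b assume b: "b \<in> \<Gamma>" "lam b \<notin> {0}"
      then have bS: "b \<in> S" by auto
      have "ad b (bas c) \<in> fspace (Gw (lam b))"
        using ad_weight[of b c] ad_in[of c b] b c True by (auto simp: fspace_lookup)
      then have "hb (bas b) (bas c) \<in> fspace (Gw (lam b))"
        unfolding hb_bas by (auto intro!: fspace_mono[OF pm_restrict_in])
      then have "d3 (hb (bas b) (bas c)) = lin (\<lambda>a. 0) (hb (bas b) (bas c))"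
        unfolding glin_expand[OF der_glin[OF d3], of "hb (bas b) (bas c)"]
        using b by (intro lin_cong zero) (auto simp: fspace_def)
      then have "act2 hb (bas b) (d3 (bas c)) - act2 hb (bas c) (d3 (bas b)) = 0"
        using der_br[OF d3 bS c] by (simp add: lin_def)
      then show "act2 hb (bas b) (d3 (bas c)) = 0"
        using zero[OF bS] b by (simp add: glin_0[OF glin_act2])
    qed simp
  next
    case False
    then show ?thesis using zero c by blast
  qed
  let ?r = "r1 + r2 + r3"
  have "d x = act2 hb x ?r" if x: "x \<in> fspace S" for x
  proof -
    have "d3 x = lin (\<lambda>a. 0) x"
      unfolding glin_expand[OF der_glin[OF d3], of x] using x by (intro lin_cong all) (auto simp: fspace_def)
    then have "d3 x = 0" by (simp add: lin_def)
    then show ?thesis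
      by (simp add: d3_def d2_def d1_def glin_add[OF glin_act2] algebra_simps)
  qed
  moreover have "?r \<in> fspace (S \<times> S)" using r1 r2 r3 by (intro fspace_add)
  ultimately show ?thesis by blast
qed

section \<open>The centre, triple tensors and bialgebra structures\<close>

lemma hb_center:
  assumes f: "f \<in> fspace S" "\<And>y. hb f y = 0"
  shows "f = 0"
proof (rule ad_generic_kernel)
  \<comment> \<open>Away from these weights the bracket with f has no constant term, so
    \<open>ad b f\<close> agrees with the bracket in the quotient.\<close>
  show "finite ((\<lambda>a. - lam a) ` Poly_Mapping.keys f)" by simp
  show "f \<in> fspace (- {0})" by (rule fspace_mono[OF f(1)]) auto
  fix b assume b: "lam b \<notin> (\<lambda>a. - lam a) ` Poly_Mapping.keys f"
  have "ad b f \<in> fspace (- {0})"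
    unfolding glin_expand[OF glin_ad, of b f]
  proof (rule lin_in_fspace, rule fspace_mono[OF ad_weight], safe)
    fix a assume "a \<in> Poly_Mapping.keys f" "lam 0 = lam b + lam a"
    then have "lam b \<in> (\<lambda>a. - lam a) ` Poly_Mapping.keys f"
      by (intro image_eqI[of _ _ a]) (simp_all add: eq_neg_iff_add_eq_0)
    then show False using b by blast
  qed
  then have "ad b f = hb (bas b) f" by (simp add: hb_bas pm_restrict_id)
  also have "\<dots> = 0" using hb_swap[of "bas b" f] f(2) by simp
  finally show "ad b f = 0" .
qed

lemma hb_centerless: "\<forall>f\<in>fspace S. (\<forall>y. hb f y = 0) \<longrightarrow> f = 0"
  using hb_center by blast

lemma hb_closed: "\<forall>x\<in>fspace S. \<forall>y\<in>fspace S. hb x y \<in> fspace S"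
  using hb_in by blast

lemmas cybe_quad = cybe_eq_quad[OF hb_centerless hb_closed]

text \<open>A triple tensor is treated as one leg tensored with a pair; the action on the pair plays
  the role of \<open>\<psi>\<close> in \<open>invariants_zero\<close>.\<close>

lemma act3_invariants_zero:
  assumes c: "c \<in> fspace (S \<times> S \<times> S)" "\<And>x. x \<in> fspace S \<Longrightarrow> act3 hb x c = 0"
  shows "c = 0"
proof (rule invariants_zero[of "{0}"])
  show "c \<in> fspace ((- {0}) \<times> UNIV)" by (rule fspace_mono[OF c(1)]) auto
  fix b assume "b \<in> \<Gamma>" "lam b \<notin> {0}"
  then have "b \<in> S" by auto
  then have "act3 hb (bas b) c = 0" by (intro c(2) fspace_single)
  moreover have "tmap id id = (id :: (('f ^ ('n + 'n)) \<times> ('f ^ ('n + 'n)) \<Rightarrow>\<^sub>0 'f) \<Rightarrow> _)"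
    by (simp add: fun_eq_iff)
  ultimately show "tmap (hb (bas b)) id c
      + tmap id (\<lambda>z. tmap (hb (bas b)) id z + tmap id (hb (bas b)) z) c = 0"
    by (simp add: act3_def tmap_add_fun_right add_ac)
qed simp

lemma derivation_inner:
  assumes d: "linear_into (fspace S) (fspace (S \<times> S)) d"
    and br: "\<And>x y. x \<in> fspace S \<Longrightarrow> y \<in> fspace S \<Longrightarrow> d (hb x y) = act2 hb x (d y) - act2 hb y (d x)"
  shows "\<exists>r\<in>fspace (S \<times> S). \<forall>x\<in>fspace S. d x = act2 hb x r"
proof -
  define d' where "d' = lin (\<lambda>a. d (bas a))"
  have eq: "d' x = d x" if "x \<in> fspace S" for x
    using lin_unique[of S d x] d that by (auto simp: linear_into_def d'_def)
  have "der d'"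
    unfolding der_def
  proof (intro conjI ballI)
    show "glin d'" unfolding d'_def by (rule glin_lin)
    show "d' (bas b) \<in> fspace (S \<times> S)" if "b \<in> S" for b
      unfolding eq[OF fspace_single[OF that]] using d fspace_single[OF that] unfolding linear_into_def by blast
    show "d' (hb (bas b) (bas c)) = act2 hb (bas b) (d' (bas c)) - act2 hb (bas c) (d' (bas b))"
      if "b \<in> S" "c \<in> S" for b c
      using that by (simp add: eq br hb_in fspace_single)
  qed
  then show ?thesis using der_inner[of d'] eq by auto
qed

lemma Der_eq_Inn: "Der S hb (fspace (S \<times> S)) (act2 hb) = Inn S (fspace (S \<times> S)) (act2 hb)"
proof (intro equalityI subsetI)
  fix d assume d: "d \<in> Der S hb (fspace (S \<times> S)) (act2 hb)"
  then obtain r where "r \<in> fspace (S \<times> S)" "\<forall>x\<in>fspace S. d x = act2 hb x r"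
    using derivation_inner[of d] by (auto simp: Der_def)
  then show "d \<in> Inn S (fspace (S \<times> S)) (act2 hb)"
    using d by (auto simp: Der_def Inn_def fun_eq_iff intro!: exI[of _ r])
next
  fix d assume "d \<in> Inn S (fspace (S \<times> S)) (act2 hb)"
  then obtain r where "r \<in> fspace (S \<times> S)" "d = (\<lambda>x. if x \<in> fspace S then act2 hb x r else 0)"
    unfolding Inn_def by blast
  then show "d \<in> Der S hb (fspace (S \<times> S)) (act2 hb)"
    by (auto simp: Der_def linear_into_def act2_in fspace_add fspace_scal hb_in act2_br
        act2_add_left act2_scal_left)
qed

lemma bialgebra_triangular:
  assumes bi: "lie_bialgebra S hb \<Delta>"
  shows "\<exists>r\<in>skew S. (\<forall>x\<in>fspace S. \<Delta> x = act2 hb x r) \<and> cybe S hb r = 0"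
proof -
  have lin: "linear_into (fspace S) (fspace (S \<times> S)) \<Delta>"
    and sk: "\<And>x. x \<in> fspace S \<Longrightarrow> \<Delta> x \<in> skew S"
    and cojac: "\<And>x. x \<in> fspace S \<Longrightarrow>
      tmap id \<Delta> (\<Delta> x) + cyc (tmap id \<Delta> (\<Delta> x)) + cyc (cyc (tmap id \<Delta> (\<Delta> x))) = 0"
    using bi by (simp_all add: lie_bialgebra_def lie_coalgebra_def Let_def)
  obtain r where r: "r \<in> fspace (S \<times> S)" "\<And>x. x \<in> fspace S \<Longrightarrow> \<Delta> x = act2 hb x r"
    using derivation_inner[OF lin] bi by (auto simp: lie_bialgebra_def)
  have tw: "twist r \<in> fspace (S \<times> S)"
    unfolding twist_eq_swap2 by (rule swap2_in[OF r(1)])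
  have "r + twist r = 0"
  proof (rule act2_invariants_zero[of "{0}"])
    show "r + twist r \<in> fspace (S \<times> S)" using r(1) tw by (rule fspace_add)
    fix b assume "b \<in> \<Gamma>" "lam b \<notin> {0}"
    then have b: "bas b \<in> fspace S" by (auto intro: fspace_single)
    then obtain u where u: "\<Delta> (bas b) = u - twist u" using sk by (auto simp: skew_def)
    have "act2 hb (bas b) (r + twist r) = \<Delta> (bas b) + twist (\<Delta> (bas b))"
      using r(2)[OF b] by (simp add: glin_add[OF glin_act2] twist_act2)
    also have "\<dots> = 0" by (simp add: u glin_diff[OF glin_twist] twist_twist)
    finally show "act2 hb (bas b) (r + twist r) = 0" .
  qed simp
  then have anti: "twist r = - r" by (simp add: eq_neg_iff_add_eq_0 add.commute)
  \<comment> \<open>A skew r is the image of r/2 under 1 - \<tau>.\<close>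
  have "inverse 2 + inverse 2 = (1 :: 'f)" by (simp add: field_simps)
  then have "r = inverse 2 \<odot> r - twist (inverse 2 \<odot> r)"
    using fs.scale_left_distrib[of "inverse 2" "inverse 2" r]
    by (simp only: glin_scal[OF glin_twist] anti fs.scale_minus_right diff_minus_eq_add fs.scale_one)
  moreover have "inverse 2 \<odot> r \<in> fspace (S \<times> S)" using r(1) by (rule fspace_scal)
  ultimately have "r \<in> skew S" unfolding skew_def by (rule image_eqI)
  moreover have "cybe S hb r = 0"
    unfolding cybe_quad(1)[OF r(1)]
  proof (rule act3_invariants_zero[OF cybe_quad(2)[OF r(1)]])
    fix x :: "'f ^ ('n + 'n) \<Rightarrow>\<^sub>0 'f" assume x: "x \<in> fspace S"
    \<comment> \<open>\<Delta> and the inner derivation agree on L only, so the replacement uses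
      that \<Delta> x is supported there.\<close>
    have "tmap id \<Delta> (\<Delta> x) = tmap id (\<lambda>y. act2 hb y r) (act2 hb x r)"
      unfolding r(2)[OF x] by (rule tmap_cong[OF act2_in[OF x r(1)]]) (simp_all add: r(2) fspace_single)
    then show "act3 hb x (quad cy r) = 0"
      using cyclic_sum_eq_act3_cybe[OF anti, of x] cojac[OF x] by simp
  qed
  ultimately show ?thesis using r(2) by blast
qed

lemma cybe_iff_invariant:
  assumes r: "r \<in> fspace (S \<times> S)"
  shows "cybe S hb r = 0 \<longleftrightarrow> (\<forall>x\<in>fspace S. act3 hb x (cybe S hb r) = 0)"
  using act3_invariants_zero[of "quad cy r"] cybe_quad[OF r] glin_0[OF glin_act3] by auto

lemma H1_trivial:
  "H1 S hb (fspace (S \<times> S)) (act2 hb) = {Inn S (fspace (S \<times> S)) (act2 hb)}"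
  by (rule Der_quotient_trivial[OF Der_eq_Inn])
    (simp_all add: fspace_0 fspace_diff glin_diff[OF glin_act2])

end

theorem theorem1p3:
  fixes \<epsilon> :: "'n::finite + 'n \<Rightarrow> 'f::field_char_0 ^ ('n + 'n)"
    and \<Gamma> :: "('f ^ ('n + 'n)) set"
  assumes "0 \<in> \<Gamma>" and "\<And>\<alpha> \<beta>. \<alpha> \<in> \<Gamma> \<Longrightarrow> \<beta> \<in> \<Gamma> \<Longrightarrow> \<alpha> - \<beta> \<in> \<Gamma>"
    and "inj \<epsilon>" and "vec.independent (range \<epsilon>)" and "vec.span (range \<epsilon>) = UNIV"
    and "range \<epsilon> \<subseteq> \<Gamma>"
  shows "(\<forall>\<Delta>. lie_bialgebra (\<Gamma> - {0}) (ham_br \<epsilon>) \<Delta> \<longrightarrow>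
        (\<exists>r\<in>skew (\<Gamma> - {0}).
          (\<forall>x\<in>fspace (\<Gamma> - {0}). \<Delta> x = act2 (ham_br \<epsilon>) x r) \<and>
          cybe (\<Gamma> - {0}) (ham_br \<epsilon>) r = 0)) \<and>
      (\<forall>r\<in>fspace ((\<Gamma> - {0}) \<times> (\<Gamma> - {0})).
        cybe (\<Gamma> - {0}) (ham_br \<epsilon>) r = 0 \<longleftrightarrow>
        (\<forall>x\<in>fspace (\<Gamma> - {0}). act3 (ham_br \<epsilon>) x (cybe (\<Gamma> - {0}) (ham_br \<epsilon>) r) = 0)) \<and>
      H1 (\<Gamma> - {0}) (ham_br \<epsilon>) (fspace ((\<Gamma> - {0}) \<times> (\<Gamma> - {0}))) (act2 (ham_br \<epsilon>)) =
        {Inn (\<Gamma> - {0}) (fspace ((\<Gamma> - {0}) \<times> (\<Gamma> - {0}))) (act2 (ham_br \<epsilon>))}"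
proof -
  \<comment> \<open>Any conjugate pair may serve as \<open>p\<close>; types are inhabited, so
    \<open>undefined\<close> names one.\<close>
  interpret ham \<epsilon> \<Gamma> "undefined :: 'n"
    by (unfold_locales; fact assms)
  show ?thesis
    using bialgebra_triangular cybe_iff_invariant H1_trivial by blast
qed

end
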